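(* Let $d\ge 1$, $t\ge 2$, $q\in\{1,\dots,d\}$, and let $\psi_1,\dots,\psi_t:\mathbb{R}^d\to\mathbb{R}^d$ be affine bijections with $\max_i \mathrm{Lip}(\psi_i)<1$. Let $G\subset\mathbb{R}^d$ be the unique nonempty compact set with $G=\bigcup_{i=1}^t\psi_i(G)$. Assume (F2), (F3), (F4) and $(ND_q)$ (defined in the context), let $F:G\to G$ be the associated expanding map, and let $V\in C^{0,\alpha}(G,\mathbb{R})$ for some $\alpha\in(0,1]$. Let $\beta_{G,V}$, $Q_{G,V}$, $\mu_{G,V}$, $\kappa_{G,V}$, $M_{G,V}$ be as in the context and set $P(V)=\log\beta_{G,V}$. For $x\in G\setminus\mathcal{F}$ let $\iota(x)$ be the unique index $i$ with $x\in\psi_i(G)\setminus\mathcal{F}$. Then $$P(V)=h(\kappa_{G,V})+\int_G V\,d\kappa_{G,V}+\int_G\log\big(Q_{G,V}(x),{}^t\Psi_{\iota(x)}(M_{G,V}(F(x)))\big)_{HS}\,d\kappa_{G,V}(x)$$ $$=\sup_{\{m,M\}\in\mathcal{K}_V}\Big\{h(m)+\int_G V\,dm+\int_G\log\big(Q_{G,V}(x),{}^t\Psi_{\iota(x)}(M(F(x)))\big)_{HS}\,dm(x)\Big\},$$ where $h(m)$ denotes the measure-theoretic entropy of $m$ with respect to $F$.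
   Context: Notation for compositions: $\psi_{i_0\dots i_{l-1}}=\psi_{i_0}\circ\dots\circ\psi_{i_{l-1}}$. (F2): for $i\neq j$, $\psi_i(G)\cap\psi_j(G)$ is finite; set $\mathcal{F}=\bigcup_{i\neq j}\psi_i(G)\cap\psi_j(G)$. (F3): for every $l\ge1$ and $i_0,\dots,i_{l-1}\in\{1,\dots,t\}$, $\psi_{i_0\dots i_{l-1}}^{-1}(\mathcal{F})\cap\mathcal{F}=\emptyset$. (F4): there are disjoint open sets $\mathcal{O}_1,\dots,\mathcal{O}_t\subset\mathbb{R}^d$ with $G\cap\mathcal{O}_i=\psi_i(G)\setminus\mathcal{F}$. The map $F:G\to G$ is $F(x)=\psi_i^{-1}(x)$ for $x\in\mathcal{O}_i\cap G$, and on $\mathcal{F}$ it is defined by sending each point to the fixed point of some (arbitrarily chosen) $\psi_i$. $\Lambda^q(\mathbb{R}^d)$ is the space of $q$-forms with the inner product induced by the Euclidean one; $(D\psi_i)_*:\Lambda^q\to\Lambda^q$ is the pull-back $[(D\psi_i)_*\omega](v_1,\dots,v_q)=\omega(D\psi_iv_1,\dots,D\psi_iv_q)$. $M^q$ is the space of self-adjoint operators on $\Lambda^q(\mathbb{R}^d)$ with Hilbert–Schmidt product $(A,B)_{HS}=\mathrm{tr}(AB)$. $\Psi_i:M^q\to M^q$ is $\Psi_i(A)={}^t(D\psi_i)_*\,A\,(D\psi_i)_*$ and ${}^t\Psi_i$ is its HS-adjoint, ${}^t\Psi_i(A)=(D\psi_i)_*\,A\,{}^t(D\psi_i)_*$.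 $(ND_q)$: there is $\gamma>0$ such that for all $c,e\in\Lambda^q(\mathbb{R}^d)$ there is $i$ with $|((D\psi_i)_*c,e)|\ge\gamma\|c\|\|e\|$. Ruelle operator on $C(G,M^q)$: $(\mathcal{L}_{G,V}A)(x)=\sum_{i=1}^t e^{V(\psi_i(x))}\Psi_i(A(\psi_i(x)))$. For an $M^q$-valued Borel measure $\mu$ with polar decomposition $\mu=N\|\mu\|$, write $\int(f,d\mu)_{HS}=\int(f,N)_{HS}\,d\|\mu\|$; the adjoint $\mathcal{L}^*_{G,V}$ is taken with respect to $\langle f,\mu\rangle=\int(f,d\mu)_{HS}$. Under the hypotheses there are a unique $\beta_{G,V}>0$ and $Q_{G,V}\in C(G,M^q)$ with $Q_{G,V}(x)$ positive definite for all $x$, unique up to a positive multiple, such that $\mathcal{L}_{G,V}Q_{G,V}=\beta_{G,V}Q_{G,V}$; and a unique $M^q$-valued Borel measure $\mu_{G,V}$, with $\mu_{G,V}(B)$ positive semidefinite for every Borel $B$, such that $\mathcal{L}^*_{G,V}\mu_{G,V}=\beta_{G,V}\mu_{G,V}$ and $\int(Q_{G,V},d\mu_{G,V})_{HS}=1$. Kusuoka's measure is $\kappa_{G,V}=(Q_{G,V},\mu_{G,V})_{HS}$, i.e. $d\kappa_{G,V}=(Q_{G,V}(x),d\mu_{G,V}(x))_{HS}$; it is an $F$-invariant non-atomic probability measure, and $\mu_{G,V}=M_{G,V}\,\kappa_{G,V}$ for a Borel $M_{G,V}:G\to M^q$. $\mathcal{K}_V$ is the set of pairs $\{m,M\}$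 where $m$ is a non-atomic $F$-invariant Borel probability on $G$ and $M:G\to M^q$ is Borel with $M(x)$ positive semidefinite and $(Q_{G,V}(x),M(x))_{HS}=1$ for $m$-a.e. $x$ (in particular $\{\kappa_{G,V},M_{G,V}\}\in\mathcal{K}_V$). *)

theory Defs
  imports "HOL-Analysis.Analysis" "HOL-Probability.Probability"
begin

text \<open>Lambda^q(R^d) is represented in the orthonormal basis e^S indexed by q-element
subsets S of the coordinate type 'n (increasing order given by linorder).
A q-form is a function 'n set => real (only values on q-subsets matter);
an operator on Lambda^q is a function 'n set => 'n set => real (matrix entries).\<close>

type_synonym 'n qform = "'n set \<Rightarrow> real"
type_synonym 'n qmat = "'n set \<Rightarrow> 'n set \<Rightarrow> real"

definition Iq :: "nat \<Rightarrow> 'n::finite set set" where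
  "Iq q = {S. card S = q}"

definition minor :: "((real, 'n::{finite,linorder}) vec, 'n) vec \<Rightarrow> 'n set \<Rightarrow> 'n set \<Rightarrow> real" where
  "minor A T S = (let q = card S; ts = sorted_list_of_set T; ss = sorted_list_of_set S in
     (\<Sum>p | p permutes {..<q}. of_int (sign p) * (\<Prod>k<q. A $ (ts ! k) $ (ss ! (p k)))))"

text \<open>Matrix of the pull-back (D psi)_* on Lambda^q for the linear map x |-> A *v x:
  ((D psi)_* omega)_S = sum_T minor A T S * omega_T.\<close>
definition pullback :: "((real, 'n::{finite,linorder}) vec, 'n) vec \<Rightarrow> 'n qmat" where
  "pullback A S T = minor A T S"

definition qapp :: "nat \<Rightarrow> 'n::finite qmat \<Rightarrow> 'n qform \<Rightarrow> 'n qform" where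
  "qapp q P c S = (\<Sum>T\<in>Iq q. P S T * c T)"

definition qinner :: "nat \<Rightarrow> 'n::finite qform \<Rightarrow> 'n qform \<Rightarrow> real" where
  "qinner q c e = (\<Sum>S\<in>Iq q. c S * e S)"

definition qnorm :: "nat \<Rightarrow> 'n::finite qform \<Rightarrow> real" where
  "qnorm q c = sqrt (qinner q c c)"

definition qmul :: "nat \<Rightarrow> 'n::finite qmat \<Rightarrow> 'n qmat \<Rightarrow> 'n qmat" where
  "qmul q X Y S T = (\<Sum>U\<in>Iq q. X S U * Y U T)"

definition qtr :: "'n qmat \<Rightarrow> 'n qmat" where
  "qtr X S T = X T S"

definition hs :: "nat \<Rightarrow> 'n::finite qmat \<Rightarrow> 'n qmat \<Rightarrow> real" where
  "hs q X Y = (\<Sum>S\<in>Iq q. \<Sum>T\<in>Iq q. X S T * Y T S)"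

definition qsym :: "nat \<Rightarrow> 'n::finite qmat \<Rightarrow> bool" where
  "qsym q X \<longleftrightarrow> (\<forall>S\<in>Iq q. \<forall>T\<in>Iq q. X S T = X T S)"

definition qpsd :: "nat \<Rightarrow> 'n::finite qmat \<Rightarrow> bool" where
  "qpsd q X \<longleftrightarrow> qsym q X \<and> (\<forall>c. 0 \<le> (\<Sum>S\<in>Iq q. \<Sum>T\<in>Iq q. c S * X S T * c T))"

definition qpd :: "nat \<Rightarrow> 'n::finite qmat \<Rightarrow> bool" where
  "qpd q X \<longleftrightarrow> qsym q X \<and>
     (\<forall>c. (\<exists>S\<in>Iq q. c S \<noteq> 0) \<longrightarrow> 0 < (\<Sum>S\<in>Iq q. \<Sum>T\<in>Iq q. c S * X S T * c T))"

text \<open>Psi_i(X) = t(D psi_i)_* X (D psi_i)_*  and its HS-adjoint  tPsi_i(X) = (D psi_i)_* X t(D psi_i)_*.\<close>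
definition Psi :: "nat \<Rightarrow> ((real, 'n::{finite,linorder}) vec, 'n) vec \<Rightarrow> 'n qmat \<Rightarrow> 'n qmat" where
  "Psi q A X = qmul q (qtr (pullback A)) (qmul q X (pullback A))"

definition tPsi :: "nat \<Rightarrow> ((real, 'n::{finite,linorder}) vec, 'n) vec \<Rightarrow> 'n qmat \<Rightarrow> 'n qmat" where
  "tPsi q A X = qmul q (pullback A) (qmul q X (qtr (pullback A)))"

text \<open>Ruelle operator on C(G, M^q); psi i x = A i *v x + b i, so D psi_i = A i.\<close>
definition ruelle :: "nat \<Rightarrow> nat \<Rightarrow> (nat \<Rightarrow> ((real, 'n::{finite,linorder}) vec, 'n) vec) \<Rightarrow> (nat \<Rightarrow> (real, 'n) vec \<Rightarrow> (real, 'n) vec)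
    \<Rightarrow> ((real, 'n) vec \<Rightarrow> real) \<Rightarrow> ((real, 'n) vec \<Rightarrow> 'n qmat) \<Rightarrow> (real, 'n) vec \<Rightarrow> 'n qmat" where
  "ruelle q t A \<psi> V f x = (\<lambda>S T. \<Sum>i=1..t. exp (V (\<psi> i x)) * Psi q (A i) (f (\<psi> i x)) S T)"

definition Fset :: "nat \<Rightarrow> (nat \<Rightarrow> 'a \<Rightarrow> 'a) \<Rightarrow> 'a set \<Rightarrow> 'a set" where
  "Fset t \<psi> G = (\<Union>i\<in>{1..t}. \<Union>j\<in>{1..t}. if i \<noteq> j then \<psi> i ` G \<inter> \<psi> j ` G else {})"

definition F2 :: "nat \<Rightarrow> (nat \<Rightarrow> 'a \<Rightarrow> 'a) \<Rightarrow> 'a set \<Rightarrow> bool" where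
  "F2 t \<psi> G \<longleftrightarrow> (\<forall>i\<in>{1..t}. \<forall>j\<in>{1..t}. i \<noteq> j \<longrightarrow> finite (\<psi> i ` G \<inter> \<psi> j ` G))"

definition compw :: "(nat \<Rightarrow> 'a \<Rightarrow> 'a) \<Rightarrow> nat list \<Rightarrow> 'a \<Rightarrow> 'a" where
  "compw \<psi> ws = foldr (\<lambda>i f. \<psi> i \<circ> f) ws id"

definition F3 :: "nat \<Rightarrow> (nat \<Rightarrow> 'a \<Rightarrow> 'a) \<Rightarrow> 'a set \<Rightarrow> bool" where
  "F3 t \<psi> G \<longleftrightarrow> (\<forall>ws. ws \<noteq> [] \<and> set ws \<subseteq> {1..t} \<longrightarrow>
      compw \<psi> ws -` Fset t \<psi> G \<inter> Fset t \<psi> G = {})"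

definition F4 :: "nat \<Rightarrow> (nat \<Rightarrow> 'a::topological_space \<Rightarrow> 'a) \<Rightarrow> 'a set \<Rightarrow> (nat \<Rightarrow> 'a set) \<Rightarrow> bool" where
  "F4 t \<psi> G Ob \<longleftrightarrow> (\<forall>i\<in>{1..t}. open (Ob i)) \<and>
      (\<forall>i\<in>{1..t}. \<forall>j\<in>{1..t}. i \<noteq> j \<longrightarrow> Ob i \<inter> Ob j = {}) \<and>
      (\<forall>i\<in>{1..t}. G \<inter> Ob i = \<psi> i ` G - Fset t \<psi> G)"

definition NDq :: "nat \<Rightarrow> nat \<Rightarrow> (nat \<Rightarrow> ((real, 'n::{finite,linorder}) vec, 'n) vec) \<Rightarrow> bool" where
  "NDq q t A \<longleftrightarrow> (\<exists>\<gamma>>0. \<forall>(c::'n qform) e. \<exists>i\<in>{1..t}.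
      \<bar>qinner q (qapp q (pullback (A i)) c) e\<bar> \<ge> \<gamma> * qnorm q c * qnorm q e)"

definition iota :: "nat \<Rightarrow> (nat \<Rightarrow> 'a \<Rightarrow> 'a) \<Rightarrow> 'a set \<Rightarrow> 'a \<Rightarrow> nat" where
  "iota t \<psi> G x = (THE i. i \<in> {1..t} \<and> x \<in> \<psi> i ` G - Fset t \<psi> G)"

definition holder_on :: "real \<Rightarrow> 'a::metric_space set \<Rightarrow> ('a \<Rightarrow> real) \<Rightarrow> bool" where
  "holder_on \<alpha> G V \<longleftrightarrow> (\<exists>C. \<forall>x\<in>G. \<forall>y\<in>G. \<bar>V x - V y\<bar> \<le> C * dist x y powr \<alpha>)"

definition meas_partitions :: "'a::topological_space set \<Rightarrow> 'a set set set" where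
  "meas_partitions G = {P. finite P \<and> (\<forall>A\<in>P. A \<in> sets borel \<and> A \<subseteq> G) \<and>
      (\<forall>A\<in>P. \<forall>B\<in>P. A \<noteq> B \<longrightarrow> A \<inter> B = {}) \<and> \<Union>P = G}"

definition join_part :: "'a set \<Rightarrow> ('a \<Rightarrow> 'a) \<Rightarrow> 'a set set \<Rightarrow> nat \<Rightarrow> 'a set set" where
  "join_part G F P n = {G \<inter> (\<Inter>k<n. (F ^^ k) -` (B k)) | B. \<forall>k<n. B k \<in> P}"

definition part_entropy :: "'a measure \<Rightarrow> 'a set set \<Rightarrow> real" where
  "part_entropy m P = - (\<Sum>A\<in>P. measure m A * ln (measure m A))"

definition ks_entropy :: "'a::topological_space set \<Rightarrow> ('a \<Rightarrow> 'a) \<Rightarrow> 'a measure \<Rightarrow> ereal" where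
  "ks_entropy G F m = (SUP P\<in>meas_partitions G.
      ereal (lim (\<lambda>n. part_entropy m (join_part G F P (Suc n)) / real (Suc n))))"

definition elog :: "real \<Rightarrow> ereal" where
  "elog r = (if 0 < r then ereal (ln r) else - \<infinity>)"

definition ext_int :: "'a measure \<Rightarrow> 'a set \<Rightarrow> ('a \<Rightarrow> ereal) \<Rightarrow> ereal" where
  "ext_int m G g = enn2ereal (\<integral>\<^sup>+ x\<in>G. e2ennreal (g x) \<partial>m)
                 - enn2ereal (\<integral>\<^sup>+ x\<in>G. e2ennreal (- g x) \<partial>m)"

definition press_fun :: "nat \<Rightarrow> nat \<Rightarrow> (nat \<Rightarrow> ((real, 'n::{finite,linorder}) vec, 'n) vec) \<Rightarrow> (nat \<Rightarrow> (real, 'n) vec \<Rightarrow> (real, 'n) vec)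
   \<Rightarrow> (real, 'n) vec set \<Rightarrow> ((real, 'n) vec \<Rightarrow> (real, 'n) vec) \<Rightarrow> ((real, 'n) vec \<Rightarrow> real) \<Rightarrow> ((real, 'n) vec \<Rightarrow> 'n qmat)
   \<Rightarrow> ((real, 'n) vec) measure \<Rightarrow> ((real, 'n) vec \<Rightarrow> 'n qmat) \<Rightarrow> ereal" where
  "press_fun q t A \<psi> G F V Q m M =
     ks_entropy G F m + ereal (LINT x:G|m. V x)
     + ext_int m G (\<lambda>x. elog (hs q (Q x) (tPsi q (A (iota t \<psi> G x)) (M (F x)))))"

definition KV :: "nat \<Rightarrow> (real, 'n::{finite,linorder}) vec set \<Rightarrow> ((real, 'n) vec \<Rightarrow> (real, 'n) vec) \<Rightarrow> ((real, 'n) vec \<Rightarrow> 'n qmat)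
   \<Rightarrow> (((real, 'n) vec) measure \<times> ((real, 'n) vec \<Rightarrow> 'n qmat)) set" where
  "KV q G F Q = {(m, M).
      sets m = sets borel \<and> prob_space m \<and> emeasure m (UNIV - G) = 0 \<and>
      (\<forall>x. emeasure m {x} = 0) \<and>
      (\<forall>B\<in>sets borel. emeasure m (F -` B \<inter> G) = emeasure m B) \<and>
      (\<forall>S T. (\<lambda>x. M x S T) \<in> borel_measurable borel) \<and>
      (\<forall>x\<in>G. qsym q (M x)) \<and>
      (AE x in m. qpsd q (M x) \<and> hs q (Q x) (M x) = 1)}"

end

theory Submission
  imports Defs
begin

text \<open>
  For a pair \<open>(m, M)\<close> put \<open>g i y = exp (V (\<psi> i y)) * (Psi_i (Q (\<psi> i y)), M y) / \<beta>\<close>. The eigenvalue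
  equation for \<open>Q\<close> says that \<open>g 1 y, ..., g t y\<close> is a probability vector, and the pressure functional
  equals \<open>ln \<beta> + h(m) + \<integral> ln (g (\<iota> x) (F x)) dm\<close>, so one has to show
  \<open>h(m) \<le> - \<integral> ln (g (\<iota> x) (F x)) dm\<close> with equality for Kusuoka's measure.

  Upper bound: if \<open>g\<close> is continuous and positive, the products of \<open>g\<close> along backward branches starting at a
  fixed point of \<open>G\<close> form a probability vector on the words of length \<open>n\<close>, and Gibbs' inequality against it
  gives the bound because branches contract. A general \<open>g\<close> is mixed with the uniform vector and then
  approximated in L1(m) by continuous ones. An arbitrary finite partition is handled simultaneously by enlarging
  the alphabet.

  Equality: testing the eigenmeasure equation on \<open>\<phi> Q\<close> shows that Kusuoka's measure \<open>\<kappa>\<close> is the sum of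
  the images of \<open>g i \<kappa>\<close> under \<open>\<psi> i\<close>. By (F3) and nondegeneracy the mass of an atom would strictly increase
  along its \<open>F\<close>-orbit, so \<open>\<kappa>\<close> has no atoms; it is then \<open>F\<close>-invariant with conditional
  probabilities \<open>g i\<close>, and Jensen's inequality on cylinders gives \<open>H(n+1) - H(n) \<ge> - \<Sum>i. \<integral> g i ln (g i) d\<kappa>\<close>.
\<close>

section \<open>Positive semidefinite kernels and the pull-back on forms\<close>

text \<open>Duality of \<open>Psi\<close> and \<open>tPsi\<close> is what brings \<open>g\<close>
  into the functional: almost everywhere the argument of the logarithm is
  \<open>g * \<beta> * exp (- V x)\<close>, so the integral of \<open>V\<close> cancels and
  \<open>ln \<beta>\<close> splits off. Three obstacles shape the rest. (a) \<open>M\<close> is only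
  Borel, whereas word weights evaluate \<open>g\<close> at points that merely approximate the orbit;
  this is where continuity enters. Mixing with the uniform vector keeps the weights away from zero,
  so that an L1 error in them costs only a proportional error in the logarithm. (b)
  \<open>ks_entropy\<close> is a supremum over all finite partitions of values of
  \<open>lim\<close>: every limit has to be shown to exist, and coding by pairs of branch and cell
  bounds each partition directly, without a generator theorem. (c) The logarithm may fail to be
  integrable; the bound \<open>ln t\<close> on the entropy then rules out a sum of opposite
  infinities. For the eigenmeasure, nondegeneracy yields two branches of positive weight, by testing
  against a form orthogonal to the image under one branch or, in top degree, by determinants. Hence
  every \<open>g i\<close> is strictly below 1, the source of the strict growth of atoms.\<close>

lemma psd_kernel_gram:
  fixes Y :: "'s \<Rightarrow> 's \<Rightarrow> real"
  assumes "finite I"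
    and "\<And>s u. s \<in> I \<Longrightarrow> u \<in> I \<Longrightarrow> Y s u = Y u s"
    and "\<And>c. 0 \<le> (\<Sum>s\<in>I. \<Sum>u\<in>I. c s * Y s u * c u)"
  shows "\<exists>(K::nat) v. \<forall>s\<in>I. \<forall>u\<in>I. Y s u = (\<Sum>k<K. v k s * v k u)"
  using assms
proof (induction I arbitrary: Y rule: finite_induct)
  case empty
  then show ?case by simp
next
  case (insert a J)
  define d where "d = Y a a"
  have split: "(\<Sum>s\<in>insert a J. \<Sum>u\<in>insert a J. c s * Y s u * c u) =
      c a * c a * d + 2 * c a * (\<Sum>u\<in>J. Y a u * c u) + (\<Sum>s\<in>J. \<Sum>u\<in>J. c s * Y s u * c u)" for c
  proof -
    have "(\<Sum>s\<in>J. c s * Y s a * c a) = c a * (\<Sum>u\<in>J. Y a u * c u)"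
      unfolding sum_distrib_left by (rule sum.cong) (auto simp: insert.prems(1))
    moreover have "(\<Sum>u\<in>J. c a * Y a u * c u) = c a * (\<Sum>u\<in>J. Y a u * c u)"
      unfolding sum_distrib_left by (rule sum.cong) auto
    ultimately show ?thesis
      using insert.hyps by (simp add: sum.distrib d_def algebra_simps)
  qed
  have form: "0 \<le> x * x * d + 2 * x * (\<Sum>u\<in>J. Y a u * c u) + (\<Sum>s\<in>J. \<Sum>u\<in>J. c s * Y s u * c u)" for c x
  proof -
    have J: "s \<in> J \<Longrightarrow> (c(a := x)) s = c s" for s
      using insert.hyps by auto
    show ?thesis
      using insert.prems(2)[of "c(a := x)"] unfolding split
      by (simp add: J fun_upd_same del: fun_upd_apply cong: sum.cong)
  qed
  show ?case
  proof (cases "d > 0")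
    case True
    \<comment> \<open>Schur complement of the pivot \<open>d\<close>: the form that remains after
      minimising over the coordinate at \<open>a\<close>.\<close>
    define Y' where "Y' s u = Y s u - Y s a * Y a u / d" for s u
    have psd': "0 \<le> (\<Sum>s\<in>J. \<Sum>u\<in>J. c s * Y' s u * c u)" for c
    proof -
      define B where "B = (\<Sum>u\<in>J. Y a u * c u)"
      have "(\<Sum>s\<in>J. \<Sum>u\<in>J. c s * Y' s u * c u) =
          (\<Sum>s\<in>J. \<Sum>u\<in>J. c s * Y s u * c u) - (\<Sum>s\<in>J. \<Sum>u\<in>J. (Y a s * c s) * (Y a u * c u)) / d"
        unfolding sum_divide_distrib sum_subtractf[symmetric]
        by (intro sum.cong refl) (auto simp: Y'_def algebra_simps insert.prems(1))
      also have "(\<Sum>s\<in>J. \<Sum>u\<in>J. (Y a s * c s) * (Y a u * c u)) = B * B"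
        unfolding B_def sum_product ..
      finally have eq: "(\<Sum>s\<in>J. \<Sum>u\<in>J. c s * Y' s u * c u) =
          (\<Sum>s\<in>J. \<Sum>u\<in>J. c s * Y s u * c u) - B * B / d" .
      \<comment> \<open>\<open>- B / d\<close> minimises the quadratic polynomial in the coordinate
        at \<open>a\<close>, and the minimum is the Schur form, which is therefore
        nonnegative.\<close>
      show ?thesis
        using form[of "- B / d" c] True unfolding eq B_def[symmetric]
        by (simp add: field_simps)
    qed
    have "\<exists>(K::nat) v. \<forall>s\<in>J. \<forall>u\<in>J. Y' s u = (\<Sum>k<K. v k s * v k u)"
      by (rule insert.IH[OF _ psd']) (simp add: Y'_def insert.prems(1))
    then obtain K v where v: "\<And>s u. s \<in> J \<Longrightarrow> u \<in> J \<Longrightarrow> Y' s u = (\<Sum>k<(K::nat). v k s * v k u)"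
      by blast
    \<comment> \<open>Completing the square: vector 0 is the pivot row divided by
      \<open>sqrt d\<close>; the Gram vectors of the Schur complement follow, extended by 0 at
      \<open>a\<close>.\<close>
    define w where "w k s = (case k of 0 \<Rightarrow> Y s a / sqrt d | Suc k \<Rightarrow> if s = a then 0 else v k s)" for k s
    have "Y s u = (\<Sum>k<Suc K. w k s * w k u)" if "s \<in> insert a J" "u \<in> insert a J" for s u
    proof -
      have 1: "(\<Sum>k<Suc K. w k s * w k u) =
          Y s a * Y a u / d + (if s = a \<or> u = a then 0 else \<Sum>k<K. v k s * v k u)"
        unfolding sum.lessThan_Suc_shift using True insert.prems(1) that by (auto simp: w_def)
      show ?thesis
      proof (cases "s = a \<or> u = a")
        case True': True
        then show ?thesis unfolding 1 using True by (auto simp: d_def)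
      next
        case False
        then show ?thesis unfolding 1 using v[of s u] that by (auto simp: Y'_def)
      qed
    qed
    then show ?thesis by blast
  next
    case False
    have "0 \<le> d" using form[of 1 "\<lambda>_. 0"] by simp
    with False have d0: "d = 0" by simp
    have row0: "Y a u = 0" if "u \<in> J" for u
    proof (rule ccontr)
      assume ne: "Y a u \<noteq> 0"
      define c where "c = (\<lambda>s. if s = u then 1 else (0::real))"
      have B: "(\<Sum>u\<in>J. Y a u * c u) = Y a u"
        using insert.hyps that by (simp add: c_def if_distrib[of "\<lambda>x. _ * x"] cong: if_cong)
      define E where "E = (\<Sum>s\<in>J. \<Sum>u\<in>J. c s * Y s u * c u)"
      have "0 \<le> 2 * x * Y a u + E" for x
        using form[of x c] unfolding B d0 E_def by simp
      \<comment> \<open>With zero pivot the form is affine in \<open>x\<close>; this choice of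
        \<open>x\<close> would give it the value -1.\<close>
      from this[of "- (E + 1) / (2 * Y a u)"] ne show False by (simp add: field_simps)
    qed
    have "\<exists>(K::nat) v. \<forall>s\<in>J. \<forall>u\<in>J. Y s u = (\<Sum>k<K. v k s * v k u)"
      by (rule insert.IH) (use insert.prems(1) form[of 0] in auto)
    then obtain K v where v: "\<And>s u. s \<in> J \<Longrightarrow> u \<in> J \<Longrightarrow> Y s u = (\<Sum>k<(K::nat). v k s * v k u)"
      by blast
    have "Y s u = (\<Sum>k<K. (if s = a then 0 else v k s) * (if u = a then 0 else v k u))"
      if "s \<in> insert a J" "u \<in> insert a J" for s u
      using that v[of s u] row0[of s] row0[of u] insert.prems(1)[of s u] d0 insert.hyps(2)
      by (cases "s = a"; cases "u = a") (auto simp: d_def)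
    then show ?thesis by (intro exI[of _ K] exI[of _ "\<lambda>k s. if s = a then 0 else v k s"]) blast
  qed
qed

section \<open>Quadratic forms and the trace pairing\<close>

definition qquad :: "nat \<Rightarrow> 'n::finite qmat \<Rightarrow> 'n qform \<Rightarrow> real" where
  "qquad q X c = (\<Sum>S\<in>Iq q. \<Sum>T\<in>Iq q. c S * X S T * c T)"

lemma qpsd_gram:
  assumes "qpsd q Y"
  shows "\<exists>(K::nat) v. \<forall>S\<in>Iq q. \<forall>T\<in>Iq q. Y S T = (\<Sum>k<K. v k S * v k T)"
  by (rule psd_kernel_gram) (use assms in \<open>auto simp: qpsd_def qsym_def\<close>)

text \<open>A Gram decomposition splits \<open>Y\<close> into rank-one kernels, and the trace
  pairing of \<open>X\<close> with a rank-one kernel is a value of the quadratic form of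
  \<open>X\<close>. The sign statements about \<open>hs\<close> below are reduced to quadratic forms
  in this way.\<close>

lemma hs_gram:
  assumes "\<forall>S\<in>Iq q. \<forall>T\<in>Iq q. Y S T = (\<Sum>k<(K::nat). v k S * v k T)"
  shows "hs q X Y = (\<Sum>k<K. qquad q X (v k))"
proof -
  have "hs q X Y = (\<Sum>S\<in>Iq q. \<Sum>T\<in>Iq q. \<Sum>k<K. v k S * X S T * v k T)"
    unfolding hs_def
    by (intro sum.cong refl) (simp add: assms sum_distrib_left mult_ac)
  also have "\<dots> = (\<Sum>S\<in>Iq q. \<Sum>k<K. \<Sum>T\<in>Iq q. v k S * X S T * v k T)"
    by (intro sum.cong refl sum.swap)
  also have "\<dots> = (\<Sum>k<K. qquad q X (v k))"
    unfolding qquad_def by (rule sum.swap)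
  finally show ?thesis .
qed

lemma qpd_imp_qpsd: "qpd q X \<Longrightarrow> qpsd q X"
proof -
  assume X: "qpd q X"
  have "0 \<le> (\<Sum>S\<in>Iq q. \<Sum>T\<in>Iq q. c S * X S T * c T)" for c
  proof (cases "\<exists>S\<in>Iq q. c S \<noteq> 0")
    case True
    then show ?thesis using X unfolding qpd_def by (blast intro: less_imp_le)
  next
    case False
    then show ?thesis by simp
  qed
  with X show ?thesis by (simp add: qpd_def qpsd_def)
qed

lemma hs_nonneg:
  assumes "qpsd q X" "qpsd q Y"
  shows "0 \<le> hs q X Y"
proof -
  obtain K :: nat and v where v: "\<forall>S\<in>Iq q. \<forall>T\<in>Iq q. Y S T = (\<Sum>k<K. v k S * v k T)"
    using qpsd_gram[OF assms(2)] by blast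
  show ?thesis
    unfolding hs_gram[OF v] using assms(1) by (intro sum_nonneg) (simp add: qpsd_def qquad_def)
qed

text \<open>Cyclicity of the trace, written as a reordering of finite sums. It turns the argument of
  the logarithm in the functional into a branch weight.\<close>

lemma hs_Psi_eq_hs_tPsi:
  fixes A :: "((real, 'n::{finite,linorder}) vec, 'n) vec"
  shows "hs q (Psi q A X) Y = hs q X (tPsi q A Y)"
proof -
  let ?P = "pullback A" and ?I = "Iq q :: 'n set set"
  have "hs q (Psi q A X) Y = (\<Sum>S\<in>?I. \<Sum>T\<in>?I. \<Sum>U\<in>?I. \<Sum>W\<in>?I. ?P U S * X U W * ?P W T * Y T S)"
    unfolding hs_def Psi_def qmul_def qtr_def
    by (intro sum.cong refl) (simp add: sum_distrib_left sum_distrib_right mult_ac)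
  also have "\<dots> = (\<Sum>S\<in>?I. \<Sum>U\<in>?I. \<Sum>T\<in>?I. \<Sum>W\<in>?I. ?P U S * X U W * ?P W T * Y T S)"
    by (intro sum.cong refl sum.swap)
  also have "\<dots> = (\<Sum>U\<in>?I. \<Sum>S\<in>?I. \<Sum>W\<in>?I. \<Sum>T\<in>?I. ?P U S * X U W * ?P W T * Y T S)"
    by (subst sum.swap) (intro sum.cong refl sum.swap)
  also have "\<dots> = (\<Sum>U\<in>?I. \<Sum>W\<in>?I. \<Sum>S\<in>?I. \<Sum>T\<in>?I. ?P U S * X U W * ?P W T * Y T S)"
    by (intro sum.cong refl sum.swap)
  also have "\<dots> = (\<Sum>U\<in>?I. \<Sum>W\<in>?I. \<Sum>T\<in>?I. \<Sum>S\<in>?I. ?P U S * X U W * ?P W T * Y T S)"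
    by (intro sum.cong refl sum.swap)
  also have "\<dots> = hs q X (tPsi q A Y)"
    unfolding hs_def tPsi_def qmul_def qtr_def
    by (intro sum.cong refl) (simp add: sum_distrib_left sum_distrib_right mult_ac)
  finally show ?thesis .
qed

text \<open>\<open>Psi\<close> is a congruence, that is, a substitution in the quadratic form.
  Positivity is therefore preserved, and nondegeneracy can be applied to the vector on the
  right.\<close>

lemma qquad_Psi:
  fixes A :: "((real, 'n::{finite,linorder}) vec, 'n) vec"
  shows "qquad q (Psi q A X) c = qquad q X (qapp q (pullback A) c)"
proof -
  let ?P = "pullback A" and ?I = "Iq q :: 'n set set"
  have "qquad q (Psi q A X) c = (\<Sum>S\<in>?I. \<Sum>T\<in>?I. \<Sum>U\<in>?I. \<Sum>W\<in>?I. ?P U S * c S * X U W * (?P W T * c T))"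
    unfolding qquad_def Psi_def qmul_def qtr_def
    by (intro sum.cong refl) (simp add: sum_distrib_left sum_distrib_right mult_ac)
  also have "\<dots> = (\<Sum>S\<in>?I. \<Sum>U\<in>?I. \<Sum>T\<in>?I. \<Sum>W\<in>?I. ?P U S * c S * X U W * (?P W T * c T))"
    by (intro sum.cong refl sum.swap)
  also have "\<dots> = (\<Sum>U\<in>?I. \<Sum>S\<in>?I. \<Sum>W\<in>?I. \<Sum>T\<in>?I. ?P U S * c S * X U W * (?P W T * c T))"
    by (subst sum.swap) (intro sum.cong refl sum.swap)
  also have "\<dots> = (\<Sum>U\<in>?I. \<Sum>W\<in>?I. \<Sum>S\<in>?I. \<Sum>T\<in>?I. ?P U S * c S * X U W * (?P W T * c T))"
    by (intro sum.cong refl sum.swap)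
  also have "\<dots> = qquad q X (qapp q (pullback A) c)"
    unfolding qquad_def qapp_def
    by (intro sum.cong refl) (simp add: sum_distrib_left sum_distrib_right mult_ac)
  finally show ?thesis .
qed

lemma qsym_Psi:
  fixes A :: "((real, 'n::{finite,linorder}) vec, 'n) vec"
  assumes "qsym q X"
  shows "qsym q (Psi q A X)"
proof -
  let ?P = "pullback A" and ?I = "Iq q :: 'n set set"
  have "Psi q A X S T = Psi q A X T S" for S T
  proof -
    have "Psi q A X S T = (\<Sum>U\<in>?I. \<Sum>W\<in>?I. ?P U S * X U W * ?P W T)"
      unfolding Psi_def qmul_def qtr_def by (simp add: sum_distrib_left mult_ac)
    also have "\<dots> = (\<Sum>W\<in>?I. \<Sum>U\<in>?I. ?P U S * X U W * ?P W T)"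
      by (rule sum.swap)
    also have "\<dots> = Psi q A X T S"
      unfolding Psi_def qmul_def qtr_def sum_distrib_left
      by (intro sum.cong refl) (use assms in \<open>auto simp: qsym_def\<close>)
    finally show ?thesis .
  qed
  then show ?thesis by (simp add: qsym_def)
qed

lemma qpsd_Psi:
  fixes A :: "((real, 'n::{finite,linorder}) vec, 'n) vec"
  assumes "qpsd q X"
  shows "qpsd q (Psi q A X)"
proof -
  have "0 \<le> qquad q (Psi q A X) c" for c
    unfolding qquad_Psi using assms by (simp add: qpsd_def qquad_def)
  with assms show ?thesis
    by (simp add: qpsd_def qsym_Psi qquad_def)
qed

section \<open>Minors and consequences of nondegeneracy\<close>

lemma minor_UNIV:
  fixes A :: "((real, 'n::{finite,linorder}) vec, 'n) vec"
  shows "minor A UNIV UNIV = det A"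
proof -
  define xs where "xs = sorted_list_of_set (UNIV :: 'n set)"
  let ?n = "CARD('n)"
  have xs: "set xs = UNIV" "distinct xs" "length xs = ?n"
    by (auto simp: xs_def)
  have bij: "bij_betw (\<lambda>k. xs ! k) {..<?n} UNIV"
    using bij_betw_nth[OF xs(2)] xs by auto
  let ?f = "\<lambda>k. xs ! k"
  have inj: "inj_on ?f {..<?n}" using bij by (rule bij_betw_imp_inj_on)
  \<comment> \<open>Permutations of positions in the sorted enumeration correspond to permutations
    of the coordinates, with equal signs; the sum defining \<open>minor\<close> thereby becomes the
    Leibniz formula.\<close>
  have perm_bij: "bij_betw (map_permutation {..<?n} ?f) {p. p permutes {..<?n}} {p. p permutes UNIV}"
    using bij_betw_permutations[OF bij] inj bij
    by (rule_tac bij_betw_cong[THEN iffD1, rotated]) (auto simp: fun_eq_iff map_permutation_def restrict_id_def bij_betw_def)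
  have "det A = (\<Sum>p | p permutes (UNIV::'n set). of_int (sign p) * (\<Prod>i\<in>UNIV. A $ i $ p i))"
    by (simp add: det_def)
  also have "\<dots> = (\<Sum>p | p permutes {..<?n}. of_int (sign (map_permutation {..<?n} ?f p)) *
      (\<Prod>i\<in>UNIV. A $ i $ (map_permutation {..<?n} ?f p) i))"
    by (rule sum.reindex_bij_betw[OF perm_bij, symmetric])
  also have "\<dots> = (\<Sum>p | p permutes {..<?n}. of_int (sign p) * (\<Prod>k<?n. A $ (xs ! k) $ (xs ! (p k))))"
  proof (intro sum.cong refl, goal_cases)
    case (1 p)
    then have p: "p permutes {..<?n}" by simp
    have "(\<Prod>i\<in>UNIV. A $ i $ (map_permutation {..<?n} ?f p) i) =
        (\<Prod>k<?n. A $ (?f k) $ (map_permutation {..<?n} ?f p) (?f k))"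
      by (rule prod.reindex_bij_betw[OF bij, symmetric])
    also have "\<dots> = (\<Prod>k<?n. A $ (xs ! k) $ (xs ! (p k)))"
      by (intro prod.cong refl) (simp add: map_permutation_apply[OF inj])
    finally show ?case using sign_map_permutation[OF inj p] by simp
  qed
  finally show ?thesis
    unfolding minor_def Let_def xs_def by simp
qed

text \<open>Exchanging one element of \<open>S\<close> for one outside yields a second subset of
  size \<open>q\<close> unless \<open>S\<close> is everything; \<open>1 \<le> q\<close> supplies the
  element to remove.\<close>

lemma Iq_eq_singleton:
  assumes "1 \<le> q" "q \<le> CARD('n)" and one: "\<And>S T :: 'n::finite set. S \<in> Iq q \<Longrightarrow> T \<in> Iq q \<Longrightarrow> S = T"
  shows "Iq q = {UNIV :: 'n set}"
proof -
  obtain S :: "'n set" where S: "card S = q"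
    using obtain_subset_with_card_n[OF assms(2)] by auto
  have "S = UNIV"
  proof (rule ccontr)
    assume "S \<noteq> UNIV"
    then obtain a where a: "a \<notin> S" by auto
    obtain b where b: "b \<in> S" using S assms(1) by (metis One_nat_def card.empty ex_in_conv not_one_le_zero)
    have "card (insert a (S - {b})) = q"
      using a b S by (simp add: card_Diff_singleton) (metis One_nat_def Suc_pred assms(1) less_eq_Suc_le)
    then have "insert a (S - {b}) = S" using S by (intro one[of _ S]) (simp_all add: Iq_def)
    then show False using a by auto
  qed
  then show ?thesis using one S by (auto simp: Iq_def)
qed

text \<open>Testing nondegeneracy against a form \<open>e\<close> orthogonal to the image of
  \<open>v\<close> under branch \<open>i\<close> forces the index it returns to differ from
  \<open>i\<close>. Such an \<open>e\<close> exists once there are two basis forms; for top-degree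
  forms every branch acts by its nonzero determinant, and any other index will do.\<close>

lemma ND_two_branches:
  fixes A :: "nat \<Rightarrow> ((real, 'n::{finite,linorder}) vec, 'n) vec"
  assumes ND: "NDq q t A" and t: "t \<ge> 2" and q: "1 \<le> q" "q \<le> CARD('n)"
    and inv: "\<And>i. i \<in> {1..t} \<Longrightarrow> invertible (A i)"
    and v: "\<exists>S\<in>Iq q. v S \<noteq> 0"
  shows "\<exists>j\<in>{1..t}. j \<noteq> i \<and> (\<exists>S\<in>Iq q. qapp q (pullback (A j)) v S \<noteq> 0)"
proof (cases "\<exists>S\<in>Iq q. \<exists>T\<in>(Iq q :: 'n set set). S \<noteq> T")
  case True
  then obtain S T :: "'n set" where ST: "S \<in> Iq q" "T \<in> Iq q" "S \<noteq> T" by blast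
  define u where "u = qapp q (pullback (A i)) v"
  \<comment> \<open>Rotating the pair \<open>(u S, u T)\<close> by a right angle makes
    \<open>e\<close> orthogonal to \<open>u\<close>; when \<open>u S = 0\<close> the basis form at
    \<open>S\<close> already is. The case distinction keeps \<open>e\<close> nonzero.\<close>
  define e where "e = (if u S = 0 then (\<lambda>U. if U = S then 1 else 0)
      else (\<lambda>U. if U = S then - u T else if U = T then u S else 0))"
  have e_ne: "\<exists>U\<in>Iq q. e U \<noteq> 0"
    using ST by (auto simp: e_def)
  have "qinner q u e = (\<Sum>U\<in>{S, T}. u U * e U)"
    unfolding qinner_def using ST by (intro sum.mono_neutral_right) (auto simp: e_def)
  also have "\<dots> = 0" using ST by (auto simp: e_def)
  finally have orth: "qinner q u e = 0" .
  have norm_pos: "0 < qnorm q w" if "\<exists>U\<in>Iq q. w U \<noteq> 0" for w :: "'n set \<Rightarrow> real"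
  proof -
    obtain U where "U \<in> Iq q" "w U \<noteq> 0" using \<open>\<exists>U\<in>Iq q. w U \<noteq> 0\<close> by blast
    then have "0 < (\<Sum>U\<in>Iq q. w U * w U)"
      by (intro sum_pos2[of _ U]) (auto simp: zero_less_mult_iff)
    then show ?thesis by (simp add: qnorm_def qinner_def)
  qed
  obtain \<gamma> j where \<gamma>: "\<gamma> > 0" and j: "j \<in> {1..t}"
      "\<bar>qinner q (qapp q (pullback (A j)) v) e\<bar> \<ge> \<gamma> * qnorm q v * qnorm q e"
    using ND unfolding NDq_def by blast
  have "0 < \<gamma> * qnorm q v * qnorm q e"
    using \<gamma> norm_pos[OF v] norm_pos[OF e_ne] by simp
  then have ne: "qinner q (qapp q (pullback (A j)) v) e \<noteq> 0" using j by auto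
  then have "j \<noteq> i" using orth by (auto simp: u_def)
  moreover have "\<exists>S\<in>Iq q. qapp q (pullback (A j)) v S \<noteq> 0"
  proof (rule ccontr)
    assume "\<not> ?thesis"
    then show False using ne by (simp add: qinner_def)
  qed
  ultimately show ?thesis using j by blast
next
  case False
  then have I: "Iq q = {UNIV :: 'n set}" using Iq_eq_singleton[OF q] by blast
  obtain j where j: "j \<in> {1..t}" "j \<noteq> i"
  proof (cases "i = 1")
    case True
    then show ?thesis using that[of 2] t by simp
  next
    case False
    then show ?thesis using that[of 1] t by simp
  qed
  have "det (A j) \<noteq> 0" using inv[OF j(1)] by (simp add: invertible_det_nz)
  then have "qapp q (pullback (A j)) v UNIV \<noteq> 0"
    using v by (simp add: qapp_def I pullback_def minor_UNIV)
  then show ?thesis using j I by blast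
qed

text \<open>A nonzero pairing forces some Gram vector of \<open>Y\<close> to be nonzero, and a
  branch other than \<open>i\<close> keeps that vector nonzero. As \<open>i\<close> is arbitrary, at
  least two branches have positive weight, so no single branch carries all the mass.\<close>

lemma hs_Psi_two_branches:
  fixes A :: "nat \<Rightarrow> ((real, 'n::{finite,linorder}) vec, 'n) vec"
  assumes "NDq q t A" "t \<ge> 2" "1 \<le> q" "q \<le> CARD('n)"
    and "\<And>i. i \<in> {1..t} \<Longrightarrow> invertible (A i)"
    and X: "\<And>i. i \<in> {1..t} \<Longrightarrow> qpd q (X i)" and Y: "qpsd q Y" "hs q Z Y \<noteq> 0"
  shows "\<exists>j\<in>{1..t}. j \<noteq> i \<and> 0 < hs q (Psi q (A j) (X j)) Y"
proof -
  obtain K :: nat and v where v: "\<forall>S\<in>Iq q. \<forall>T\<in>Iq q. Y S T = (\<Sum>k<K. v k S * v k T)"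
    using qpsd_gram[OF Y(1)] by blast
  have "\<exists>k<K. \<exists>S\<in>Iq q. v k S \<noteq> 0"
  proof (rule ccontr)
    assume "\<not> ?thesis"
    then have "qquad q Z (v k) = 0" if "k < K" for k
      using that by (simp add: qquad_def)
    then show False using Y(2) unfolding hs_gram[OF v] by simp
  qed
  then obtain k where k: "k < K" "\<exists>S\<in>Iq q. v k S \<noteq> 0" by blast
  obtain j where j: "j \<in> {1..t}" "j \<noteq> i" "\<exists>S\<in>Iq q. qapp q (pullback (A j)) (v k) S \<noteq> 0"
    using ND_two_branches[OF assms(1-5) k(2)] by blast
  have nn: "0 \<le> qquad q (X j) c" for c
    using qpd_imp_qpsd[OF X[OF j(1)]] by (simp add: qpsd_def qquad_def)
  have "0 < qquad q (X j) (qapp q (pullback (A j)) (v k))"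
    using X[OF j(1)] j(3) unfolding qpd_def qquad_def by blast
  then have "0 < (\<Sum>k<K. qquad q (X j) (qapp q (pullback (A j)) (v k)))"
    using k nn by (intro sum_pos2[of _ k]) auto
  then have "0 < hs q (Psi q (A j) (X j)) Y"
    unfolding hs_gram[OF v] qquad_Psi .
  then show ?thesis using j by blast
qed

section \<open>Entropy of coded orbits\<close>

text \<open>Nonnegativity of relative entropy, from \<open>ln x \<le> x - 1\<close> applied to
  \<open>r v / p v\<close>. The comparison vector may have total mass below 1.\<close>

lemma gibbs_inequality:
  fixes p r :: "'b \<Rightarrow> real"
  assumes "finite I" and p: "\<And>v. v \<in> I \<Longrightarrow> 0 \<le> p v" and r: "\<And>v. v \<in> I \<Longrightarrow> 0 \<le> r v"
    and "(\<Sum>v\<in>I. p v) = 1" "(\<Sum>v\<in>I. r v) \<le> 1"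
    and pos: "\<And>v. v \<in> I \<Longrightarrow> 0 < p v \<Longrightarrow> 0 < r v"
  shows "- (\<Sum>v\<in>I. p v * ln (p v)) \<le> - (\<Sum>v\<in>I. p v * ln (r v))"
proof -
  have "p v * ln (r v) - p v * ln (p v) \<le> r v - p v" if "v \<in> I" for v
  proof (cases "p v = 0")
    case True
    then show ?thesis using r that by simp
  next
    case False
    then have pr: "0 < p v" "0 < r v" using p[OF that] pos[OF that] by auto
    have "ln (r v / p v) \<le> r v / p v - 1"
      using pr by (intro ln_le_minus_one) simp
    then have "p v * (ln (r v) - ln (p v)) \<le> p v * (r v / p v - 1)"
      using pr by (intro mult_left_mono) (simp_all add: ln_div)
    then show ?thesis using pr by (simp add: algebra_simps)
  qed
  then have "(\<Sum>v\<in>I. p v * ln (r v) - p v * ln (p v)) \<le> (\<Sum>v\<in>I. r v - p v)"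
    by (rule sum_mono)
  then show ?thesis using assms by (simp add: sum_subtractf)
qed

text \<open>Convergence itself is the point: \<open>ks_entropy\<close> is written with
  \<open>lim\<close>, whose value is meaningful only for convergent sequences. The limit is the
  infimum of the quotients.\<close>

lemma fekete_convergent:
  fixes a :: "nat \<Rightarrow> real"
  assumes sub: "\<And>m n. a (m + n) \<le> a m + a n" and nn: "\<And>n. 0 \<le> a n"
  shows "convergent (\<lambda>n. a (Suc n) / real (Suc n))"
proof -
  let ?S = "(\<lambda>n. a (Suc n) / real (Suc n)) ` UNIV"
  define L where "L = Inf ?S"
  have bdd: "bdd_below ?S" by (rule bdd_belowI[of _ 0]) (auto simp: nn)
  have lower: "L \<le> a (Suc n) / real (Suc n)" for n
    unfolding L_def by (rule cInf_lower[OF _ bdd]) simp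
  have mult: "a (j * k + r) \<le> real j * a k + a r" for j k r
  proof (induction j)
    case (Suc j)
    have "a (Suc j * k + r) \<le> a k + a (j * k + r)"
      using sub[of k "j * k + r"] by (simp add: add.assoc)
    with Suc show ?case by (simp add: algebra_simps)
  qed simp
  have "(\<lambda>n. a (Suc n) / real (Suc n)) \<longlonglongrightarrow> L"
  proof (rule LIMSEQ_I)
    fix e :: real assume e: "0 < e"
    have "Inf ?S < L + e / 2" using e by (simp add: L_def)
    then obtain k0 where k0: "a (Suc k0) / real (Suc k0) < L + e / 2"
      by (subst (asm) cInf_less_iff) (use bdd in auto)
    define k where "k = Suc k0"
    define C where "C = (\<Sum>r<k. a r)"
    have C: "a r \<le> C" if "r < k" for r
      unfolding C_def using that nn by (intro member_le_sum) auto
    have C0: "0 \<le> C" unfolding C_def by (intro sum_nonneg nn)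
    obtain n0 :: nat where n0: "2 * C / e < real n0" using reals_Archimedean2 by blast
    show "\<exists>no. \<forall>n\<ge>no. norm (a (Suc n) / real (Suc n) - L) < e"
    proof (intro exI allI impI)
      fix n assume n: "n0 \<le> n"
      define N where "N = Suc n"
      have Npos: "0 < N" by (simp add: N_def)
      \<comment> \<open>Division with remainder by a near-optimal \<open>k\<close>; \<open>C\<close>
        bounds all remainder terms, so they vanish after division by \<open>N\<close>.\<close>
      have "a N = a ((N div k) * k + N mod k)" by simp
      also have "\<dots> \<le> real (N div k) * a k + a (N mod k)" by (rule mult)
      also have "\<dots> \<le> (real N / real k) * a k + C"
        using nn C by (intro add_mono mult_right_mono of_nat_div_le_of_nat) (auto simp: k_def)
      finally have "a N / real N \<le> ((real N / real k) * a k + C) / real N"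
        by (intro divide_right_mono) auto
      also have "\<dots> = a k / real k + C / real N"
        using Npos by (simp add: add_divide_distrib)
      also have "C / real N < e / 2"
      proof -
        have "2 * C / e < real N" using n0 n by (simp add: N_def)
        then show ?thesis using e by (simp add: field_simps N_def)
      qed
      finally have "a N / real N < L + e" using k0 by (simp add: k_def)
      with lower[of n] show "norm (a (Suc n) / real (Suc n) - L) < e"
        by (simp add: N_def abs_less_iff)
    qed
  qed
  then show ?thesis by (rule convergentI)
qed

lemma borel_measurable_finite_index:
  fixes h :: "'b \<Rightarrow> 'a::topological_space \<Rightarrow> real"
  assumes "finite J" "\<And>x. Y x \<in> J" and Y: "\<And>v. v \<in> J \<Longrightarrow> {x. Y x = v} \<in> sets borel"
    and h: "\<And>v. v \<in> J \<Longrightarrow> h v \<in> borel_measurable borel"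
  shows "(\<lambda>x. h (Y x) x) \<in> borel_measurable borel"
proof -
  have "(\<lambda>x. h (Y x) x) = (\<lambda>x. \<Sum>v\<in>J. indicator {x. Y x = v} x * h v x)"
    using assms(1,2) by (auto simp: fun_eq_iff indicator_def if_distrib[of "\<lambda>x. x * _"] cong: if_cong)
  also have "\<dots> \<in> borel_measurable borel"
    using Y h by (intro borel_measurable_sum borel_measurable_times borel_measurable_indicator) auto
  finally show ?thesis .
qed

section \<open>Itineraries and words\<close>

primrec word :: "('a \<Rightarrow> 'b) \<Rightarrow> ('a \<Rightarrow> 'a) \<Rightarrow> nat \<Rightarrow> 'a \<Rightarrow> 'b list" where
  "word X T 0 x = []"
| "word X T (Suc n) x = X x # word X T n (T x)"

lemma length_word [simp]: "length (word X T n x) = n"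
  by (induction n arbitrary: x) auto

lemma nth_word: "k < n \<Longrightarrow> word X T n x ! k = X ((T ^^ k) x)"
proof (induction n arbitrary: x k)
  case (Suc n)
  then show ?case by (cases k) (auto simp: funpow_swap1)
qed simp

lemma word_add: "word X T (n + k) x = word X T n x @ word X T k ((T ^^ n) x)"
  by (induction n arbitrary: x) (auto simp: funpow_swap1)

lemma map_word: "map f (word X T n x) = word (\<lambda>x. f (X x)) T n x"
  by (induction n arbitrary: x) auto

definition words :: "'b set \<Rightarrow> nat \<Rightarrow> 'b list set" where
  "words I n = {ws. set ws \<subseteq> I \<and> length ws = n}"

lemma finite_words: "finite I \<Longrightarrow> finite (words I n)"
  unfolding words_def by (rule finite_lists_length_eq)

lemma word_in_words: "(\<And>x. X x \<in> I) \<Longrightarrow> word X T n x \<in> words I n"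
  unfolding words_def by (induction n arbitrary: x) auto

lemma words_0: "words I 0 = {[]}"
  by (auto simp: words_def)

lemma sum_words_Suc:
  "(\<Sum>ws\<in>words I (Suc n). f ws) = (\<Sum>a\<in>I. \<Sum>ws\<in>words I n. f (a # ws))"
proof -
  have "bij_betw (\<lambda>(a, ws). a # ws) (I \<times> words I n) (words I (Suc n))"
    by (rule bij_betwI[of _ _ _ "\<lambda>ws. (hd ws, tl ws)"])
      (auto simp: words_def length_Suc_conv)
  from sum.reindex_bij_betw[OF this, of f] show ?thesis
    by (simp add: sum.cartesian_product case_prod_unfold)
qed

lemma sum_words_add:
  "(\<Sum>ws\<in>words I (n + k). f ws) = (\<Sum>us\<in>words I n. \<Sum>ws\<in>words I k. f (us @ ws))"
proof -
  have "bij_betw (\<lambda>(us, ws). us @ ws) (words I n \<times> words I k) (words I (n + k))"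
    by (rule bij_betwI[of _ _ _ "\<lambda>ws. (take n ws, drop n ws)"])
      (auto simp: words_def dest: in_set_takeD in_set_dropD)
  from sum.reindex_bij_betw[OF this, of f] show ?thesis
    by (simp add: sum.cartesian_product case_prod_unfold)
qed

text \<open>The map is total on the ambient space, so that iterates and preimages need no
  restriction to \<open>G\<close>; for the fractal it is instantiated by the extension
  \<open>Tm\<close> of \<open>F\<close>.\<close>

locale inv_measure = prob_space m for m :: "'a::euclidean_space measure" +
  fixes T :: "'a \<Rightarrow> 'a"
  assumes sets_m [measurable_cong, simp]: "sets m = sets borel"
    and T_meas [measurable]: "T \<in> borel_measurable borel"
    and T_inv: "\<And>B. B \<in> sets borel \<Longrightarrow> emeasure m (T -` B) = emeasure m B"
begin

lemma space_m [simp]: "space m = UNIV"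
  using sets_eq_imp_space_eq[OF sets_m] by simp

lemma prob_UNIV [simp]: "measure m UNIV = 1"
  using prob_space by simp

lemma distr_T: "distr m borel T = m"
  by (rule measure_eqI) (auto simp: emeasure_distr T_inv)

lemma integral_T:
  fixes f :: "'a \<Rightarrow> real"
  assumes [measurable]: "f \<in> borel_measurable borel"
  shows "(\<integral>x. f (T x) \<partial>m) = (\<integral>x. f x \<partial>m)"
proof -
  have "(\<integral>x. f (T x) \<partial>m) = (\<integral>x. f x \<partial>distr m borel T)"
    by (rule integral_distr[symmetric]) measurable
  then show ?thesis by (simp add: distr_T)
qed

lemma integrable_T:
  fixes f :: "'a \<Rightarrow> real"
  assumes "integrable m f"
  shows "integrable m (\<lambda>x. f (T x))"
proof (rule integrable_distr[of T m borel])
  show "T \<in> m \<rightarrow>\<^sub>M borel" by measurable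
  show "integrable (distr m borel T) f" using assms by (simp add: distr_T)
qed

lemma AE_T:
  assumes "AE x in m. P x"
  shows "AE x in m. P (T x)"
proof (rule AE_distrD[of T m borel])
  show "T \<in> m \<rightarrow>\<^sub>M borel" by measurable
  show "AE x in distr m borel T. P x" unfolding distr_T by (rule assms)
qed

lemma funpow_T_meas [measurable]: "(T ^^ n) \<in> borel_measurable borel"
proof (induction n)
  case 0
  then show ?case by (simp add: id_def)
next
  case (Suc n)
  note [measurable] = Suc
  have "(\<lambda>x. T ((T ^^ n) x)) \<in> borel_measurable borel" by measurable
  then show ?case by (simp add: comp_def)
qed

lemma inv_measure_funpow: "inv_measure m (T ^^ n)"
proof
  show "emeasure m ((T ^^ n) -` B) = emeasure m B" if "B \<in> sets borel" for B
  proof (induction n)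
    case (Suc n)
    have "(T ^^ Suc n) -` B = T -` ((T ^^ n) -` B)"
      by (auto simp: funpow_swap1)
    moreover have "(T ^^ n) -` B \<in> sets borel"
      using measurable_sets[OF funpow_T_meas that] by simp
    ultimately show ?case using Suc T_inv[of "(T ^^ n) -` B"] by (simp only:)
  qed simp
qed simp_all

lemma AE_funpow:
  assumes "AE x in m. P x"
  shows "AE x in m. \<forall>n. P ((T ^^ n) x)"
  using inv_measure.AE_T[OF inv_measure_funpow assms] by (simp add: AE_all_countable)

lemma integrable_bounded:
  fixes f :: "'a \<Rightarrow> real"
  assumes "f \<in> borel_measurable borel" "AE x in m. \<bar>f x\<bar> \<le> B"
  shows "integrable m f"
  using assms by (intro integrable_const_bound[of _ B]) auto

lemma integral_finite_valued:
  fixes f :: "'b \<Rightarrow> real"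
  assumes "finite J" "\<And>x. Y x \<in> J" and Y: "\<And>v. v \<in> J \<Longrightarrow> {x. Y x = v} \<in> sets borel"
  shows "(\<integral>x. f (Y x) \<partial>m) = (\<Sum>v\<in>J. measure m {x. Y x = v} * f v)" "integrable m (\<lambda>x. f (Y x))"
proof -
  have eq: "(\<lambda>x. f (Y x)) = (\<lambda>x. \<Sum>v\<in>J. indicator {x. Y x = v} x * f v)"
    using assms(1,2) by (auto simp: fun_eq_iff indicator_def if_distrib[of "\<lambda>x. x * _"] cong: if_cong)
  have int: "integrable m (\<lambda>x. indicator {x. Y x = v} x * f v)" if "v \<in> J" for v
    using Y[OF that] by (intro integrable_mult_left integrable_real_indicator) (auto simp: emeasure_eq_measure)
  show "integrable m (\<lambda>x. f (Y x))" unfolding eq using int by (rule Bochner_Integration.integrable_sum)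
  show "(\<integral>x. f (Y x) \<partial>m) = (\<Sum>v\<in>J. measure m {x. Y x = v} * f v)"
    unfolding eq using int by (subst Bochner_Integration.integral_sum) (auto intro!: sum.cong)
qed

end

text \<open>A finite measurable partition is given by a labelling function. Labels, unlike cells,
  stay distinct when cells are empty, which keeps sums over words free of collisions.\<close>

locale coded_measure = inv_measure m T for m :: "'a::euclidean_space measure" and T +
  fixes X :: "'a \<Rightarrow> 'b" and I :: "'b set"
  assumes finite_I: "finite I" and X_in: "\<And>x. X x \<in> I"
    and X_meas: "\<And>v. v \<in> I \<Longrightarrow> {x. X x = v} \<in> sets borel"
begin

definition prb :: "'b list \<Rightarrow> real" where
  "prb ws = measure m {x. word X T (length ws) x = ws}"

definition ent :: "nat \<Rightarrow> real" where
  "ent n = - (\<Sum>ws\<in>words I n. prb ws * ln (prb ws))"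

lemma word_meas: "ws \<in> words I n \<Longrightarrow> {x. word X T n x = ws} \<in> sets borel"
proof (induction n arbitrary: ws)
  case 0
  then show ?case by (simp add: words_def)
next
  case (Suc n)
  then obtain a us where ws: "ws = a # us" "a \<in> I" "us \<in> words I n"
    by (auto simp: words_def length_Suc_conv)
  have "{x. word X T (Suc n) x = ws} = {x. X x = a} \<inter> T -` {x. word X T n x = us}"
    by (auto simp: ws)
  moreover have "T -` {x. word X T n x = us} \<in> sets borel"
    using measurable_sets[OF T_meas Suc.IH[OF ws(3)]] by simp
  ultimately show ?case using X_meas[OF ws(2)] by auto
qed

lemma word_words [simp]: "word X T n x \<in> words I n"
  by (rule word_in_words) (rule X_in)

lemma integral_word:
  fixes f :: "'b list \<Rightarrow> real"
  shows "(\<integral>x. f (word X T n x) \<partial>m) = (\<Sum>ws\<in>words I n. prb ws * f ws)"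
    and "integrable m (\<lambda>x. f (word X T n x))"
proof -
  have "(\<integral>x. f (word X T n x) \<partial>m) = (\<Sum>ws\<in>words I n. measure m {x. word X T n x = ws} * f ws)"
    by (rule integral_finite_valued) (auto simp: finite_words finite_I word_meas)
  also have "\<dots> = (\<Sum>ws\<in>words I n. prb ws * f ws)"
    by (rule sum.cong) (auto simp: prb_def words_def)
  finally show "(\<integral>x. f (word X T n x) \<partial>m) = (\<Sum>ws\<in>words I n. prb ws * f ws)" .
  show "integrable m (\<lambda>x. f (word X T n x))"
    by (rule integral_finite_valued(2)[of "words I n"]) (auto simp: finite_words finite_I word_meas)
qed

lemma prb_nonneg [simp]: "0 \<le> prb ws"
  by (simp add: prb_def)

lemma sum_prb: "(\<Sum>ws\<in>words I n. prb ws) = 1"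
  using integral_word(1)[of "\<lambda>_. 1" n] prob_space by simp

lemma ent_integral: "ent n = (\<integral>x. - ln (prb (word X T n x)) \<partial>m)"
  unfolding integral_word(1)[of "\<lambda>ws. - ln (prb ws)"] ent_def by (simp add: sum_negf)

lemma ent_nonneg: "0 \<le> ent n"
  unfolding ent_def neg_0_le_iff_le
proof (rule sum_nonpos)
  show "prb ws * ln (prb ws) \<le> 0" for ws
  proof (cases "prb ws = 0")
    case False
    then have "0 < prb ws" using prb_nonneg[of ws] by linarith
    moreover have "prb ws \<le> 1" by (simp add: prb_def)
    ultimately show ?thesis by (intro mult_nonneg_nonpos) auto
  qed simp
qed

text \<open>Cross entropy is written as an integral along itineraries because logarithms of products
  then split, and invariance of the measure applies to the shifted factors.\<close>

lemma ent_le_integral: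
  assumes "\<And>ws. ws \<in> words I n \<Longrightarrow> 0 \<le> r ws" "(\<Sum>ws\<in>words I n. r ws) \<le> 1"
    and "\<And>ws. ws \<in> words I n \<Longrightarrow> 0 < prb ws \<Longrightarrow> 0 < r ws"
  shows "ent n \<le> (\<integral>x. - ln (r (word X T n x)) \<partial>m)"
proof -
  have "ent n \<le> - (\<Sum>ws\<in>words I n. prb ws * ln (r ws))"
    unfolding ent_def using assms
    by (intro gibbs_inequality) (auto simp: sum_prb finite_words finite_I)
  then show ?thesis
    unfolding integral_word(1)[of "\<lambda>ws. - ln (r ws)"] by (simp add: sum_negf)
qed

lemma prb_append_le:
  assumes "us \<in> words I n" "ws \<in> words I k"
  shows "prb (us @ ws) \<le> prb us" "prb (us @ ws) \<le> prb ws"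
proof -
  have len: "length us = n" "length ws = k" using assms by (auto simp: words_def)
  have sub: "{x. word X T (n + k) x = us @ ws} = {x. word X T n x = us} \<inter> (T ^^ n) -` {x. word X T k x = ws}"
    by (auto simp: word_add len)
  have m1: "{x. word X T n x = us} \<in> sets borel" and m2: "{x. word X T k x = ws} \<in> sets borel"
    using assms word_meas by auto
  have m3: "(T ^^ n) -` {x. word X T k x = ws} \<in> sets borel"
    using measurable_sets[OF funpow_T_meas m2] by simp
  show "prb (us @ ws) \<le> prb us"
    unfolding prb_def length_append len sub by (rule finite_measure_mono) (use m1 in auto)
  have "prb (us @ ws) \<le> measure m ((T ^^ n) -` {x. word X T k x = ws})"
    unfolding prb_def length_append len sub by (rule finite_measure_mono) (use m3 in auto)
  also have "\<dots> = prb ws"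
    using inv_measure.T_inv[OF inv_measure_funpow m2] by (simp add: prb_def measure_def len)
  finally show "prb (us @ ws) \<le> prb ws" .
qed

text \<open>Gibbs' inequality against the product of the two marginal distributions, which charges
  every word that is charged; invariance identifies the law of the last \<open>k\<close> letters
  with that of the first \<open>k\<close>.\<close>

lemma ent_subadd: "ent (n + k) \<le> ent n + ent k"
proof -
  define r where "r ws = prb (take n ws) * prb (drop n ws)" for ws
  have split: "\<exists>us vs. ws = us @ vs \<and> us \<in> words I n \<and> vs \<in> words I k" if "ws \<in> words I (n + k)" for ws
    using that by (intro exI[of _ "take n ws"] exI[of _ "drop n ws"])
      (auto simp: words_def dest: in_set_takeD in_set_dropD)
  have r: "r (us @ vs) = prb us * prb vs" if "us \<in> words I n" for us vs
    using that by (simp add: r_def words_def)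
  have "(\<Sum>ws\<in>words I (n + k). r ws) = (\<Sum>us\<in>words I n. \<Sum>ws\<in>words I k. prb us * prb ws)"
    unfolding sum_words_add by (intro sum.cong refl r)
  also have "\<dots> = 1" by (simp add: sum_prb flip: sum_distrib_left)
  finally have sum_r: "(\<Sum>ws\<in>words I (n + k). r ws) = 1" .
  have pos: "0 < prb (take n ws)" "0 < prb (drop n ws)" if ws: "ws \<in> words I (n + k)" "0 < prb ws" for ws
  proof -
    obtain us vs where "ws = us @ vs" "us \<in> words I n" "vs \<in> words I k" using split[OF ws(1)] by blast
    then show "0 < prb (take n ws)" "0 < prb (drop n ws)"
      using prb_append_le[of us n vs k] ws(2) by (auto simp: words_def)
  qed
  have "ent (n + k) \<le> (\<integral>x. - ln (r (word X T (n + k) x)) \<partial>m)"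
    by (rule ent_le_integral) (auto simp: sum_r, auto simp: r_def pos)
  also have "\<dots> = (\<Sum>ws\<in>words I (n + k). prb ws * - ln (r ws))" by (rule integral_word(1))
  also have "\<dots> = (\<Sum>ws\<in>words I (n + k). prb ws * (- ln (prb (take n ws)) - ln (prb (drop n ws))))"
  proof (rule sum.cong[OF refl])
    fix ws assume ws: "ws \<in> words I (n + k)"
    show "prb ws * - ln (r ws) = prb ws * (- ln (prb (take n ws)) - ln (prb (drop n ws)))"
    proof (cases "prb ws = 0")
      case False
      then have "0 < prb ws" using prb_nonneg[of ws] by linarith
      from pos[OF ws this] show ?thesis by (simp add: r_def ln_mult)
    qed simp
  qed
  also have "\<dots> = (\<integral>x. - ln (prb (take n (word X T (n + k) x))) - ln (prb (drop n (word X T (n + k) x))) \<partial>m)"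
    by (rule integral_word(1)[symmetric])
  also have "\<dots> = (\<integral>x. - ln (prb (word X T n x)) + - ln (prb (word X T k ((T ^^ n) x))) \<partial>m)"
    by (simp add: word_add)
  also have "\<dots> = (\<integral>x. - ln (prb (word X T n x)) \<partial>m) + (\<integral>x. - ln (prb (word X T k ((T ^^ n) x))) \<partial>m)"
    by (intro Bochner_Integration.integral_add integral_word(2)
      inv_measure.integrable_T[OF inv_measure_funpow, of "\<lambda>x. - ln (prb (word X T k x))"])
  also have "(\<integral>x. - ln (prb (word X T k ((T ^^ n) x))) \<partial>m) = (\<integral>x. - ln (prb (word X T k x)) \<partial>m)"
    using borel_measurable_integrable[OF integral_word(2), of "\<lambda>ws. - ln (prb ws)" k]
    by (intro inv_measure.integral_T[OF inv_measure_funpow, of "\<lambda>x. - ln (prb (word X T k x))"])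
      (simp add: measurable_cong_sets[OF sets_m refl])
  finally show ?thesis by (simp add: ent_integral)
qed

lemma ent_convergent: "convergent (\<lambda>n. ent (Suc n) / real (Suc n))"
  by (rule fekete_convergent) (simp_all add: ent_subadd ent_nonneg)

end

text \<open>A join is a set of cells, so words with the same cell are counted once. A nonempty cell
  belongs to a single word, and the cells that repeat are empty and contribute nothing, so summing
  over words gives the same value.\<close>

lemma part_entropy_join:
  fixes X :: "'a::euclidean_space \<Rightarrow> 'a set"
  assumes coded: "coded_measure m T X I" and R: "I \<in> meas_partitions G" and "G \<in> sets borel" and G0: "emeasure m (- G) = 0"
    and XG: "\<And>x. x \<in> G \<Longrightarrow> x \<in> X x"
    and FT: "\<And>x. x \<in> G \<Longrightarrow> F x = T x" and TG: "\<And>x. x \<in> G \<Longrightarrow> T x \<in> G"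
  shows "part_entropy m (join_part G F I n) = coded_measure.ent m T X I n"
proof -
  interpret coded_measure m T X I by (rule coded)
  have pow: "(F ^^ k) x = (T ^^ k) x \<and> (T ^^ k) x \<in> G" if "x \<in> G" for k x
    using that by (induction k) (auto simp: FT TG)
  have mem: "y \<in> v \<longleftrightarrow> X y = v" if "y \<in> G" "v \<in> I" for y v
    using XG[OF that(1)] X_in[of y] that(2) R unfolding meas_partitions_def by blast
  let ?c = "\<lambda>ws. G \<inter> {x. word X T n x = ws}"
  have c_eq: "?c ws = G \<inter> (\<Inter>k<n. (F ^^ k) -` (ws ! k))" if "ws \<in> words I n" for ws
  proof -
    have "word X T n x = ws \<longleftrightarrow> (\<forall>k<n. (F ^^ k) x \<in> ws ! k)" if "x \<in> G" for x
    proof -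
      have "word X T n x = ws \<longleftrightarrow> (\<forall>k<n. X ((T ^^ k) x) = ws ! k)"
        using \<open>ws \<in> words I n\<close> by (auto simp: list_eq_iff_nth_eq nth_word words_def)
      also have "\<dots> \<longleftrightarrow> (\<forall>k<n. (F ^^ k) x \<in> ws ! k)"
      proof (intro all_cong)
        fix k assume "k < n"
        then have "ws ! k \<in> I" using \<open>ws \<in> words I n\<close> by (auto simp: words_def)
        then show "X ((T ^^ k) x) = ws ! k \<longleftrightarrow> (F ^^ k) x \<in> ws ! k"
          using mem[of "(T ^^ k) x" "ws ! k"] pow[OF that, of k] by simp
      qed
      finally show ?thesis .
    qed
    then show ?thesis by auto
  qed
  have join: "join_part G F I n = ?c ` words I n"
  proof (intro equalityI subsetI)
    fix E assume "E \<in> join_part G F I n"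
    then obtain B where B: "E = G \<inter> (\<Inter>k<n. (F ^^ k) -` (B k))" "\<forall>k<n. B k \<in> I"
      unfolding join_part_def by auto
    have ws: "map B [0..<n] \<in> words I n" using B(2) by (auto simp: words_def)
    have "E = ?c (map B [0..<n])" unfolding c_eq[OF ws] B(1) by auto
    with ws show "E \<in> ?c ` words I n" by blast
  next
    fix E assume "E \<in> ?c ` words I n"
    then obtain ws where ws: "ws \<in> words I n" "E = ?c ws" by blast
    then show "E \<in> join_part G F I n"
      unfolding c_eq[OF ws(1)] ws(2) join_part_def
      by (auto simp: words_def intro!: exI[of _ "\<lambda>k. ws ! k"])
  qed
  have c_meas: "measure m (?c ws) = prb ws" if "ws \<in> words I n" for ws
  proof -
    have "AE x in m. x \<in> G" using G0 \<open>G \<in> sets borel\<close>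
      by (intro AE_I[of _ _ "- G"]) auto
    then have "measure m (?c ws) = measure m {x. word X T n x = ws}"
      using word_meas[OF that] \<open>G \<in> sets borel\<close> by (intro finite_measure_eq_AE) auto
    then show ?thesis using that by (simp add: prb_def words_def)
  qed
  have "(\<Sum>E\<in>?c ` words I n. measure m E * ln (measure m E)) =
      (\<Sum>ws\<in>words I n. measure m (?c ws) * ln (measure m (?c ws)))"
  proof (subst sum.reindex_nontrivial)
    show "finite (words I n)" by (simp add: finite_words finite_I)
    fix us ws assume "us \<in> words I n" "ws \<in> words I n" "us \<noteq> ws" "?c us = ?c ws"
    then have "?c us = {}" by blast
    then show "measure m (?c us) * ln (measure m (?c us)) = 0" by simp
  qed simp
  also have "\<dots> = - ent n" unfolding ent_def by (simp add: c_meas)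
  finally show ?thesis unfolding part_entropy_def join by simp
qed

section \<open>Continuous functions are dense in L1\<close>

text \<open>Regularity gives a compact set inside \<open>A\<close> and an open set containing
  \<open>A\<close> whose measures differ by less than \<open>e\<close>; a Urysohn function between
  them differs from the indicator only in the gap.\<close>

lemma indicator_L1_continuous_approx:
  fixes m :: "'a::euclidean_space measure"
  assumes "finite_measure m" and sets_m: "sets m = sets borel" and A: "A \<in> sets borel" and e: "0 < e"
  shows "\<exists>u. continuous_on UNIV u \<and> (\<forall>x. 0 \<le> u x \<and> u x \<le> (1::real)) \<and>
    (\<integral>x. \<bar>indicator A x - u x\<bar> \<partial>m) < e"
proof -
  interpret finite_measure m by fact
  have sp: "space m = UNIV" using sets_eq_imp_space_eq[OF sets_m] by simp
  have fin: "emeasure m (space m) \<noteq> \<infinity>" by (simp add: emeasure_eq_measure)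
  obtain K where K: "K \<subseteq> A" "compact K" "measure m A - e / 2 < measure m K"
  proof (rule ccontr)
    assume "\<not> thesis"
    with that have le: "measure m K \<le> measure m A - e / 2" if "K \<subseteq> A" "compact K" for K
      using that not_le by blast
    have "emeasure m A = (SUP K\<in>{K. K \<subseteq> A \<and> compact K}. emeasure m K)"
      by (rule inner_regular[OF sets_m fin A])
    also have "\<dots> \<le> ennreal (measure m A - e / 2)"
      by (rule SUP_least) (auto simp: emeasure_eq_measure intro!: ennreal_leI le)
    finally have "measure m A \<le> measure m A - e / 2"
      using le[of "{}"] by (simp add: emeasure_eq_measure)
    with e show False by simp
  qed
  obtain U where U: "A \<subseteq> U" "open U" "measure m U < measure m A + e / 2"
  proof (rule ccontr)
    assume "\<not> thesis"
    with that have le: "measure m A + e / 2 \<le> measure m U" if "A \<subseteq> U" "open U" for U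
      using that not_le by blast
    have "ennreal (measure m A + e / 2) \<le> (INF U\<in>{U. A \<subseteq> U \<and> open U}. emeasure m U)"
      by (rule INF_greatest) (auto simp: emeasure_eq_measure intro!: ennreal_leI le)
    also have "\<dots> = emeasure m A"
      by (rule outer_regular[OF sets_m fin A, symmetric])
    finally have "measure m A + e / 2 \<le> measure m A"
      by (simp add: emeasure_eq_measure)
    with e show False by simp
  qed
  obtain u :: "'a \<Rightarrow> real" where u: "continuous_on UNIV u" "\<And>x. u x \<in> closed_segment 1 0"
      "\<And>x. x \<in> K \<Longrightarrow> u x = 1" "\<And>x. x \<in> - U \<Longrightarrow> u x = 0"
    by (rule Urysohn[of K "- U" "1::real" 0])
      (use K U in \<open>auto simp: compact_imp_closed\<close>)
  have u01: "0 \<le> u x \<and> u x \<le> 1" for x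
    using u(2)[of x] by (simp add: closed_segment_eq_real_ivl)
  have [measurable]: "u \<in> borel_measurable m" "A \<in> sets m" "K \<in> sets m" "U \<in> sets m"
    using borel_measurable_continuous_onI[OF u(1)] A K U
    by (auto simp: measurable_cong_sets[OF sets_m refl] sets_m compact_imp_closed)
  have le: "\<bar>indicator A x - u x\<bar> \<le> indicator (U - K) x" for x
    using K(1) U(1) u(3)[of x] u(4)[of x] u01[of x] by (auto simp: indicator_def)
  have "(\<integral>x. \<bar>indicator A x - u x\<bar> \<partial>m) \<le> (\<integral>x. indicator (U - K) x \<partial>m)"
    by (rule integral_mono'[OF _ le]) (auto simp: emeasure_eq_measure)
  also have "\<dots> = measure m U - measure m K"
    using K U by (subst finite_measure_Diff[symmetric]) (auto simp: sp)
  also have "\<dots> < e" using K U by simp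
  finally show ?thesis using u(1) u01 by blast
qed

lemma L1_continuous_approx:
  fixes m :: "'a::euclidean_space measure" and f :: "'a \<Rightarrow> real"
  assumes "finite_measure m" and sets_m: "sets m = sets borel" and f: "integrable m f" and "0 < e"
  shows "\<exists>u. continuous_on UNIV u \<and> integrable m u \<and> (\<integral>x. \<bar>f x - u x\<bar> \<partial>m) < e"
  using f \<open>0 < e\<close>
proof (induction f arbitrary: e rule: integrable_induct)
  case (base A c)
  interpret finite_measure m by fact
  have A: "A \<in> sets borel" using base(1) sets_m by simp
  \<comment> \<open>The summand 1 covers the case \<open>c = 0\<close>.\<close>
  have "0 < e / (\<bar>c\<bar> + 1)" using base by simp
  from indicator_L1_continuous_approx[OF assms(1) sets_m A this]
  obtain u where u: "continuous_on UNIV u" "\<And>x. 0 \<le> u x \<and> u x \<le> (1::real)"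
    "(\<integral>x. \<bar>indicator A x - u x\<bar> \<partial>m) < e / (\<bar>c\<bar> + 1)" by blast
  have um: "u \<in> borel_measurable m"
    using borel_measurable_continuous_onI[OF u(1)] by (simp add: measurable_cong_sets[OF sets_m refl])
  have "integrable m u" using um u(2) by (intro integrable_const_bound[of _ 1]) auto
  then have int: "integrable m (\<lambda>x. u x * c)" by simp
  have "(\<integral>x. \<bar>indicator A x *\<^sub>R c - u x * c\<bar> \<partial>m) = (\<integral>x. \<bar>indicator A x - u x\<bar> * \<bar>c\<bar> \<partial>m)"
    by (simp flip: abs_mult add: left_diff_distrib)
  also have "\<dots> = (\<integral>x. \<bar>indicator A x - u x\<bar> \<partial>m) * \<bar>c\<bar>" by simp
  also have "\<dots> \<le> (\<integral>x. \<bar>indicator A x - u x\<bar> \<partial>m) * (\<bar>c\<bar> + 1)"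
    by (intro mult_left_mono) auto
  also have "\<dots> < e" using u(3) by (simp add: pos_less_divide_eq)
  finally show ?case using u(1) int
    by (intro exI[of _ "\<lambda>x. u x * c"]) (auto intro!: continuous_intros)
next
  case (add f g)
  obtain u where u: "continuous_on UNIV u" "integrable m u" "(\<integral>x. \<bar>f x - u x\<bar> \<partial>m) < e / 2"
    using add.IH(1)[of "e / 2"] add.prems by auto
  obtain v where v: "continuous_on UNIV v" "integrable m v" "(\<integral>x. \<bar>g x - v x\<bar> \<partial>m) < e / 2"
    using add.IH(2)[of "e / 2"] add.prems by auto
  have "(\<integral>x. \<bar>f x + g x - (u x + v x)\<bar> \<partial>m) \<le> (\<integral>x. \<bar>f x - u x\<bar> + \<bar>g x - v x\<bar> \<partial>m)"
    using add.hyps u v by (intro integral_mono) auto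
  also have "\<dots> = (\<integral>x. \<bar>f x - u x\<bar> \<partial>m) + (\<integral>x. \<bar>g x - v x\<bar> \<partial>m)"
    using add.hyps u v by (intro Bochner_Integration.integral_add) auto
  finally show ?case using u v
    by (intro exI[of _ "\<lambda>x. u x + v x"]) (auto intro!: continuous_intros)
next
  case (lim f s)
  \<comment> \<open>The approximants satisfy
    \<open>\<bar>s i x\<bar> \<le> 2 * \<bar>f x\<bar>\<close>, hence the factor 3 in the dominating
    function.\<close>
  have "(\<lambda>i. \<integral>x. \<bar>f x - s i x\<bar> \<partial>m) \<longlonglongrightarrow> (\<integral>x. 0 \<partial>m)"
  proof (rule integral_dominated_convergence[where w = "\<lambda>x. 3 * \<bar>f x\<bar>"])
    show "AE x in m. (\<lambda>i. \<bar>f x - s i x\<bar>) \<longlonglongrightarrow> 0"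
    proof (rule AE_I2)
      fix x assume "x \<in> space m"
      from tendsto_diff[OF tendsto_const[of "f x"] lim.hyps(2)[OF this]]
      show "(\<lambda>i. \<bar>f x - s i x\<bar>) \<longlonglongrightarrow> 0" by (simp add: tendsto_rabs_zero)
    qed
    show "AE x in m. norm \<bar>f x - s i x\<bar> \<le> 3 * \<bar>f x\<bar>" for i
    proof (rule AE_I2)
      fix x assume "x \<in> space m"
      from lim.hyps(3)[OF this, of i] show "norm \<bar>f x - s i x\<bar> \<le> 3 * \<bar>f x\<bar>" by simp
    qed
  qed (use lim.hyps in auto)
  then have "(\<lambda>i. \<integral>x. \<bar>f x - s i x\<bar> \<partial>m) \<longlonglongrightarrow> 0" by simp
  then have "\<forall>\<^sub>F i in sequentially. (\<integral>x. \<bar>f x - s i x\<bar> \<partial>m) < e / 2"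
    using lim.prems by (intro order_tendstoD) auto
  then obtain i where i: "(\<integral>x. \<bar>f x - s i x\<bar> \<partial>m) < e / 2"
    by (auto simp: eventually_sequentially)
  obtain u where u: "continuous_on UNIV u" "integrable m u" "(\<integral>x. \<bar>s i x - u x\<bar> \<partial>m) < e / 2"
    using lim.IH[of "e / 2" i] lim.prems by auto
  have "(\<integral>x. \<bar>f x - u x\<bar> \<partial>m) \<le> (\<integral>x. \<bar>f x - s i x\<bar> + \<bar>s i x - u x\<bar> \<partial>m)"
    using lim.hyps(1,4) u by (intro integral_mono) auto
  also have "\<dots> = (\<integral>x. \<bar>f x - s i x\<bar> \<partial>m) + (\<integral>x. \<bar>s i x - u x\<bar> \<partial>m)"
    using lim.hyps(1,4) u by (intro Bochner_Integration.integral_add) auto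
  finally show ?case using u i by (intro exI[of _ u]) auto
qed

section \<open>An upper bound for the entropy rate\<close>

primrec pt :: "('b \<Rightarrow> 'a \<Rightarrow> 'a) \<Rightarrow> 'a \<Rightarrow> 'b list \<Rightarrow> 'a" where
  "pt \<sigma> z [] = z"
| "pt \<sigma> z (a # as) = \<sigma> a (pt \<sigma> z as)"

text \<open>The probability of a word for the chain that starts at \<open>z\<close> and moves from
  \<open>y\<close> to \<open>\<sigma> a y\<close> with probability \<open>\<phi> a y\<close>;
  letters are generated from the last one to the first.\<close>

primrec wt :: "('b \<Rightarrow> 'a \<Rightarrow> 'a) \<Rightarrow> ('b \<Rightarrow> 'a \<Rightarrow> real) \<Rightarrow> 'a \<Rightarrow> 'b list \<Rightarrow> real" where
  "wt \<sigma> \<phi> z [] = 1"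
| "wt \<sigma> \<phi> z (a # as) = \<phi> a (pt \<sigma> z as) * wt \<sigma> \<phi> z as"

text \<open>Letters may carry more information than the branch, since \<open>\<sigma>\<close> need
  not be injective in the letter. The two almost-everywhere conditions say that the measure lives on
  \<open>G\<close> and that the letter of \<open>x\<close> selects the branch leading from
  \<open>T x\<close> back to \<open>x\<close>.\<close>

locale coded_ifs = coded_measure m T X I for m :: "'a::euclidean_space measure" and T and X :: "'a \<Rightarrow> 'b" and I +
  fixes \<sigma> :: "'b \<Rightarrow> 'a \<Rightarrow> 'a" and G :: "'a set" and C :: real
  assumes G_compact: "compact G" and G_ne: "G \<noteq> {}"
    and \<sigma>_G: "\<And>a x. a \<in> I \<Longrightarrow> x \<in> G \<Longrightarrow> \<sigma> a x \<in> G"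
    and C: "0 \<le> C" "C < 1"
    and \<sigma>_contr: "\<And>a x y. a \<in> I \<Longrightarrow> x \<in> G \<Longrightarrow> y \<in> G \<Longrightarrow> dist (\<sigma> a x) (\<sigma> a y) \<le> C * dist x y"
    and AE_G: "AE x in m. x \<in> G"
    and AE_\<sigma>: "AE x in m. \<sigma> (X x) (T x) = x"
begin

lemma pt_in_G: "z \<in> G \<Longrightarrow> ws \<in> words I n \<Longrightarrow> pt \<sigma> z ws \<in> G"
  by (induction ws arbitrary: n) (auto simp: words_def \<sigma>_G)

lemma AE_good: "AE x in m. \<forall>n. (T ^^ n) x \<in> G \<and> \<sigma> (X ((T ^^ n) x)) (T ((T ^^ n) x)) = (T ^^ n) x"
  using AE_conjI[OF AE_G AE_\<sigma>] by (rule AE_funpow)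

text \<open>The word records the branches that lead from \<open>(T ^^ n) x\<close> back to
  \<open>x\<close>; following them from \<open>z\<close> instead shrinks the distance by a factor
  \<open>C\<close> at each letter.\<close>

lemma dist_pt_word:
  assumes "z \<in> G" and "\<forall>n. (T ^^ n) x \<in> G \<and> \<sigma> (X ((T ^^ n) x)) (T ((T ^^ n) x)) = (T ^^ n) x"
  shows "dist (pt \<sigma> z (word X T n x)) x \<le> C ^ n * diameter G"
  using assms(2)
proof (induction n arbitrary: x)
  case 0
  have "x \<in> G" using 0[rule_format, of 0] by simp
  then show ?case
    using assms(1) diameter_bounded_bound[OF compact_imp_bounded[OF G_compact]] by simp
next
  case (Suc n)
  have Tx: "\<forall>n. (T ^^ n) (T x) \<in> G \<and> \<sigma> (X ((T ^^ n) (T x))) (T ((T ^^ n) (T x))) = (T ^^ n) (T x)"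
  proof
    fix n
    show "(T ^^ n) (T x) \<in> G \<and> \<sigma> (X ((T ^^ n) (T x))) (T ((T ^^ n) (T x))) = (T ^^ n) (T x)"
      using Suc.prems[rule_format, of "Suc n"] by (simp add: funpow_swap1)
  qed
  have x: "\<sigma> (X x) (T x) = x" using Suc.prems[rule_format, of 0] by simp
  have "T x \<in> G" using Tx[rule_format, of 0] by simp
  then have "dist (\<sigma> (X x) (pt \<sigma> z (word X T n (T x)))) (\<sigma> (X x) (T x)) \<le> C * dist (pt \<sigma> z (word X T n (T x))) (T x)"
    by (intro \<sigma>_contr X_in pt_in_G[OF assms(1) word_words])
  also have "\<dots> \<le> C * (C ^ n * diameter G)"
    using C by (intro mult_left_mono Suc.IH[OF Tx])
  finally show ?case by (simp add: x)
qed

lemma sum_wt: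
  assumes "z \<in> G" "\<And>y. y \<in> G \<Longrightarrow> (\<Sum>a\<in>I. \<phi> a y) = 1"
  shows "(\<Sum>ws\<in>words I n. wt \<sigma> \<phi> z ws) = 1"
proof (induction n)
  case 0
  then show ?case by (simp add: words_0)
next
  case (Suc n)
  have "(\<Sum>ws\<in>words I (Suc n). wt \<sigma> \<phi> z ws) =
      (\<Sum>ws\<in>words I n. \<Sum>a\<in>I. \<phi> a (pt \<sigma> z ws) * wt \<sigma> \<phi> z ws)"
    unfolding sum_words_Suc by (subst sum.swap) simp
  also have "\<dots> = (\<Sum>ws\<in>words I n. (\<Sum>a\<in>I. \<phi> a (pt \<sigma> z ws)) * wt \<sigma> \<phi> z ws)"
    by (simp add: sum_distrib_right)
  also have "\<dots> = (\<Sum>ws\<in>words I n. wt \<sigma> \<phi> z ws)"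
    using assms(2)[OF pt_in_G[OF assms(1)]] by (intro sum.cong refl) auto
  finally show ?case using Suc by simp
qed

lemma wt_pos:
  assumes "z \<in> G" "\<And>a y. a \<in> I \<Longrightarrow> y \<in> G \<Longrightarrow> 0 < \<phi> a y"
  shows "ws \<in> words I n \<Longrightarrow> 0 < wt \<sigma> \<phi> z ws"
proof (induction ws arbitrary: n)
  case (Cons a ws)
  then have "a \<in> I" "ws \<in> words I (length ws)" by (auto simp: words_def)
  then show ?case using Cons.IH pt_in_G[OF assms(1)] assms(2) by simp
qed simp

lemma coded_image: "coded_measure m T (\<lambda>x. f (X x)) (f ` I)"
proof
  show "{x. f (X x) = v} \<in> sets borel" for v
  proof -
    have "{x. f (X x) = v} = (\<Union>a\<in>{a\<in>I. f a = v}. {x. X x = a})" using X_in by auto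
    also have "\<dots> \<in> sets borel" using finite_I X_meas by (intro sets.finite_UN) auto
    finally show ?thesis .
  qed
qed (auto simp: finite_I X_in)

text \<open>Applying \<open>f\<close> to the letters pushes the word weights to a probability vector
  on coarser words, in which a coarse word weighs at least as much as any word above it. Gibbs'
  inequality for the coarse vector therefore yields a bound by the fine weights. Later
  \<open>f\<close> forgets the branch and keeps the cell of an arbitrary partition.\<close>

lemma ent_image_le:
  fixes f :: "'b \<Rightarrow> 'c"
  assumes z: "z \<in> G" and sum1: "\<And>y. y \<in> G \<Longrightarrow> (\<Sum>a\<in>I. \<phi> a y) = 1"
    and pos: "\<And>a y. a \<in> I \<Longrightarrow> y \<in> G \<Longrightarrow> 0 < \<phi> a y"
  shows "coded_measure.ent m T (\<lambda>x. f (X x)) (f ` I) n \<le> (\<integral>x. - ln (wt \<sigma> \<phi> z (word X T n x)) \<partial>m)"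
proof -
  interpret f: coded_measure m T "\<lambda>x. f (X x)" "f ` I" by (rule coded_image)
  define r where "r rs = (\<Sum>ws\<in>{ws \<in> words I n. map f ws = rs}. wt \<sigma> \<phi> z ws)" for rs
  have fin: "finite (words I n)" by (simp add: finite_words finite_I)
  have img: "map f ` words I n = words (f ` I) n"
  proof -
    have "map f ` words I n = {rs \<in> lists (f ` I). length rs = n}"
      unfolding lists_image words_def by (auto simp: in_lists_conv_set subset_eq)
    then show ?thesis by (auto simp: words_def in_lists_conv_set subset_eq)
  qed
  have wpos: "0 < wt \<sigma> \<phi> z ws" if "ws \<in> words I n" for ws
    by (rule wt_pos[OF z _ that]) (rule pos)
  have le_r: "wt \<sigma> \<phi> z ws \<le> r (map f ws)" if "ws \<in> words I n" for ws
    unfolding r_def using that fin wpos by (intro member_le_sum) (auto intro: less_imp_le)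
  have "(\<Sum>rs\<in>words (f ` I) n. r rs) = (\<Sum>ws\<in>words I n. wt \<sigma> \<phi> z ws)"
    unfolding r_def by (rule sum.group[OF fin]) (simp_all add: finite_words finite_I img)
  also have "\<dots> = 1" by (rule sum_wt[OF z sum1])
  finally have sum_r: "(\<Sum>rs\<in>words (f ` I) n. r rs) = 1" .
  have r_pos: "0 < r rs" if "rs \<in> words (f ` I) n" for rs
  proof -
    have "rs \<in> map f ` words I n" using that unfolding img .
    then obtain ws where "ws \<in> words I n" "rs = map f ws" by (auto simp only: image_iff)
    then show ?thesis using le_r[of ws] wpos[of ws] by simp
  qed
  have "f.ent n \<le> (\<integral>x. - ln (r (word (\<lambda>x. f (X x)) T n x)) \<partial>m)"
    by (rule f.ent_le_integral) (auto simp: sum_r r_pos less_imp_le)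
  also have "\<dots> = (\<integral>x. - ln (r (map f (word X T n x))) \<partial>m)"
    by (simp add: map_word)
  also have "\<dots> \<le> (\<integral>x. - ln (wt \<sigma> \<phi> z (word X T n x)) \<partial>m)"
  proof (rule integral_mono)
    show "integrable m (\<lambda>x. - ln (r (map f (word X T n x))))"
      by (rule integral_word(2)[of "\<lambda>ws. - ln (r (map f ws))"])
    show "integrable m (\<lambda>x. - ln (wt \<sigma> \<phi> z (word X T n x)))"
      by (rule integral_word(2)[of "\<lambda>ws. - ln (wt \<sigma> \<phi> z ws)"])
    show "- ln (r (map f (word X T n x))) \<le> - ln (wt \<sigma> \<phi> z (word X T n x))" for x
      using le_r[OF word_words, of x] wpos[OF word_words, of x] by simp
  qed
  finally show ?thesis .
qed

text \<open>The cross entropy \<open>e n\<close> grows at each step by the integral of one new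
  factor, evaluated at a point within \<open>C ^ n * diameter G\<close> of the orbit. Uniform
  continuity makes the increments eventually at most \<open>c + \<eta>\<close>, which bounds the
  growth rate.\<close>

lemma entropy_rate_le_continuous:
  fixes f :: "'b \<Rightarrow> 'c"
  assumes cont: "\<And>a. a \<in> I \<Longrightarrow> continuous_on UNIV (\<phi> a)" and sum1: "\<And>y. (\<Sum>a\<in>I. \<phi> a y) = 1"
    and \<delta>: "0 < \<delta>" "\<And>a y. a \<in> I \<Longrightarrow> \<delta> \<le> \<phi> a y"
  shows "integrable m (\<lambda>x. - ln (\<phi> (X x) (T x)))"
    and "lim (\<lambda>n. coded_measure.ent m T (\<lambda>x. f (X x)) (f ` I) (Suc n) / real (Suc n)) \<le>
      (\<integral>x. - ln (\<phi> (X x) (T x)) \<partial>m)"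
proof -
  interpret f: coded_measure m T "\<lambda>x. f (X x)" "f ` I" by (rule coded_image)
  obtain z where z: "z \<in> G" using G_ne by blast
  have pos: "0 < \<phi> a y" if "a \<in> I" for a y using \<delta> that by (meson less_le_trans)
  have le1: "\<phi> a y \<le> 1" if "a \<in> I" for a y
  proof -
    have "\<phi> a y \<le> (\<Sum>a\<in>I. \<phi> a y)"
      using that finite_I pos by (intro member_le_sum) (auto intro: less_imp_le)
    then show ?thesis by (simp add: sum1)
  qed
  have bd: "\<bar>- ln (\<phi> a y)\<bar> \<le> - ln \<delta>" "0 \<le> - ln (\<phi> a y)" if "a \<in> I" for a y
    using \<delta> pos[OF that, of y] le1[OF that, of y] that by (auto simp: abs_if)
  have \<phi>m: "(\<lambda>x. \<phi> a (T x)) \<in> borel_measurable borel" if "a \<in> I" for a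
    using measurable_compose[OF T_meas borel_measurable_continuous_onI[OF cont[OF that]]] by simp
  have meas: "(\<lambda>x. - ln (\<phi> (X x) (T x))) \<in> borel_measurable borel"
    by (rule borel_measurable_finite_index[OF finite_I X_in X_meas, of "\<lambda>a x. - ln (\<phi> a (T x))"])
      (use \<phi>m in auto)
  show int: "integrable m (\<lambda>x. - ln (\<phi> (X x) (T x)))"
    by (rule integrable_bounded[OF meas, of "- ln \<delta>"]) (use bd X_in in auto)
  define c where "c = (\<integral>x. - ln (\<phi> (X x) (T x)) \<partial>m)"
  have c0: "0 \<le> c" unfolding c_def by (rule integral_nonneg_AE) (use bd X_in in auto)
  define e where "e n = (\<integral>x. - ln (wt \<sigma> \<phi> z (word X T n x)) \<partial>m)" for n
  \<comment> \<open>\<open>h\<close> is the contribution of the newest letter, the first of the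
    word; it depends only on a finite word and is therefore integrable.\<close>
  define h where "h = (\<lambda>ws. - ln (\<phi> (hd ws) (pt \<sigma> z (tl ws))))"
  have e_Suc: "e (Suc n) = (\<integral>x. h (word X T (Suc n) x) \<partial>m) + e n" for n
  proof -
    have "e (Suc n) = (\<integral>x. h (word X T (Suc n) x) + - ln (wt \<sigma> \<phi> z (word X T n (T x))) \<partial>m)"
      unfolding e_def
    proof (rule Bochner_Integration.integral_cong[OF refl])
      fix x
      have "0 < wt \<sigma> \<phi> z (word X T n (T x))" by (rule wt_pos[OF z pos word_words])
      then show "- ln (wt \<sigma> \<phi> z (word X T (Suc n) x)) = h (word X T (Suc n) x) + - ln (wt \<sigma> \<phi> z (word X T n (T x)))"
        using pos[OF X_in, of x "pt \<sigma> z (word X T n (T x))"] by (simp add: h_def ln_mult)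
    qed
    also have "\<dots> = (\<integral>x. h (word X T (Suc n) x) \<partial>m) + (\<integral>x. - ln (wt \<sigma> \<phi> z (word X T n (T x))) \<partial>m)"
      by (intro Bochner_Integration.integral_add integral_word(2)
        integrable_T[OF integral_word(2)[of "\<lambda>ws. - ln (wt \<sigma> \<phi> z ws)"]])
    also have "(\<integral>x. - ln (wt \<sigma> \<phi> z (word X T n (T x))) \<partial>m) = e n"
      unfolding e_def
      using borel_measurable_integrable[OF integral_word(2), of "\<lambda>ws. - ln (wt \<sigma> \<phi> z ws)" n]
      by (intro integral_T[of "\<lambda>x. - ln (wt \<sigma> \<phi> z (word X T n x))"])
        (simp add: measurable_cong_sets[OF sets_m refl])
    finally show ?thesis .
  qed
  have step: "\<exists>L. \<forall>n\<ge>L. e (Suc n) \<le> e n + c + \<eta>" if \<eta>: "0 < \<eta>" for \<eta>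
  proof -
    have "\<exists>d>0. \<forall>x\<in>G. \<forall>y\<in>G. dist x y < d \<longrightarrow> dist (ln (\<phi> a x)) (ln (\<phi> a y)) < \<eta>" if a: "a \<in> I" for a
    proof -
      have "continuous_on G (\<lambda>x. ln (\<phi> a x))"
        using continuous_on_subset[OF cont[OF a]] pos[OF a]
        by (intro continuous_on_ln) (auto simp: less_imp_neq[symmetric])
      then have "uniformly_continuous_on G (\<lambda>x. ln (\<phi> a x))"
        using G_compact by (rule compact_uniformly_continuous)
      then show ?thesis using \<eta> unfolding uniformly_continuous_on_def by (metis dist_commute)
    qed
    then obtain d where d: "\<And>a. a \<in> I \<Longrightarrow> 0 < d a"
      "\<And>a x y. a \<in> I \<Longrightarrow> x \<in> G \<Longrightarrow> y \<in> G \<Longrightarrow> dist x y < d a \<Longrightarrow> dist (ln (\<phi> a x)) (ln (\<phi> a y)) < \<eta>"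
      by metis
    have "I \<noteq> {}" using X_in by blast
    define dd where "dd = Min (d ` I)"
    have dd: "0 < dd" "\<And>a. a \<in> I \<Longrightarrow> dd \<le> d a"
      unfolding dd_def using finite_I \<open>I \<noteq> {}\<close> d(1) by auto
    have "(\<lambda>n. C ^ n * diameter G) \<longlonglongrightarrow> 0"
      using C by (intro tendsto_mult_left_zero LIMSEQ_realpow_zero) auto
    then have "\<forall>\<^sub>F n in sequentially. C ^ n * diameter G < dd"
      using dd(1) by (intro order_tendstoD) auto
    then obtain L where L: "\<And>n. n \<ge> L \<Longrightarrow> C ^ n * diameter G < dd"
      by (auto simp: eventually_sequentially)
    show ?thesis
    proof (intro exI[of _ L] allI impI)
      fix n assume n: "L \<le> n"
      have "(\<integral>x. h (word X T (Suc n) x) \<partial>m) \<le> (\<integral>x. - ln (\<phi> (X x) (T x)) + \<eta> \<partial>m)"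
      proof (rule integral_mono_AE)
        show "integrable m (\<lambda>x. h (word X T (Suc n) x))" by (rule integral_word(2))
        show "integrable m (\<lambda>x. - ln (\<phi> (X x) (T x)) + \<eta>)" using int by simp
        show "AE x in m. h (word X T (Suc n) x) \<le> - ln (\<phi> (X x) (T x)) + \<eta>"
          using AE_T[OF AE_good]
        proof eventually_elim
          case (elim x)
          have "T x \<in> G" using elim[rule_format, of 0] by simp
          have "dist (pt \<sigma> z (word X T n (T x))) (T x) < d (X x)"
            using dist_pt_word[OF z elim, of n] L[OF n] dd(2)[OF X_in, of x] by linarith
          then have "dist (ln (\<phi> (X x) (pt \<sigma> z (word X T n (T x))))) (ln (\<phi> (X x) (T x))) < \<eta>"
            by (intro d(2) X_in pt_in_G[OF z word_words] \<open>T x \<in> G\<close>)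
          then show ?case by (simp add: h_def dist_real_def abs_less_iff)
        qed
      qed
      also have "\<dots> = c + \<eta>" using int by (simp add: c_def prob_space)
      finally show "e (Suc n) \<le> e n + c + \<eta>" using e_Suc[of n] by simp
    qed
  qed
  obtain l where l: "(\<lambda>n. f.ent (Suc n) / real (Suc n)) \<longlonglongrightarrow> l"
    using f.ent_convergent by (auto simp: convergent_def)
  have "l \<le> c + \<eta>" if \<eta>: "0 < \<eta>" for \<eta>
  proof -
    obtain L where L: "\<And>n. n \<ge> L \<Longrightarrow> e (Suc n) \<le> e n + c + \<eta>" using step[OF \<eta>] by blast
    \<comment> \<open>The increments are controlled only from \<open>L\<close> on; the contribution
      \<open>e L\<close> of the earlier ones disappears after division by
      \<open>Suc n\<close>.\<close>
    have e_le: "e (L + k) \<le> e L + real k * (c + \<eta>)" for k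
    proof (induction k)
      case (Suc k)
      then show ?case using L[of "L + k"] by (simp add: algebra_simps)
    qed simp
    have "f.ent (Suc n) / real (Suc n) \<le> \<bar>e L\<bar> / real (Suc n) + (c + \<eta>)" if n: "L \<le> n" for n
    proof -
      have "f.ent (Suc n) \<le> e (Suc n)"
        unfolding e_def by (rule ent_image_le[OF z sum1 pos])
      also have "\<dots> \<le> e L + real (Suc n - L) * (c + \<eta>)" using e_le[of "Suc n - L"] n by simp
      also have "\<dots> \<le> \<bar>e L\<bar> + real (Suc n) * (c + \<eta>)"
        using c0 \<eta> by (intro add_mono mult_right_mono) auto
      finally have "f.ent (Suc n) / real (Suc n) \<le> (\<bar>e L\<bar> + real (Suc n) * (c + \<eta>)) / real (Suc n)"
        by (intro divide_right_mono) auto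
      then show ?thesis by (simp add: add_divide_distrib del: of_nat_Suc)
    qed
    moreover have "(\<lambda>n. \<bar>e L\<bar> / real (Suc n) + (c + \<eta>)) \<longlonglongrightarrow> 0 + (c + \<eta>)"
      by (intro tendsto_add tendsto_const LIMSEQ_Suc[OF lim_const_over_n])
    ultimately show ?thesis
      using l by (intro LIMSEQ_le[of _ l _ "c + \<eta>"]) auto
  qed
  then have "l \<le> c" by (rule field_le_epsilon)
  then show "lim (\<lambda>n. f.ent (Suc n) / real (Suc n)) \<le> (\<integral>x. - ln (\<phi> (X x) (T x)) \<partial>m)"
    using limI[OF l] by (simp add: c_def)
qed

text \<open>The order of the choices matters: first \<open>\<epsilon>\<close>, which fixes the lower
  bound \<open>\<epsilon> / K\<close> and with it the sensitivity \<open>K / \<epsilon>\<close> of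
  the logarithm, then the L1 tolerance \<open>\<eta>\<close>. Mixing can raise
  \<open>- ln \<phi>\<close> by at most \<open>- ln (1 - \<epsilon>)\<close>, even where
  \<open>\<phi>\<close> is small.\<close>

lemma entropy_rate_le:
  fixes f :: "'b \<Rightarrow> 'c"
  assumes \<phi>m: "\<And>a. a \<in> I \<Longrightarrow> \<phi> a \<in> borel_measurable borel"
    and nonneg: "AE y in m. \<forall>a\<in>I. 0 \<le> \<phi> a y" and sum1: "AE y in m. (\<Sum>a\<in>I. \<phi> a y) = 1"
    and pos: "AE x in m. 0 < \<phi> (X x) (T x)" and int: "integrable m (\<lambda>x. ln (\<phi> (X x) (T x)))"
  shows "lim (\<lambda>n. coded_measure.ent m T (\<lambda>x. f (X x)) (f ` I) (Suc n) / real (Suc n)) \<le>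
      - (\<integral>x. ln (\<phi> (X x) (T x)) \<partial>m)" (is "?l \<le> - ?c")
proof -
  define K where "K = real (card I)"
  have "I \<noteq> {}" using X_in by blast
  then have K1: "1 \<le> K" using finite_I by (simp add: K_def Suc_le_eq card_gt_0_iff)
  have main: "?l \<le> - ?c - ln (1 - \<epsilon>) + (K / \<epsilon> + 1) * (K * \<eta>)" if \<epsilon>: "0 < \<epsilon>" "\<epsilon> < 1" and \<eta>: "0 < \<eta>" for \<epsilon> \<eta>
  proof -
    define \<theta> where "\<theta> a y = (1 - \<epsilon>) * \<phi> a y + \<epsilon> / K" for a y
    have good: "AE y in m. (\<forall>a\<in>I. 0 \<le> \<phi> a y \<and> \<phi> a y \<le> 1) \<and> (\<Sum>a\<in>I. \<phi> a y) = 1"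
      using nonneg sum1
    proof eventually_elim
      case (elim y)
      have "\<phi> a y \<le> (\<Sum>a\<in>I. \<phi> a y)" if "a \<in> I" for a
        using that elim finite_I by (intro member_le_sum) auto
      with elim show ?case by auto
    qed
    have \<theta>_good: "AE y in m. (\<forall>a\<in>I. \<epsilon> / K \<le> \<theta> a y \<and> \<theta> a y \<le> 1 \<and> (1 - \<epsilon>) * \<phi> a y \<le> \<theta> a y) \<and> (\<Sum>a\<in>I. \<theta> a y) = 1"
      using good
    proof eventually_elim
      case (elim y)
      have "\<theta> a y \<le> 1" if "a \<in> I" for a
      proof -
        have "\<theta> a y \<le> (1 - \<epsilon>) * 1 + \<epsilon> / 1"
          unfolding \<theta>_def using elim that \<epsilon> K1
          by (intro add_mono mult_left_mono divide_left_mono) auto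
        then show ?thesis by simp
      qed
      moreover have "(\<Sum>a\<in>I. \<theta> a y) = 1"
        using elim K1 by (simp add: \<theta>_def sum.distrib K_def flip: sum_distrib_left)
      ultimately show ?case using elim \<epsilon> K1 by (auto simp: \<theta>_def)
    qed
    have \<theta>m: "\<theta> a \<in> borel_measurable borel" if "a \<in> I" for a
      unfolding \<theta>_def using \<phi>m[OF that] by (intro borel_measurable_add borel_measurable_times) auto
    have "0 < \<epsilon> / K" using \<epsilon> K1 by simp
    then have \<theta>int: "integrable m (\<theta> a)" if "a \<in> I" for a
      by (rule_tac integrable_bounded[OF \<theta>m[OF that], of 1], use \<theta>_good in eventually_elim) (use that in \<open>auto simp: abs_le_iff\<close>)
    have "\<exists>u. continuous_on UNIV u \<and> integrable m u \<and> (\<integral>x. \<bar>\<theta> a x - u x\<bar> \<partial>m) < \<eta>" if "a \<in> I" for a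
      by (rule L1_continuous_approx[OF finite_measure_axioms sets_m \<theta>int[OF that] \<eta>])
    then obtain u0 where u0: "\<And>a. a \<in> I \<Longrightarrow> continuous_on UNIV (u0 a)" "\<And>a. a \<in> I \<Longrightarrow> integrable m (u0 a)"
      "\<And>a. a \<in> I \<Longrightarrow> (\<integral>x. \<bar>\<theta> a x - u0 a x\<bar> \<partial>m) < \<eta>" by metis
    \<comment> \<open>Clamping to the range that \<open>\<theta>\<close> almost surely occupies
      cannot increase the distance to \<open>\<theta>\<close>, and it gives a positive lower bound
      everywhere.\<close>
    define u where "u a y = max (min (u0 a y) 1) (\<epsilon> / K)" for a y
    define s where "s y = (\<Sum>a\<in>I. u a y)" for y
    \<comment> \<open>Clamping destroys the normalisation. Dividing by the sum \<open>s\<close>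
      restores it at a cost of \<open>ln (s y) \<le> s y - 1\<close>, which is again at most the
      total error \<open>E y\<close>.\<close>
    define v where "v a y = u a y / s y" for a y
    have u_ge: "\<epsilon> / K \<le> u a y" and u_le: "u a y \<le> 1" for a y
      using \<epsilon> K1 by (auto simp: u_def field_simps)
    have u_pos: "0 < u a y" for a y using u_ge[of a y] \<open>0 < \<epsilon> / K\<close> by linarith
    have s_pos: "0 < s y" for y unfolding s_def using finite_I \<open>I \<noteq> {}\<close> u_pos by (intro sum_pos) auto
    have s_le: "s y \<le> K" for y
      unfolding s_def K_def using sum_mono[of I "\<lambda>a. u a y" "\<lambda>_. 1"] u_le by simp
    have u_cont: "continuous_on UNIV (u a)" if "a \<in> I" for a
      unfolding u_def using u0(1)[OF that] by (intro continuous_intros)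
    have v_cont: "continuous_on UNIV (v a)" if "a \<in> I" for a
      unfolding v_def s_def using u_cont s_pos that
      by (intro continuous_intros) (auto simp: s_def less_imp_neq[symmetric])
    have v_sum: "(\<Sum>a\<in>I. v a y) = 1" for y
      using s_pos[of y] by (simp add: v_def s_def flip: sum_divide_distrib)
    have v_ge: "\<epsilon> / K / K \<le> v a y" for a y
      unfolding v_def using u_ge[of a y] s_le[of y] s_pos[of y] u_pos[of a y] by (intro frac_le) auto
    have \<delta>: "0 < \<epsilon> / K / K" using \<epsilon> K1 by simp
    note rate = entropy_rate_le_continuous[of v "\<epsilon> / K / K", OF v_cont v_sum \<delta> v_ge]
    define E where "E y = (\<Sum>a\<in>I. \<bar>\<theta> a y - u0 a y\<bar>)" for y
    have E_int: "integrable m E" unfolding E_def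
      using \<theta>int u0(2) by (intro Bochner_Integration.integrable_sum integrable_abs Bochner_Integration.integrable_diff) auto
    have "(\<integral>y. E y \<partial>m) = (\<Sum>a\<in>I. \<integral>y. \<bar>\<theta> a y - u0 a y\<bar> \<partial>m)"
      unfolding E_def using \<theta>int u0(2) by (intro Bochner_Integration.integral_sum integrable_abs Bochner_Integration.integrable_diff) auto
    also have "\<dots> \<le> (\<Sum>a\<in>I. \<eta>)" using u0(3) by (intro sum_mono) (auto intro: less_imp_le)
    finally have E_le: "(\<integral>y. E y \<partial>m) \<le> K * \<eta>" by (simp add: K_def)
    have Em: "E \<in> borel_measurable borel"
      using borel_measurable_integrable[OF E_int] by (simp add: measurable_cong_sets[OF sets_m refl])
    have "?l \<le> (\<integral>x. - ln (v (X x) (T x)) \<partial>m)" by (rule rate(2))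
    \<comment> \<open>In the coefficient of \<open>E\<close>, the part \<open>K / \<epsilon>\<close>
      comes from comparing \<open>ln u\<close> with \<open>ln \<theta>\<close>, the summand 1 from
      \<open>ln s\<close>.\<close>
    also have "\<dots> \<le> (\<integral>x. (- ln (\<phi> (X x) (T x)) - ln (1 - \<epsilon>)) + (K / \<epsilon> + 1) * E (T x) \<partial>m)"
    proof (rule integral_mono_AE)
      show "integrable m (\<lambda>x. - ln (v (X x) (T x)))" by (rule rate(1))
      show "integrable m (\<lambda>x. (- ln (\<phi> (X x) (T x)) - ln (1 - \<epsilon>)) + (K / \<epsilon> + 1) * E (T x))"
        using int integrable_T[OF E_int] by simp
      show "AE x in m. - ln (v (X x) (T x)) \<le> (- ln (\<phi> (X x) (T x)) - ln (1 - \<epsilon>)) + (K / \<epsilon> + 1) * E (T x)"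
        using pos AE_T[OF \<theta>_good]
      proof eventually_elim
        case (elim x)
        define a y where "a = X x" and "y = T x"
        have a: "a \<in> I" by (simp add: a_def X_in)
        have dist_u: "\<bar>\<theta> b y - u b y\<bar> \<le> \<bar>\<theta> b y - u0 b y\<bar>" if "b \<in> I" for b
          using elim that by (auto simp: u_def y_def[symmetric])
        have abs_a: "\<bar>\<theta> a y - u a y\<bar> \<le> E y"
          unfolding E_def using dist_u[OF a] member_le_sum[of a I "\<lambda>a. \<bar>\<theta> a y - u0 a y\<bar>"] a finite_I by force
        have E0: "0 \<le> E y" unfolding E_def by (intro sum_nonneg) auto
        have "ln (s y) \<le> s y - 1" using s_pos by (rule ln_le_minus_one)
        also have "\<dots> = (\<Sum>b\<in>I. u b y - \<theta> b y)" using elim by (simp add: s_def sum_subtractf y_def)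
        also have "\<dots> \<le> E y" unfolding E_def using dist_u by (intro sum_mono) force
        finally have ln_s: "ln (s y) \<le> E y" .
        have \<theta>pos: "0 < \<theta> a y" and \<theta>ge: "(1 - \<epsilon>) * \<phi> a y \<le> \<theta> a y" and \<phi>pos: "0 < \<phi> a y"
          using elim a \<open>0 < \<epsilon> / K\<close> unfolding a_def y_def by force+
        have "ln (\<theta> a y) - ln (u a y) = ln (\<theta> a y / u a y)"
          using \<theta>pos u_pos[of a y] by (simp add: ln_div)
        also have "\<dots> \<le> \<theta> a y / u a y - 1"
          using \<theta>pos u_pos by (intro ln_le_minus_one) simp
        also have "\<dots> = (\<theta> a y - u a y) / u a y" using u_pos[of a y] by (simp add: diff_divide_distrib)
        also have "\<dots> \<le> E y / u a y" using abs_a u_pos[of a y] by (intro divide_right_mono) auto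
        also have "\<dots> \<le> E y / (\<epsilon> / K)"
          using E0 u_ge[of a y] u_pos[of a y] \<open>0 < \<epsilon> / K\<close> by (intro divide_left_mono mult_pos_pos)
        finally have ln_u: "- ln (u a y) \<le> - ln (\<theta> a y) + K / \<epsilon> * E y" by (simp add: mult.commute)
        have "ln ((1 - \<epsilon>) * \<phi> a y) \<le> ln (\<theta> a y)" using \<theta>ge \<phi>pos \<theta>pos \<epsilon> by (subst ln_le_cancel_iff) auto
        then have "ln (1 - \<epsilon>) + ln (\<phi> a y) \<le> ln (\<theta> a y)" using \<phi>pos \<epsilon> by (simp add: ln_mult)
        with ln_u ln_s show ?case
          unfolding a_def[symmetric] y_def[symmetric] v_def
          using u_pos[of a y] s_pos[of y] by (simp add: ln_div algebra_simps)
      qed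
    qed
    also have "\<dots> = - ?c - ln (1 - \<epsilon>) + (K / \<epsilon> + 1) * (\<integral>y. E y \<partial>m)"
      using int integrable_T[OF E_int] integral_T[OF Em] by (simp add: prob_space)
    also have "\<dots> \<le> - ?c - ln (1 - \<epsilon>) + (K / \<epsilon> + 1) * (K * \<eta>)"
      using E_le K1 \<epsilon> by (intro add_left_mono mult_left_mono) auto
    finally show ?thesis .
  qed
  show ?thesis
  proof (rule field_le_epsilon)
    fix \<xi> :: real assume \<xi>: "0 < \<xi>"
    \<comment> \<open>This value makes \<open>- ln (1 - \<epsilon>)\<close> equal to
      \<open>\<xi> / 2\<close>; \<open>\<eta>\<close> below uses up the other half.\<close>
    define \<epsilon> where "\<epsilon> = 1 - exp (- \<xi> / 2)"
    have \<epsilon>: "0 < \<epsilon>" "\<epsilon> < 1" "- ln (1 - \<epsilon>) = \<xi> / 2" using \<xi> by (auto simp: \<epsilon>_def)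
    define D where "D = (K / \<epsilon> + 1) * K"
    define \<eta> where "\<eta> = \<xi> / 2 / D"
    have D: "0 < D" using K1 \<epsilon> by (simp add: D_def add_pos_pos)
    have "0 < \<eta>" unfolding \<eta>_def using \<xi> D by simp
    moreover have "(K / \<epsilon> + 1) * (K * \<eta>) = D * \<eta>" by (simp only: D_def mult.assoc)
    then have "(K / \<epsilon> + 1) * (K * \<eta>) = \<xi> / 2" using D by (simp add: \<eta>_def)
    ultimately show "?l \<le> - ?c + \<xi>" using main[OF \<epsilon>(1,2), of \<eta>] \<epsilon>(3) by simp
  qed
qed

end

section \<open>The expanding map and conformal measures\<close>

locale ifs_geom =
  fixes t :: nat and \<psi> :: "nat \<Rightarrow> 'a::euclidean_space \<Rightarrow> 'a" and G :: "'a set" and Ob :: "nat \<Rightarrow> 'a set"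
    and F :: "'a \<Rightarrow> 'a"
  assumes t2: "t \<ge> 2"
    and \<psi>_cont: "\<And>i. i \<in> {1..t} \<Longrightarrow> continuous_on UNIV (\<psi> i)"
    and \<psi>_inj: "\<And>i. i \<in> {1..t} \<Longrightarrow> inj (\<psi> i)"
    and G_compact: "compact G" and G_ne: "G \<noteq> {}"
    and G_attr: "G = (\<Union>i\<in>{1..t}. \<psi> i ` G)"
    and F2: "F2 t \<psi> G" and F3: "F3 t \<psi> G" and F4: "F4 t \<psi> G Ob"
    and F_G: "\<And>x. x \<in> G \<Longrightarrow> F x \<in> G"
    and F_inv: "\<And>i x. i \<in> {1..t} \<Longrightarrow> x \<in> G \<inter> Ob i \<Longrightarrow> \<psi> i (F x) = x"
begin

abbreviation "Crit \<equiv> Fset t \<psi> G"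

lemma Crit_iff: "x \<in> Crit \<longleftrightarrow> (\<exists>i\<in>{1..t}. \<exists>j\<in>{1..t}. i \<noteq> j \<and> x \<in> \<psi> i ` G \<and> x \<in> \<psi> j ` G)"
  by (simp add: Fset_def Bex_def) blast

lemma finite_Crit: "finite Crit"
  using F2 unfolding Fset_def F2_def
  by (intro finite_UN_I finite_atLeastAtMost) (simp split: if_split)

lemma \<psi>_G: "i \<in> {1..t} \<Longrightarrow> x \<in> G \<Longrightarrow> \<psi> i x \<in> G"
  using G_attr by blast

lemma Crit_sub: "Crit \<subseteq> G"
  using \<psi>_G by (auto simp: Crit_iff)

lemma G_borel [measurable, simp]: "G \<in> sets borel"
  using G_compact by (simp add: compact_imp_closed borel_closed)

lemma Crit_borel [measurable, simp]: "Crit \<in> sets borel"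
  using finite_Crit by (simp add: finite_imp_closed borel_closed)

lemma branch_unique:
  assumes "i \<in> {1..t}" "j \<in> {1..t}" "x \<in> \<psi> i ` G" "x \<in> \<psi> j ` G" "x \<notin> Crit"
  shows "i = j"
proof (rule ccontr)
  assume "i \<noteq> j"
  then have "x \<in> Crit" unfolding Crit_iff using assms(1-4) by blast
  with assms show False by simp
qed

lemma G_Ob: "i \<in> {1..t} \<Longrightarrow> G \<inter> Ob i = \<psi> i ` G - Crit"
  using F4 by (simp add: F4_def)

lemma iota_eq:
  assumes "i \<in> {1..t}" "x \<in> \<psi> i ` G" "x \<notin> Crit"
  shows "iota t \<psi> G x = i"
  unfolding iota_def
proof (rule the_equality)
  show "i \<in> {1..t} \<and> x \<in> \<psi> i ` G - Crit" using assms by simp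
  show "j = i" if "j \<in> {1..t} \<and> x \<in> \<psi> j ` G - Crit" for j
    using branch_unique[OF _ assms(1) _ assms(2,3)] that by simp
qed

lemma iota_branch:
  assumes "x \<in> G" "x \<notin> Crit"
  shows "iota t \<psi> G x \<in> {1..t}" "x \<in> \<psi> (iota t \<psi> G x) ` G" "\<psi> (iota t \<psi> G x) (F x) = x"
proof -
  obtain i where i: "i \<in> {1..t}" "x \<in> \<psi> i ` G" using assms(1) G_attr by blast
  have "iota t \<psi> G x = i" by (rule iota_eq[OF i assms(2)])
  moreover have "\<psi> i (F x) = x" using F_inv[OF i(1), of x] G_Ob[OF i(1)] i assms by blast
  ultimately show "iota t \<psi> G x \<in> {1..t}" "x \<in> \<psi> (iota t \<psi> G x) ` G" "\<psi> (iota t \<psi> G x) (F x) = x"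
    using i by auto
qed

lemma F_\<psi>:
  assumes "i \<in> {1..t}" "x \<in> G" "\<psi> i x \<notin> Crit"
  shows "F (\<psi> i x) = x" "iota t \<psi> G (\<psi> i x) = i"
proof -
  show i: "iota t \<psi> G (\<psi> i x) = i" by (rule iota_eq) (use assms in auto)
  have "\<psi> i (F (\<psi> i x)) = \<psi> i x"
    using iota_branch(3)[OF \<psi>_G[OF assms(1,2)] assms(3)] i by simp
  then show "F (\<psi> i x) = x" using \<psi>_inj[OF assms(1)] by (simp add: inj_eq)
qed

section \<open>Orbits and the critical set\<close>

lemma compw_orbit:
  assumes "x \<in> G" "\<And>l. l < k \<Longrightarrow> (F ^^ l) x \<notin> Crit"
  shows "\<exists>ws. set ws \<subseteq> {1..t} \<and> compw \<psi> ws ((F ^^ k) x) = x"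
  using assms
proof (induction k arbitrary: x)
  case 0
  then show ?case by (intro exI[of _ "[]"]) (simp add: compw_def)
next
  case (Suc k)
  have x: "x \<notin> Crit" using Suc.prems(2)[of 0] by simp
  have "\<And>l. l < k \<Longrightarrow> (F ^^ l) (F x) \<notin> Crit"
    using Suc.prems(2)[of "Suc l" for l] by (simp add: funpow_swap1)
  from Suc.IH[OF F_G[OF Suc.prems(1)] this] obtain ws
    where ws: "set ws \<subseteq> {1..t}" "compw \<psi> ws ((F ^^ k) (F x)) = F x" by blast
  show ?case
    using ws iota_branch(1,3)[OF Suc.prems(1) x]
    by (intro exI[of _ "iota t \<psi> G x # ws"]) (simp add: compw_def funpow_swap1)
qed

text \<open>If the iterates before \<open>k\<close> avoid the critical set, a word of branches leads
  from \<open>(F ^^ k) x\<close> back to \<open>x\<close>, and prefixing \<open>i\<close> leads on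
  into the critical set. (F3) for this nonempty word keeps \<open>(F ^^ k) x\<close> out of it;
  strong induction supplies the premise on the earlier iterates.\<close>

lemma orbit_after_Crit:
  assumes "i \<in> {1..t}" "x \<in> G" "\<psi> i x \<in> Crit"
  shows "(F ^^ k) x \<notin> Crit"
proof (induction k rule: less_induct)
  case (less k)
  obtain ws where ws: "set ws \<subseteq> {1..t}" "compw \<psi> ws ((F ^^ k) x) = x"
    using compw_orbit[OF assms(2) less] by blast
  have "compw \<psi> (i # ws) ((F ^^ k) x) \<in> Crit"
    using ws assms(3) by (simp add: compw_def)
  moreover have "compw \<psi> (i # ws) -` Crit \<inter> Crit = {}"
    using F3 ws assms(1) unfolding F3_def by (metis insert_subset list.distinct(1) list.simps(15))
  ultimately show ?case by blast
qed

text \<open>\<open>F\<close> is constrained only on \<open>G\<close>, and \<open>iota\<close> is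
  meaningful only off the critical set. The total versions take values in \<open>G\<close> and in
  \<open>{1..t}\<close> everywhere, as the coding locales require of labels; the default values lie
  on sets that are null for the measures considered.\<close>

definition Tm :: "'a \<Rightarrow> 'a" where
  "Tm x = (if x \<in> G then F x else (SOME z. z \<in> G))"

definition idx :: "'a \<Rightarrow> nat" where
  "idx x = (if x \<in> G - Crit then iota t \<psi> G x else 1)"

lemma Tm_G: "Tm x \<in> G"
  using F_G G_ne by (auto simp: Tm_def some_in_eq)

lemma idx_in: "idx x \<in> {1..t}"
  using iota_branch(1) t2 by (auto simp: idx_def)

lemma idx_\<psi>: "i \<in> {1..t} \<Longrightarrow> x \<in> G \<Longrightarrow> \<psi> i x \<notin> Crit \<Longrightarrow> idx (\<psi> i x) = i"
  using F_\<psi> \<psi>_G by (simp add: idx_def)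

lemma Tm_\<psi>: "i \<in> {1..t} \<Longrightarrow> x \<in> G \<Longrightarrow> \<psi> i x \<notin> Crit \<Longrightarrow> Tm (\<psi> i x) = x"
  using F_\<psi> \<psi>_G by (simp add: Tm_def)

lemma \<psi>_idx_Tm: "x \<in> G \<Longrightarrow> x \<notin> Crit \<Longrightarrow> \<psi> (idx x) (Tm x) = x"
  using iota_branch(3) by (simp add: idx_def Tm_def)

lemma \<psi>_meas: "i \<in> {1..t} \<Longrightarrow> \<psi> i \<in> borel_measurable borel"
  using \<psi>_cont by (intro borel_measurable_continuous_onI)

lemma branch_borel: "i \<in> {1..t} \<Longrightarrow> \<psi> i ` G - Crit \<in> sets borel"
  using compact_continuous_image[OF continuous_on_subset[OF \<psi>_cont] G_compact]
  by (intro sets.Diff[OF borel_closed Crit_borel] compact_imp_closed) auto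

lemma idx_eq: "i \<in> {1..t} \<Longrightarrow> {x. idx x = i} = (\<psi> i ` G - Crit) \<union> (if i = 1 then - (G - Crit) else {})"
proof -
  assume i: "i \<in> {1..t}"
  have "idx x = i \<longleftrightarrow> x \<in> \<psi> i ` G" if "x \<in> G" "x \<notin> Crit" for x
    using iota_branch(2)[OF that] iota_eq[OF i _ that(2)] that by (auto simp: idx_def)
  moreover have "\<psi> i ` G \<subseteq> G" using \<psi>_G[OF i] by blast
  moreover have "idx x = 1" if "x \<notin> G - Crit" for x using that by (auto simp: idx_def)
  ultimately show ?thesis by (cases "i = 1") (auto, metis+)
qed

lemma idx_meas: "i \<in> {1..t} \<Longrightarrow> {x. idx x = i} \<in> sets borel"
  using idx_eq branch_borel by auto

text \<open>Measurability is forced by the geometry: off the critical set \<open>F\<close> is pieced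
  together from branch inverses, continuous by compactness of \<open>G\<close>, and the finite
  critical set adds finitely many values.\<close>

lemma Tm_meas [measurable]: "Tm \<in> borel_measurable borel"
proof -
  define gi where "gi i = inv_into G (\<psi> i)" for i
  have gi: "continuous_on (\<psi> i ` G) (gi i)" if "i \<in> {1..t}" for i
    unfolding gi_def using continuous_on_subset[OF \<psi>_cont[OF that]] inv_into_f_f[OF inj_on_subset[OF \<psi>_inj[OF that]]]
    by (intro continuous_on_inv G_compact) auto
  define T' where "T' x = (\<Sum>i=1..t. indicator (\<psi> i ` G - Crit) x *\<^sub>R gi i x) +
    (\<Sum>y\<in>Crit. indicator {y} x *\<^sub>R F y) + indicator (- G) x *\<^sub>R (SOME z. z \<in> G)" for x
  have "Tm = T'"
  proof
    fix x
    consider "x \<notin> G" | "x \<in> Crit" | "x \<in> G" "x \<notin> Crit" by blast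
    then show "Tm x = T' x"
    proof cases
      case 1
      then have "x \<notin> Crit" "\<And>i. i \<in> {1..t} \<Longrightarrow> x \<notin> \<psi> i ` G" using Crit_sub \<psi>_G by auto
      moreover have "(\<Sum>y\<in>Crit. indicator {y} x *\<^sub>R F y) = 0"
        using \<open>x \<notin> Crit\<close> by (intro sum.neutral) (auto simp: indicator_def)
      ultimately show ?thesis using 1 by (simp add: Tm_def T'_def)
    next
      case 2
      then have "x \<in> G" using Crit_sub by blast
      have "(\<Sum>y\<in>Crit. indicator {y} x *\<^sub>R F y) = (\<Sum>y\<in>Crit. if y = x then F y else 0)"
        by (rule sum.cong) (auto simp: indicator_def)
      with 2 \<open>x \<in> G\<close> finite_Crit show ?thesis by (simp add: Tm_def T'_def)
    next
      case 3
      define j where "j = iota t \<psi> G x"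
      have j: "j \<in> {1..t}" "x \<in> \<psi> j ` G" "\<psi> j (F x) = x" using iota_branch[OF 3] by (auto simp: j_def)
      have "gi j x = F x"
        unfolding gi_def using j F_G[OF 3(1)] \<psi>_inj[OF j(1)]
        by (metis inj_on_subset inv_into_f_f subset_UNIV)
      moreover have "(\<Sum>i=1..t. indicator (\<psi> i ` G - Crit) x *\<^sub>R gi i x) = (\<Sum>i=1..t. if i = j then gi i x else 0)"
      proof (intro sum.cong refl)
        fix i assume i: "i \<in> {1..t}"
        show "indicator (\<psi> i ` G - Crit) x *\<^sub>R gi i x = (if i = j then gi i x else 0)"
        proof (cases "i = j")
          case True
          then show ?thesis using 3 j by simp
        next
          case False
          then have "x \<notin> \<psi> i ` G" using branch_unique[OF j(1) i j(2) _ 3(2)] by blast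
          then show ?thesis using False by simp
        qed
      qed
      moreover have "(\<Sum>y\<in>Crit. indicator {y} x *\<^sub>R F y) = 0"
        using 3 by (intro sum.neutral) (auto simp: indicator_def)
      ultimately show ?thesis using j(1) 3 by (simp add: Tm_def T'_def)
    qed
  qed
  moreover have "T' \<in> borel_measurable borel"
  proof -
    have 1: "(\<lambda>x. indicator (\<psi> i ` G - Crit) x *\<^sub>R gi i x) \<in> borel_measurable borel" if "i \<in> {1..t}" for i
      using branch_borel[OF that] continuous_on_subset[OF gi[OF that], of "\<psi> i ` G - Crit"]
      by (intro borel_measurable_continuous_on_indicator) auto
    show ?thesis unfolding T'_def
      by (intro borel_measurable_add borel_measurable_sum 1)
        (auto intro!: borel_measurable_scaleR borel_measurable_indicator)
  qed
  ultimately show ?thesis by simp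
qed

end

text \<open>\<open>g i x\<close> plays the role of the conditional probability that branch
  \<open>i\<close> is the one used, given the image point \<open>x\<close>; \<open>transfer\<close>
  says on continuous test functions that \<kappa> is the sum of the images of
  \<open>g i \<kappa>\<close>. Invariance and absence of atoms are to be derived. The clause with
  \<open>j \<noteq> i\<close> in \<open>g_good\<close> makes each weight strictly smaller than
  1.\<close>

locale conformal = ifs_geom t \<psi> G Ob F + prob_space \<kappa>
  for t :: nat and \<psi> :: "nat \<Rightarrow> 'a::euclidean_space \<Rightarrow> 'a" and G Ob F and \<kappa> :: "'a measure" +
  fixes g :: "nat \<Rightarrow> 'a \<Rightarrow> real"
  assumes sets_\<kappa> [measurable_cong, simp]: "sets \<kappa> = sets borel"
    and AE_G: "AE x in \<kappa>. x \<in> G"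
    and g_meas [measurable]: "\<And>i. i \<in> {1..t} \<Longrightarrow> g i \<in> borel_measurable borel"
    and g_good: "AE x in \<kappa>. (\<forall>i\<in>{1..t}. 0 \<le> g i x) \<and> (\<Sum>i=1..t. g i x) = 1 \<and>
        (\<forall>i. \<exists>j\<in>{1..t}. j \<noteq> i \<and> 0 < g j x)"
    and transfer: "\<And>\<phi>. continuous_on UNIV \<phi> \<Longrightarrow> (\<forall>x. 0 \<le> \<phi> x \<and> \<phi> x \<le> 1) \<Longrightarrow>
        (\<Sum>i=1..t. \<integral>x. g i x * \<phi> (\<psi> i x) \<partial>\<kappa>) = (\<integral>x. \<phi> x \<partial>\<kappa>)"
begin

lemma space_\<kappa> [simp]: "space \<kappa> = UNIV"
  using sets_eq_imp_space_eq[OF sets_\<kappa>] by simp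

lemma g_le1: "AE x in \<kappa>. \<forall>i\<in>{1..t}. 0 \<le> g i x \<and> g i x < 1"
  using g_good
proof eventually_elim
  case (elim x)
  have "g i x < 1" if "i \<in> {1..t}" for i
  proof -
    obtain j where j: "j \<in> {1..t}" "j \<noteq> i" "0 < g j x" using elim by blast
    have "g i x < g i x + g j x" using j by simp
    also have "\<dots> = (\<Sum>k\<in>{i, j}. g k x)" using j by simp
    also have "\<dots> \<le> (\<Sum>k=1..t. g k x)" using that j elim by (intro sum_mono2) auto
    finally show ?thesis using elim by simp
  qed
  with elim show ?case by auto
qed

lemma g_integrable: "i \<in> {1..t} \<Longrightarrow> integrable \<kappa> (g i)"
proof (rule integrable_const_bound[of _ 1])
  assume i: "i \<in> {1..t}"
  show "AE x in \<kappa>. norm (g i x) \<le> 1" using g_le1 by eventually_elim (use i in force)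
  show "g i \<in> borel_measurable \<kappa>" using g_meas[OF i] by measurable
qed

definition \<nu> :: "nat \<Rightarrow> 'a measure" where
  "\<nu> i = distr (density \<kappa> (\<lambda>x. ennreal (g i x))) borel (\<psi> i)"

lemma \<nu>_sets [simp]: "sets (\<nu> i) = sets borel" "space (\<nu> i) = UNIV"
  by (simp_all add: \<nu>_def)

lemma \<nu>_integral:
  assumes i: "i \<in> {1..t}" and [measurable]: "f \<in> borel_measurable borel"
  shows "(\<integral>x. f x \<partial>\<nu> i) = (\<integral>x. g i x * f (\<psi> i x) \<partial>\<kappa>)" (is ?A)
    and "integrable (\<nu> i) f \<longleftrightarrow> integrable \<kappa> (\<lambda>x. g i x * f (\<psi> i x))" (is ?B)
proof -
  note [measurable] = \<psi>_meas[OF i] g_meas[OF i]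
  have nn: "AE x in \<kappa>. 0 \<le> g i x" using g_good i by auto
  show ?A unfolding \<nu>_def
    by (subst integral_distr, measurable, subst integral_real_density) (use nn in auto)
  show ?B unfolding \<nu>_def
    by (subst integrable_distr_eq, measurable, subst integrable_real_density) (use nn in auto)
qed

lemma \<nu>_finite: "i \<in> {1..t} \<Longrightarrow> finite_measure (\<nu> i)"
proof -
  assume i: "i \<in> {1..t}"
  have "integrable (\<nu> i) (\<lambda>x. 1::real)"
    using g_integrable[OF i] by (subst \<nu>_integral(2)[OF i]) auto
  then show ?thesis
    unfolding integrable_iff_bounded by (intro finite_measureI) (auto simp: less_top)
qed

lemma \<nu>_measure:
  assumes i: "i \<in> {1..t}" and B: "B \<in> sets borel"
  shows "measure (\<nu> i) B = (\<integral>x. g i x * indicator B (\<psi> i x) \<partial>\<kappa>)"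
  using \<nu>_integral(1)[OF i, of "indicator B"] B by simp

text \<open>Continuous test functions determine the values on closed sets, through cut-offs
  converging to the indicator. Closed sets are stable under intersection and generate the Borel
  sets, so the identity extends by Dynkin's argument.\<close>

lemma \<kappa>_eq_sum_\<nu>:
  assumes "B \<in> sets borel"
  shows "measure \<kappa> B = (\<Sum>i=1..t. measure (\<nu> i) B)"
proof -
  have closed_case: "measure \<kappa> S = (\<Sum>i=1..t. measure (\<nu> i) S)" if S: "closed S" for S
  proof (cases "S = {}")
    \<comment> \<open>The empty set is separated because \<open>infdist\<close> to it is 0 by
      convention, so the cut-offs would not converge to its indicator.\<close>
    case False
    define \<phi> where "\<phi> n x = max 0 (1 - real n * infdist x S)" for n x
    have \<phi>01: "0 \<le> \<phi> n x \<and> \<phi> n x \<le> 1" for n x by (simp add: \<phi>_def infdist_nonneg)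
    have \<phi>_cont: "continuous_on UNIV (\<phi> n)" for n unfolding \<phi>_def by (intro continuous_intros)
    have [measurable]: "\<phi> n \<in> borel_measurable borel" for n
      by (rule borel_measurable_continuous_onI[OF \<phi>_cont])
    have lim: "(\<lambda>n. \<phi> n x) \<longlonglongrightarrow> indicator S x" for x
    proof (cases "x \<in> S")
      case True
      then show ?thesis by (simp add: \<phi>_def)
    next
      case False': False
      then have d: "0 < infdist x S" using S False infdist_pos_not_in_closed by blast
      obtain N :: nat where N: "1 / infdist x S < real N" using reals_Archimedean2 by blast
      have "\<phi> n x = 0" if "n \<ge> N" for n
      proof -
        have "1 < real N * infdist x S" using N d by (simp add: divide_less_eq)
        also have "\<dots> \<le> real n * infdist x S" using that d by (intro mult_right_mono) auto
        finally show ?thesis by (simp add: \<phi>_def)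
      qed
      then have "\<forall>\<^sub>F n in sequentially. \<phi> n x = indicator S x"
        using False' by (auto simp: eventually_sequentially)
      then show ?thesis by (rule tendsto_eventually)
    qed
    have [measurable]: "S \<in> sets borel" using S by simp
    have "(\<lambda>n. \<integral>x. \<phi> n x \<partial>\<kappa>) \<longlonglongrightarrow> (\<integral>x. indicator S x \<partial>\<kappa>)"
      by (rule integral_dominated_convergence[where w = "\<lambda>_. 1"]) (use lim \<phi>01 in auto)
    then have 1: "(\<lambda>n. \<integral>x. \<phi> n x \<partial>\<kappa>) \<longlonglongrightarrow> measure \<kappa> S" by simp
    have 2: "(\<lambda>n. \<integral>x. \<phi> n x \<partial>\<nu> i) \<longlonglongrightarrow> measure (\<nu> i) S" if i: "i \<in> {1..t}" for i
    proof -
      interpret fm: finite_measure "\<nu> i" by (rule \<nu>_finite[OF i])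
      have "(\<lambda>n. \<integral>x. \<phi> n x \<partial>\<nu> i) \<longlonglongrightarrow> (\<integral>x. indicator S x \<partial>\<nu> i)"
        by (rule integral_dominated_convergence[where w = "\<lambda>_. 1"])
          (use lim \<phi>01 in \<open>auto simp: measurable_cong_sets[OF \<nu>_sets(1) refl]\<close>)
      then show ?thesis by simp
    qed
    have "(\<lambda>n. \<Sum>i=1..t. \<integral>x. \<phi> n x \<partial>\<nu> i) \<longlonglongrightarrow> (\<Sum>i=1..t. measure (\<nu> i) S)"
      by (intro tendsto_sum 2)
    moreover have "(\<Sum>i=1..t. \<integral>x. \<phi> n x \<partial>\<nu> i) = (\<integral>x. \<phi> n x \<partial>\<kappa>)" for n
    proof -
      have "(\<Sum>i=1..t. \<integral>x. \<phi> n x \<partial>\<nu> i) = (\<Sum>i=1..t. \<integral>x. g i x * \<phi> n (\<psi> i x) \<partial>\<kappa>)"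
        by (intro sum.cong refl \<nu>_integral(1)) auto
      then show ?thesis using transfer[OF \<phi>_cont] \<phi>01 by simp
    qed
    ultimately show ?thesis using 1 by (intro LIMSEQ_unique) auto
  qed simp
  have total: "measure \<kappa> UNIV = (\<Sum>i=1..t. measure (\<nu> i) UNIV)" by (rule closed_case) simp
  have gen: "sets borel = sigma_sets UNIV (Collect closed :: 'a set set)"
    unfolding borel_eq_closed by simp
  have "Int_stable (Collect closed :: 'a set set)" by (auto intro!: Int_stableI)
  moreover have "Collect closed \<subseteq> Pow (UNIV :: 'a set)" by simp
  moreover have "B \<in> sigma_sets UNIV (Collect closed)" using assms gen by simp
  ultimately show ?thesis
  proof (induction rule: sigma_sets_induct_disjoint)
    case (basic A)
    then show ?case using closed_case by simp
  next
    case empty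
    then show ?case by simp
  next
    case (compl A)
    have A: "A \<in> sets borel" using compl gen by simp
    have "measure \<kappa> (UNIV - A) = measure \<kappa> UNIV - measure \<kappa> A"
      using A by (intro finite_measure_Diff) auto
    moreover have "measure (\<nu> i) (UNIV - A) = measure (\<nu> i) UNIV - measure (\<nu> i) A" if "i \<in> {1..t}" for i
      using A by (intro finite_measure.finite_measure_Diff[OF \<nu>_finite[OF that]]) auto
    ultimately show ?case using compl total by (simp add: sum_subtractf)
  next
    case (union A)
    have A: "range A \<subseteq> sets borel" using union gen by auto
    have "(\<lambda>n. measure \<kappa> (A n)) sums measure \<kappa> (\<Union>n. A n)"
      using A union by (intro finite_measure_UNION) auto
    moreover have "(\<lambda>n. \<Sum>i=1..t. measure (\<nu> i) (A n)) sums (\<Sum>i=1..t. measure (\<nu> i) (\<Union>n. A n))"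
      using A union by (intro sums_sum finite_measure.finite_measure_UNION \<nu>_finite) auto
    ultimately show ?case using union by (simp add: sums_unique2)
  qed
qed

section \<open>Absence of atoms\<close>

lemma \<kappa>_atom: "measure \<kappa> {x} = (\<Sum>i=1..t. measure (\<nu> i) {x})"
  by (rule \<kappa>_eq_sum_\<nu>) simp

lemma \<nu>_null:
  assumes i: "i \<in> {1..t}" and "B \<in> sets borel" and "\<And>x. x \<in> G \<Longrightarrow> \<psi> i x \<notin> B"
  shows "measure (\<nu> i) B = 0"
proof -
  have "AE x in \<kappa>. g i x * indicator B (\<psi> i x) = 0" using AE_G by eventually_elim (simp add: assms(3))
  then show ?thesis unfolding \<nu>_measure[OF assms(1,2)] by (rule integral_eq_zero_AE)
qed

lemma \<nu>_atom:
  assumes i: "i \<in> {1..t}"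
  shows "measure (\<nu> i) {\<psi> i x} = g i x * measure \<kappa> {x}"
proof -
  have "measure (\<nu> i) {\<psi> i x} = (\<integral>y. g i y * indicator {\<psi> i x} (\<psi> i y) \<partial>\<kappa>)"
    by (rule \<nu>_measure[OF i]) simp
  also have "\<dots> = (\<integral>y. g i x * indicator {x} y \<partial>\<kappa>)"
    using \<psi>_inj[OF i] by (intro Bochner_Integration.integral_cong) (auto simp: indicator_def inj_eq)
  also have "\<dots> = g i x * measure \<kappa> {x}" by simp
  finally show ?thesis .
qed

lemma AE_atom:
  assumes "AE x in \<kappa>. P x" "0 < measure \<kappa> {x}"
  shows "P x"
proof (rule ccontr)
  assume "\<not> P x"
  obtain N where N: "{x \<in> space \<kappa>. \<not> P x} \<subseteq> N" "emeasure \<kappa> N = 0" "N \<in> sets \<kappa>"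
    using AE_E[OF assms(1)] by metis
  have "emeasure \<kappa> {x} \<le> emeasure \<kappa> N" using N \<open>\<not> P x\<close> by (intro emeasure_mono) auto
  with N assms(2) show False by (simp add: emeasure_eq_measure)
qed

text \<open>Off the critical set a single branch reaches \<open>x\<close>, so its mass is the mass
  of \<open>F x\<close> times a weight that is strictly below 1 when \<open>F x\<close> is
  charged.\<close>

lemma mass_step:
  assumes "x \<in> G" "x \<notin> Crit"
  shows "measure \<kappa> {x} = 0 \<or> measure \<kappa> {x} < measure \<kappa> {F x}"
proof -
  define i where "i = iota t \<psi> G x"
  have i: "i \<in> {1..t}" "x \<in> \<psi> i ` G" "\<psi> i (F x) = x" using iota_branch[OF assms] by (auto simp: i_def)
  have "measure \<kappa> {x} = (\<Sum>j=1..t. if j = i then measure (\<nu> j) {x} else 0)"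
    unfolding \<kappa>_atom
  proof (intro sum.cong refl)
    fix j assume j: "j \<in> {1..t}"
    have "measure (\<nu> j) {x} = 0" if "j \<noteq> i"
      using branch_unique[OF i(1) j i(2) _ assms(2)] that by (intro \<nu>_null[OF j]) auto
    then show "measure (\<nu> j) {x} = (if j = i then measure (\<nu> j) {x} else 0)" by simp
  qed
  also have "\<dots> = measure (\<nu> i) {\<psi> i (F x)}" using i by simp
  also have "\<dots> = g i (F x) * measure \<kappa> {F x}" by (rule \<nu>_atom[OF i(1)])
  finally have eq: "measure \<kappa> {x} = g i (F x) * measure \<kappa> {F x}" .
  show ?thesis
  proof (cases "measure \<kappa> {F x} = 0")
    case True
    then show ?thesis using eq by simp
  next
    case False
    then have pos: "0 < measure \<kappa> {F x}" using measure_nonneg[of \<kappa> "{F x}"] by linarith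
    have "g i (F x) < 1" using AE_atom[OF g_le1 pos] i(1) by blast
    then have "g i (F x) * measure \<kappa> {F x} < 1 * measure \<kappa> {F x}"
      using pos by (rule mult_strict_right_mono)
    then show ?thesis using eq by simp
  qed
qed

text \<open>A positive mass would increase strictly along the whole orbit. The orbit points would
  then be pairwise distinct and each would carry at least the initial mass, against total mass
  1.\<close>

lemma mass_orbit_avoiding:
  assumes "x \<in> G" "\<And>k. (F ^^ k) x \<notin> Crit"
  shows "measure \<kappa> {x} = 0"
proof (rule ccontr)
  let ?a = "\<lambda>k. measure \<kappa> {(F ^^ k) x}"
  assume "measure \<kappa> {x} \<noteq> 0"
  then have pos: "0 < ?a 0" by (simp add: zero_less_measure_iff)
  have orb: "(F ^^ k) x \<in> G" for k by (induction k) (auto simp: assms(1) F_G)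
  have step: "0 < ?a k \<Longrightarrow> ?a k < ?a (Suc k)" for k
    using mass_step[OF orb assms(2), of k] by auto
  have apos: "0 < ?a k" for k
  proof (induction k)
    case (Suc k)
    then show ?case using step[of k] by simp
  qed (use pos in simp)
  have sm: "strict_mono ?a" using step[OF apos] by (simp add: strict_mono_Suc_iff)
  have inj: "inj (\<lambda>k. (F ^^ k) x)"
  proof (rule injI)
    fix j k assume "(F ^^ j) x = (F ^^ k) x"
    then have "?a j = ?a k" by simp
    then show "j = k" using strict_mono_eq[OF sm] by blast
  qed
  obtain n :: nat where n: "1 / ?a 0 < real n" using reals_Archimedean2 by blast
  have "real n * ?a 0 = (\<Sum>k<n. ?a 0)" by simp
  also have "\<dots> \<le> (\<Sum>k<n. ?a k)" using monoD[OF strict_mono_mono[OF sm], of 0] by (intro sum_mono) simp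
  also have "\<dots> = (\<Sum>y\<in>(\<lambda>k. (F ^^ k) x) ` {..<n}. measure \<kappa> {y})"
    using inj by (subst sum.reindex) (auto intro: inj_on_subset)
  also have "\<dots> = measure \<kappa> ((\<lambda>k. (F ^^ k) x) ` {..<n})"
    by (rule finite_measure_eq_sum_singleton[symmetric]) auto
  also have "\<dots> \<le> 1" by (rule prob_le_1)
  finally show False using n pos by (simp add: field_simps)
qed

text \<open>A critical point receives mass only from points whose orbits avoid the critical set, and
  those have none. Any other point of \<open>G\<close> either has such an orbit itself or has mass
  at most that of the first critical point it meets.\<close>

lemma nonatomic: "measure \<kappa> {x} = 0"
proof -
  have Crit0: "measure \<kappa> {y} = 0" if y: "y \<in> Crit" for y
    unfolding \<kappa>_atom
  proof (rule sum.neutral, rule ballI)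
    fix j assume j: "j \<in> {1..t}"
    show "measure (\<nu> j) {y} = 0"
    proof (cases "y \<in> \<psi> j ` G")
      case True
      then obtain z where z: "z \<in> G" "y = \<psi> j z" by blast
      have "measure \<kappa> {z} = 0"
        using orbit_after_Crit[OF j z(1)] z(2) y by (intro mass_orbit_avoiding[OF z(1)]) auto
      then show ?thesis unfolding z(2) \<nu>_atom[OF j] by simp
    next
      case False
      then show ?thesis by (intro \<nu>_null[OF j]) auto
    qed
  qed
  show ?thesis
  proof (cases "x \<in> G")
    case False
    then show ?thesis using AE_atom[OF AE_G, of x] measure_nonneg[of \<kappa> "{x}"] by linarith
  next
    case True
    have orb: "(F ^^ k) x \<in> G" for k by (induction k) (auto simp: True F_G)
    show ?thesis
    proof (cases "\<exists>k. (F ^^ k) x \<in> Crit")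
      case False
      then show ?thesis using mass_orbit_avoiding[OF True] by blast
    next
      case ex: True
      define k where "k = (LEAST k. (F ^^ k) x \<in> Crit)"
      have k: "(F ^^ k) x \<in> Crit" unfolding k_def by (rule LeastI_ex[OF ex])
      have least: "l < k \<Longrightarrow> (F ^^ l) x \<notin> Crit" for l unfolding k_def by (rule not_less_Least)
      have "l \<le> k \<Longrightarrow> measure \<kappa> {x} \<le> measure \<kappa> {(F ^^ l) x}" for l
      proof (induction l)
        case (Suc l)
        have "measure \<kappa> {(F ^^ l) x} = 0 \<or> measure \<kappa> {(F ^^ l) x} < measure \<kappa> {(F ^^ Suc l) x}"
          using mass_step[OF orb least, of l] Suc.prems by simp
        moreover have "measure \<kappa> {x} \<le> measure \<kappa> {(F ^^ l) x}" using Suc by simp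
        ultimately show ?case using measure_nonneg[of \<kappa> "{(F ^^ Suc l) x}"] by linarith
      qed simp
      from this[of k] Crit0[OF k] show ?thesis using measure_nonneg[of \<kappa> "{x}"] by simp
    qed
  qed
qed

section \<open>Invariance and the branch decomposition\<close>

lemma finite_null: "finite A \<Longrightarrow> measure \<kappa> A = 0"
  using finite_measure_eq_sum_singleton[of A] nonatomic by auto

lemma AE_finite_avoid: "finite A \<Longrightarrow> AE x in \<kappa>. x \<notin> A"
  using finite_null[of A] by (intro AE_I[of _ _ A]) (auto simp: emeasure_eq_measure finite_imp_closed)

text \<open>By injectivity a branch sends only finitely many points into the critical set, a null
  set now that atoms are excluded. At the other points of \<open>G\<close> the map undoes the
  branch.\<close>

lemma AE_\<psi>_good:
  assumes i: "i \<in> {1..t}"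
  shows "AE x in \<kappa>. x \<in> G \<and> \<psi> i x \<notin> Crit \<and> Tm (\<psi> i x) = x \<and> idx (\<psi> i x) = i"
proof -
  have "finite (\<psi> i -` Crit)" using finite_Crit \<psi>_inj[OF i] by (rule finite_vimageI)
  from AE_finite_avoid[OF this] AE_G show ?thesis
    by eventually_elim (auto simp: Tm_\<psi>[OF i] idx_\<psi>[OF i])
qed

lemma invariant: "B \<in> sets borel \<Longrightarrow> emeasure \<kappa> (Tm -` B) = emeasure \<kappa> B"
proof -
  assume B [measurable]: "B \<in> sets borel"
  have TB: "Tm -` B \<in> sets borel" using measurable_sets[OF Tm_meas B] by simp
  have "measure \<kappa> (Tm -` B) = (\<Sum>i=1..t. \<integral>x. g i x * indicator (Tm -` B) (\<psi> i x) \<partial>\<kappa>)"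
    using \<kappa>_eq_sum_\<nu>[OF TB] \<nu>_measure[OF _ TB] by simp
  also have "\<dots> = (\<Sum>i=1..t. \<integral>x. g i x * indicator B x \<partial>\<kappa>)"
  proof (intro sum.cong refl integral_cong_AE)
    fix i assume i: "i \<in> {1..t}"
    note [measurable] = \<psi>_meas[OF i] g_meas[OF i] TB
    show "(\<lambda>x. g i x * indicator (Tm -` B) (\<psi> i x)) \<in> borel_measurable \<kappa>" by measurable
    show "(\<lambda>x. g i x * indicator B x) \<in> borel_measurable \<kappa>" by measurable
    show "AE x in \<kappa>. g i x * indicator (Tm -` B) (\<psi> i x) = g i x * indicator B x"
      using AE_\<psi>_good[OF i] by eventually_elim (auto simp: indicator_def)
  qed
  also have "\<dots> = (\<integral>x. (\<Sum>i=1..t. g i x * indicator B x) \<partial>\<kappa>)"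
    using g_integrable by (intro Bochner_Integration.integral_sum[symmetric] integrable_real_mult_indicator) auto
  also have "\<dots> = (\<integral>x. indicator B x \<partial>\<kappa>)"
  proof (intro integral_cong_AE)
    show "(\<lambda>x. \<Sum>i=1..t. g i x * indicator B x) \<in> borel_measurable \<kappa>"
      using g_meas by (intro borel_measurable_sum borel_measurable_times) auto
    show "AE x in \<kappa>. (\<Sum>i=1..t. g i x * indicator B x) = indicator B x"
      using g_good by eventually_elim (simp flip: sum_distrib_right)
  qed auto
  finally show ?thesis by (simp add: emeasure_eq_measure)
qed

lemma inv_measure_\<kappa>: "inv_measure \<kappa> Tm"
  by unfold_locales (simp_all add: invariant)

lemma coded_\<kappa>: "coded_measure \<kappa> Tm idx {1..t}"
proof -
  interpret inv_measure \<kappa> Tm by (rule inv_measure_\<kappa>)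
  show ?thesis by unfold_locales (use idx_in idx_meas in auto)
qed

text \<open>\<open>\<nu> i\<close> is the part of \<kappa> carried by branch \<open>i\<close>,
  because any other \<open>\<nu> j\<close> lives on points with label \<open>j\<close>. This
  justifies reading \<open>g i\<close> as a conditional probability.\<close>

lemma density_idx_eq_\<nu>:
  assumes i: "i \<in> {1..t}"
  shows "density \<kappa> (indicator {x. idx x = i}) = \<nu> i"
proof (rule measure_eqI)
  fix B assume "B \<in> sets (density \<kappa> (indicator {x. idx x = i}))"
  then have B: "B \<in> sets borel" by simp
  note Im = idx_meas[OF i]
  interpret fm: finite_measure "\<nu> i" by (rule \<nu>_finite[OF i])
  have other: "measure (\<nu> j) (B \<inter> {x. idx x = i}) = 0" if j: "j \<in> {1..t}" "j \<noteq> i" for j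
  proof -
    have "AE x in \<kappa>. g j x * indicator (B \<inter> {x. idx x = i}) (\<psi> j x) = 0"
      using AE_\<psi>_good[OF j(1)] by eventually_elim (use j in auto)
    then show ?thesis unfolding \<nu>_measure[OF j(1) sets.Int[OF B Im]] by (rule integral_eq_zero_AE)
  qed
  have "emeasure (density \<kappa> (indicator {x. idx x = i})) B = emeasure \<kappa> (B \<inter> {x. idx x = i})"
    using B Im by (subst emeasure_density) (auto simp: indicator_inter_arith[symmetric] Int_commute)
  also have "measure \<kappa> (B \<inter> {x. idx x = i}) = (\<Sum>j=1..t. if j = i then measure (\<nu> j) (B \<inter> {x. idx x = i}) else 0)"
    unfolding \<kappa>_eq_sum_\<nu>[OF sets.Int[OF B Im]] using other by (intro sum.cong refl) auto
  then have "emeasure \<kappa> (B \<inter> {x. idx x = i}) = ennreal (measure (\<nu> i) (B \<inter> {x. idx x = i}))"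
    using i by (simp add: emeasure_eq_measure)
  also have "measure (\<nu> i) (B \<inter> {x. idx x = i}) = measure (\<nu> i) B"
  proof -
    note [measurable] = \<psi>_meas[OF i] g_meas[OF i] B Im
    show ?thesis
      unfolding \<nu>_measure[OF i B] \<nu>_measure[OF i sets.Int[OF B Im]]
    proof (rule integral_cong_AE)
      show "(\<lambda>x. g i x * indicator (B \<inter> {x. idx x = i}) (\<psi> i x)) \<in> borel_measurable \<kappa>" by measurable
      show "(\<lambda>x. g i x * indicator B (\<psi> i x)) \<in> borel_measurable \<kappa>" by measurable
      show "AE x in \<kappa>. g i x * indicator (B \<inter> {x. idx x = i}) (\<psi> i x) = g i x * indicator B (\<psi> i x)"
        using AE_\<psi>_good[OF i] by eventually_elim (auto simp: indicator_def)
    qed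
  qed
  finally show "emeasure (density \<kappa> (indicator {x. idx x = i})) B = emeasure (\<nu> i) B"
    by (simp add: fm.emeasure_eq_measure)
qed simp

end

section \<open>A lower bound for the entropy of a conformal measure\<close>

lemma abs_mult_ln_le:
  fixes x :: real
  assumes "0 \<le> x" "x \<le> 1"
  shows "\<bar>x * ln x\<bar> \<le> 1"
proof (cases "x = 0")
  case False
  then have x: "0 < x" using assms by simp
  have "ln (1 / x) \<le> 1 / x - 1" using x by (intro ln_le_minus_one) simp
  then have "- ln x \<le> 1 / x - 1" using x by (simp add: ln_div)
  then have "x * - ln x \<le> x * (1 / x - 1)" using x by (intro mult_left_mono) auto
  also have "\<dots> \<le> 1" using x by (simp add: algebra_simps)
  finally have "- (x * ln x) \<le> 1" by simp
  moreover have "x * ln x \<le> 0" using x assms by (intro mult_nonneg_nonpos) auto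
  ultimately show ?thesis by simp
qed simp

text \<open>\<open>x * ln a + x - a\<close> is the tangent line at \<open>a\<close> of the convex
  function \<open>x ln x\<close>.\<close>

lemma mult_ln_tangent:
  fixes x a :: real
  assumes "0 \<le> x" "0 < a"
  shows "x * ln a + x - a \<le> x * ln x"
proof (cases "x = 0")
  case False
  then have x: "0 < x" using assms by simp
  have "ln (a / x) \<le> a / x - 1" using x assms by (intro ln_le_minus_one) simp
  then have "x * (ln a - ln x) \<le> x * (a / x - 1)" using x assms by (intro mult_left_mono) (auto simp: ln_div)
  then show ?thesis using x by (simp add: algebra_simps)
qed (use assms in simp)

context conformal
begin

lemma branch_integral:
  fixes h :: "'a \<Rightarrow> real"
  assumes i: "i \<in> {1..t}" and h [measurable]: "h \<in> borel_measurable borel"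
  shows "(\<integral>x. indicator {x. idx x = i} x * h x \<partial>\<kappa>) = (\<integral>x. g i x * h (\<psi> i x) \<partial>\<kappa>)"
    and "integrable \<kappa> (\<lambda>x. indicator {x. idx x = i} x * h x) \<longleftrightarrow> integrable \<kappa> (\<lambda>x. g i x * h (\<psi> i x))"
proof -
  note [measurable] = idx_meas[OF i]
  have eq: "density \<kappa> (\<lambda>x. ennreal (indicator {x. idx x = i} x)) = \<nu> i"
    using density_idx_eq_\<nu>[OF i] by (simp add: ennreal_indicator)
  have "(\<integral>x. indicator {x. idx x = i} x * h x \<partial>\<kappa>) = (\<integral>x. h x \<partial>\<nu> i)"
    unfolding eq[symmetric] by (subst integral_real_density) auto
  then show "(\<integral>x. indicator {x. idx x = i} x * h x \<partial>\<kappa>) = (\<integral>x. g i x * h (\<psi> i x) \<partial>\<kappa>)"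
    by (simp add: \<nu>_integral(1)[OF i h])
  have "integrable \<kappa> (\<lambda>x. indicator {x. idx x = i} x * h x) \<longleftrightarrow> integrable (\<nu> i) h"
    unfolding eq[symmetric] by (subst integrable_real_density) auto
  then show "integrable \<kappa> (\<lambda>x. indicator {x. idx x = i} x * h x) \<longleftrightarrow> integrable \<kappa> (\<lambda>x. g i x * h (\<psi> i x))"
    by (simp add: \<nu>_integral(2)[OF i h])
qed

lemma g_ln_g_integrable: "i \<in> {1..t} \<Longrightarrow> integrable \<kappa> (\<lambda>x. g i x * ln (g i x))"
proof (rule integrable_const_bound[of _ 1])
  assume i: "i \<in> {1..t}"
  note [measurable] = g_meas[OF i]
  show "AE x in \<kappa>. norm (g i x * ln (g i x)) \<le> 1"
    using g_le1
  proof eventually_elim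
    case (elim x)
    then have "0 \<le> g i x" "g i x \<le> 1" using i by force+
    then show ?case using abs_mult_ln_le by simp
  qed
  show "(\<lambda>x. g i x * ln (g i x)) \<in> borel_measurable \<kappa>" by measurable
qed

text \<open>The conditional entropy of the branch label given the image point, with \<open>g\<close>
  as the conditional distribution.\<close>

definition gent :: real where
  "gent = - (\<Sum>i=1..t. \<integral>x. g i x * ln (g i x) \<partial>\<kappa>)"

text \<open>The logarithm may be unbounded, but restricting to branch \<open>i\<close> brings in the
  factor \<open>g i\<close>, and \<open>x ln x\<close> is bounded on [0, 1].\<close>

lemma ln_g_integral:
  shows "integrable \<kappa> (\<lambda>x. ln (g (idx x) (Tm x)))" (is ?A)
    and "(\<integral>x. ln (g (idx x) (Tm x)) \<partial>\<kappa>) = - gent" (is ?B)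
proof -
  have eq: "ln (g (idx x) (Tm x)) = (\<Sum>i=1..t. indicator {x. idx x = i} x * ln (g i (Tm x)))" for x
  proof -
    have "(\<Sum>i=1..t. indicator {x. idx x = i} x * ln (g i (Tm x))) = (\<Sum>i=1..t. if i = idx x then ln (g i (Tm x)) else 0)"
      by (intro sum.cong refl) (simp add: indicator_def)
    then show ?thesis using idx_in[of x] by simp
  qed
  have m: "(\<lambda>x. ln (g i (Tm x))) \<in> borel_measurable borel" if "i \<in> {1..t}" for i
    using measurable_compose[OF Tm_meas g_meas[OF that]] by simp
  have AEi: "AE x in \<kappa>. g i x * ln (g i (Tm (\<psi> i x))) = g i x * ln (g i x)" if "i \<in> {1..t}" for i
    using AE_\<psi>_good[OF that] by eventually_elim simp
  have m2: "(\<lambda>x. g i x * ln (g i (Tm (\<psi> i x)))) \<in> borel_measurable \<kappa>" if "i \<in> {1..t}" for i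
    using measurable_compose[OF \<psi>_meas[OF that] m[OF that]] g_meas[OF that] by simp
  have int: "integrable \<kappa> (\<lambda>x. indicator {x. idx x = i} x * ln (g i (Tm x)))" if i: "i \<in> {1..t}" for i
    unfolding branch_integral(2)[OF i m[OF i]]
    using g_ln_g_integrable[OF i] m2[OF i] AEi[OF i]
    by (subst integrable_cong_AE[where g = "\<lambda>x. g i x * ln (g i x)"]) auto
  show ?A unfolding eq using int by (rule Bochner_Integration.integrable_sum)
  have "(\<integral>x. ln (g (idx x) (Tm x)) \<partial>\<kappa>) = (\<Sum>i=1..t. \<integral>x. indicator {x. idx x = i} x * ln (g i (Tm x)) \<partial>\<kappa>)"
    unfolding eq using int by (rule Bochner_Integration.integral_sum)
  also have "\<dots> = (\<Sum>i=1..t. \<integral>x. g i x * ln (g i x) \<partial>\<kappa>)"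
  proof (intro sum.cong refl)
    fix i assume i: "i \<in> {1..t}"
    show "(\<integral>x. indicator {x. idx x = i} x * ln (g i (Tm x)) \<partial>\<kappa>) = (\<integral>x. g i x * ln (g i x) \<partial>\<kappa>)"
      unfolding branch_integral(1)[OF i m[OF i]]
      using m2[OF i] AEi[OF i] borel_measurable_integrable[OF g_ln_g_integrable[OF i]]
      by (intro integral_cong_AE) auto
  qed
  finally show ?B by (simp add: gent_def)
qed

text \<open>Branch \<open>i\<close> is entered with density \<open>g i\<close>, so the set where
  that density vanishes is not charged.\<close>

lemma AE_g_pos: "AE x in \<kappa>. 0 < g (idx x) (Tm x)"
proof -
  have "AE x in \<kappa>. idx x = i \<longrightarrow> 0 < g i (Tm x)" if i: "i \<in> {1..t}" for i
  proof -
    note [measurable] = idx_meas[OF i] g_meas[OF i] \<psi>_meas[OF i]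
    have [measurable]: "(\<lambda>x. g i (Tm x)) \<in> borel_measurable borel" by measurable
    have "AE x in \<kappa>. 0 < g i x \<longrightarrow> 0 < g i (Tm (\<psi> i x))"
      using AE_\<psi>_good[OF i] by eventually_elim simp
    then have "AE x in density \<kappa> (\<lambda>x. ennreal (g i x)). 0 < g i (Tm (\<psi> i x))"
      by (subst AE_density) auto
    then have "AE x in \<nu> i. 0 < g i (Tm x)"
      unfolding \<nu>_def by (subst AE_distr_iff) auto
    then have "AE x in \<kappa>. 0 < (indicator {x. idx x = i} x :: ennreal) \<longrightarrow> 0 < g i (Tm x)"
      unfolding density_idx_eq_\<nu>[OF i, symmetric] by (subst (asm) AE_density) auto
    then show ?thesis by eventually_elim (auto simp: indicator_def split: if_splits)
  qed
  then have "AE x in \<kappa>. \<forall>i\<in>{1..t}. idx x = i \<longrightarrow> 0 < g i (Tm x)"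
    by (intro AE_finite_allI) auto
  then show ?thesis by eventually_elim (use idx_in in blast)
qed

sublocale cd: coded_measure \<kappa> Tm idx "{1..t}"
  by (rule coded_\<kappa>)

lemma prb_Cons:
  assumes i: "i \<in> {1..t}" and ws: "ws \<in> words {1..t} n"
  shows "cd.prb (i # ws) = (\<integral>x. indicator {x. word idx Tm n x = ws} x * g i x \<partial>\<kappa>)"
proof -
  define D where "D = {x. word idx Tm n x = ws}"
  have D [measurable]: "D \<in> sets borel" unfolding D_def by (rule cd.word_meas[OF ws])
  note [measurable] = idx_meas[OF i] g_meas[OF i] \<psi>_meas[OF i]
  have TD [measurable]: "Tm -` D \<in> sets borel" using measurable_sets[OF Tm_meas D] by simp
  have "{x. word idx Tm (Suc n) x = i # ws} = {x. idx x = i} \<inter> Tm -` D" by (auto simp: D_def)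
  then have "cd.prb (i # ws) = measure \<kappa> ({x. idx x = i} \<inter> Tm -` D)"
    using ws by (simp add: cd.prb_def words_def)
  also have "\<dots> = (\<integral>x. indicator {x. idx x = i} x * indicator (Tm -` D) x \<partial>\<kappa>)"
    by (simp flip: indicator_inter_arith)
  also have "\<dots> = (\<integral>x. g i x * indicator (Tm -` D) (\<psi> i x) \<partial>\<kappa>)"
    by (rule branch_integral(1)[OF i]) simp
  also have "\<dots> = (\<integral>x. indicator D x * g i x \<partial>\<kappa>)"
  proof (rule integral_cong_AE)
    show "AE x in \<kappa>. g i x * indicator (Tm -` D) (\<psi> i x) = indicator D x * g i x"
      using AE_\<psi>_good[OF i] by eventually_elim (auto simp: indicator_def)
  qed measurable
  finally show ?thesis unfolding D_def .
qed

text \<open>Jensen's inequality for \<open>x ln x\<close> on a cylinder, in the form of the tangent at the mean.\<close>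

lemma prb_Cons_ln_le:
  assumes i: "i \<in> {1..t}" and ws: "ws \<in> words {1..t} n"
  shows "cd.prb (i # ws) * ln (cd.prb (i # ws)) - cd.prb (i # ws) * ln (cd.prb ws)
    \<le> (\<integral>x. indicator {x. word idx Tm n x = ws} x * (g i x * ln (g i x)) \<partial>\<kappa>)"
proof -
  define D where "D = {x. word idx Tm n x = ws}"
  define p where "p = cd.prb ws"
  define b where "b = cd.prb (i # ws)"
  have D [measurable]: "D \<in> sets borel" unfolding D_def by (rule cd.word_meas[OF ws])
  have Dk: "D \<in> sets \<kappa>" by simp
  have p: "p = measure \<kappa> D" using ws by (simp add: p_def cd.prb_def D_def words_def)
  have b: "b = (\<integral>x. indicator D x * g i x \<partial>\<kappa>)" unfolding b_def D_def by (rule prb_Cons[OF i ws])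
  have int1: "integrable \<kappa> (\<lambda>x. indicator D x * g i x)"
    using integrable_real_mult_indicator[OF Dk g_integrable[OF i]] by (simp add: mult.commute)
  have int2: "integrable \<kappa> (\<lambda>x. indicator D x * (g i x * ln (g i x)))"
    using integrable_real_mult_indicator[OF Dk g_ln_g_integrable[OF i]] by (simp add: mult.commute)
  have int3: "integrable \<kappa> (\<lambda>x. indicator D x * c)" for c :: real
    by (intro integrable_mult_left integrable_real_indicator) (auto simp: emeasure_eq_measure)
  have nn: "AE x in \<kappa>. 0 \<le> indicator D x * g i x"
    using g_le1 by eventually_elim (use i in \<open>auto simp: indicator_def\<close>)
  have b0: "0 \<le> b" unfolding b_def by simp
  have "b * ln b - b * ln p \<le> (\<integral>x. indicator D x * (g i x * ln (g i x)) \<partial>\<kappa>)"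
  proof (cases "b = 0")
    case True
    then have "AE x in \<kappa>. indicator D x * g i x = 0"
      using integral_nonneg_eq_0_iff_AE[OF int1 nn] b by simp
    then have "AE x in \<kappa>. indicator D x * (g i x * ln (g i x)) = 0"
      by eventually_elim auto
    then have "(\<integral>x. indicator D x * (g i x * ln (g i x)) \<partial>\<kappa>) = 0" by (rule integral_eq_zero_AE)
    then show ?thesis using True by simp
  next
    case False
    then have bpos: "0 < b" using b0 by simp
    have "b \<le> p"
      using cd.prb_append_le(2)[of "[i]" 1 ws n] i ws by (simp add: b_def p_def words_def)
    then have ppos: "0 < p" using bpos by simp
    \<comment> \<open>The tangent point \<open>b / p\<close> is the mean of \<open>g i\<close> over
      the cylinder, so the terms other than the logarithmic one cancel after integration.\<close>
    have "b * ln (b / p) + b - p * (b / p) =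
        (\<integral>x. indicator D x * g i x * ln (b / p) + indicator D x * g i x - indicator D x * (b / p) \<partial>\<kappa>)"
      using int1 int3[of "b / p"] by (simp add: b[symmetric] p[symmetric])
    also have "\<dots> \<le> (\<integral>x. indicator D x * (g i x * ln (g i x)) \<partial>\<kappa>)"
    proof (rule integral_mono_AE)
      show "integrable \<kappa> (\<lambda>x. indicator D x * g i x * ln (b / p) + indicator D x * g i x - indicator D x * (b / p))"
        by (intro Bochner_Integration.integrable_add Bochner_Integration.integrable_diff integrable_mult_left[OF int1] int1 int3)
      show "AE x in \<kappa>. indicator D x * g i x * ln (b / p) + indicator D x * g i x - indicator D x * (b / p)
          \<le> indicator D x * (g i x * ln (g i x))"
        using g_le1
      proof eventually_elim
        case (elim x)
        then have "0 \<le> g i x" using i by blast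
        moreover have "0 < b / p" using bpos ppos by simp
        ultimately show ?case using mult_ln_tangent[of "g i x" "b / p"] by (simp add: indicator_def)
      qed
    qed (rule int2)
    finally show ?thesis using bpos ppos by (simp add: ln_div algebra_simps)
  qed
  then show ?thesis unfolding b_def p_def D_def .
qed

text \<open>Letters are prepended: the increment is the conditional entropy of the label of
  \<open>x\<close> given the first \<open>n\<close> letters of \<open>Tm x\<close>. Conditioning on
  the whole point \<open>Tm x\<close> is finer and can only lower it, to
  \<open>gent\<close>.\<close>

lemma ent_Suc_ge: "cd.ent n + gent \<le> cd.ent (Suc n)"
proof -
  let ?W = "words {1..t} n"
  let ?D = "\<lambda>ws. {x. word idx Tm n x = ws}"
  have sum_Cons: "(\<Sum>i=1..t. cd.prb (i # ws)) = cd.prb ws" if ws: "ws \<in> ?W" for ws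
  proof -
    have Dk: "?D ws \<in> sets \<kappa>" using cd.word_meas[OF ws] by simp
    have int: "integrable \<kappa> (\<lambda>x. indicator (?D ws) x * g i x)" if "i \<in> {1..t}" for i
      using integrable_real_mult_indicator[OF Dk g_integrable[OF that]] by (simp add: mult.commute)
    have "(\<Sum>i=1..t. cd.prb (i # ws)) = (\<integral>x. (\<Sum>i=1..t. indicator (?D ws) x * g i x) \<partial>\<kappa>)"
      using int by (subst Bochner_Integration.integral_sum) (auto simp: prb_Cons[OF _ ws])
    also have "\<dots> = (\<integral>x. indicator (?D ws) x \<partial>\<kappa>)"
    proof (rule integral_cong_AE)
      show "(\<lambda>x. \<Sum>i=1..t. indicator (?D ws) x * g i x) \<in> borel_measurable \<kappa>"
        using int by (intro borel_measurable_sum borel_measurable_integrable)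
      show "AE x in \<kappa>. (\<Sum>i=1..t. indicator (?D ws) x * g i x) = indicator (?D ws) x"
        using g_good by eventually_elim (simp flip: sum_distrib_left)
      show "indicator (?D ws) \<in> borel_measurable \<kappa>" using Dk by (rule borel_measurable_indicator)
    qed
    also have "\<dots> = cd.prb ws" using Dk ws by (simp add: cd.prb_def words_def)
    finally show ?thesis .
  qed
  have part: "(\<Sum>ws\<in>?W. \<integral>x. indicator (?D ws) x * f x \<partial>\<kappa>) = (\<integral>x. f x \<partial>\<kappa>)" if f: "integrable \<kappa> f" for f :: "'a \<Rightarrow> real"
  proof -
    have "(\<Sum>ws\<in>?W. \<integral>x. indicator (?D ws) x * f x \<partial>\<kappa>) = (\<integral>x. (\<Sum>ws\<in>?W. indicator (?D ws) x * f x) \<partial>\<kappa>)"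
    proof (rule Bochner_Integration.integral_sum[symmetric])
      fix ws assume "ws \<in> ?W"
      then have "?D ws \<in> sets \<kappa>" using cd.word_meas by simp
      from integrable_real_mult_indicator[OF this f]
      show "integrable \<kappa> (\<lambda>x. indicator (?D ws) x * f x)" by (simp add: mult.commute)
    qed
    also have "\<dots> = (\<integral>x. f x \<partial>\<kappa>)"
    proof (rule Bochner_Integration.integral_cong[OF refl])
      fix x
      have "(\<Sum>ws\<in>?W. indicator (?D ws) x * f x) = (\<Sum>ws\<in>?W. if ws = word idx Tm n x then f x else 0)"
        by (intro sum.cong refl) (auto simp: indicator_def)
      then show "(\<Sum>ws\<in>?W. indicator (?D ws) x * f x) = f x"
        by (simp only: sum.delta[OF finite_words[OF finite_atLeastAtMost]] cd.word_words if_True)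
    qed
    finally show ?thesis .
  qed
  have "- cd.ent (Suc n) + cd.ent n = (\<Sum>ws\<in>?W. \<Sum>i=1..t. cd.prb (i # ws) * ln (cd.prb (i # ws)))
      - (\<Sum>ws\<in>?W. cd.prb ws * ln (cd.prb ws))"
    unfolding cd.ent_def sum_words_Suc by (subst sum.swap) simp
  also have "\<dots> = (\<Sum>ws\<in>?W. \<Sum>i=1..t. cd.prb (i # ws) * ln (cd.prb (i # ws)) - cd.prb (i # ws) * ln (cd.prb ws))"
    unfolding sum_subtractf[symmetric]
    by (rule sum.cong[OF refl]) (simp only: sum_subtractf sum_distrib_right[symmetric] sum_Cons)
  also have "\<dots> \<le> (\<Sum>ws\<in>?W. \<Sum>i=1..t. \<integral>x. indicator (?D ws) x * (g i x * ln (g i x)) \<partial>\<kappa>)"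
    by (intro sum_mono prb_Cons_ln_le)
  also have "\<dots> = (\<Sum>i=1..t. \<Sum>ws\<in>?W. \<integral>x. indicator (?D ws) x * (g i x * ln (g i x)) \<partial>\<kappa>)"
    by (rule sum.swap)
  also have "\<dots> = - gent"
    unfolding gent_def using part[OF g_ln_g_integrable] by simp
  finally show ?thesis by simp
qed

lemma entropy_rate_ge: "gent \<le> lim (\<lambda>n. cd.ent (Suc n) / real (Suc n))"
proof -
  have ge: "real n * gent \<le> cd.ent n" for n
  proof (induction n)
    case 0
    show ?case using cd.ent_nonneg[of 0] by (simp only: of_nat_0 mult_zero_left)
  next
    case (Suc n)
    then show ?case using ent_Suc_ge[of n] by (simp add: algebra_simps)
  qed
  obtain l where l: "(\<lambda>n. cd.ent (Suc n) / real (Suc n)) \<longlonglongrightarrow> l"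
    using cd.ent_convergent by (auto simp: convergent_def)
  have "gent \<le> cd.ent (Suc n) / real (Suc n)" for n
    using ge[of "Suc n"] by (simp add: le_divide_eq mult.commute del: of_nat_Suc)
  then have "gent \<le> l" by (intro LIMSEQ_le_const[OF l]) auto
  then show ?thesis using limI[OF l] by simp
qed

text \<open>One partition suffices for a lower bound, the one into branch pieces. As \<kappa> has no
  atoms, \<open>G\<close> is infinite and every piece is nonempty, so cells and labels correspond
  bijectively and both entropies coincide.\<close>

lemma ks_entropy_ge: "ereal gent \<le> ks_entropy G F \<kappa>"
proof -
  define h where "h i = {x \<in> G. idx x = i}" for i
  define R where "R = h ` {1..t}"
  have h_ne: "h i \<noteq> {}" if i: "i \<in> {1..t}" for i
  proof -
    have "infinite G"
    proof
      assume "finite G"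
      then have "measure \<kappa> G = 0" by (rule finite_null)
      moreover have "measure \<kappa> G = 1" using AE_G by (subst prob_eq_1) auto
      ultimately show False by simp
    qed
    then have "infinite (\<psi> i ` G)"
      using \<psi>_inj[OF i] by (simp add: finite_image_iff inj_on_subset)
    then have "\<psi> i ` G - Crit \<noteq> {}" using finite_Crit by (metis Diff_eq_empty_iff finite_subset)
    then obtain x where "x \<in> G" "\<psi> i x \<notin> Crit" by blast
    then have "\<psi> i x \<in> h i" using idx_\<psi>[OF i] \<psi>_G[OF i] by (simp add: h_def)
    then show ?thesis by blast
  qed
  have h_inj: "inj_on h {1..t}"
  proof (rule inj_onI)
    fix i j assume "i \<in> {1..t}" "h i = h j"
    then obtain x where "x \<in> h i" "x \<in> h j" using h_ne by blast
    then show "i = j" by (simp add: h_def)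
  qed
  have h_meas: "h i \<in> sets borel" if "i \<in> {1..t}" for i
  proof -
    have "h i = G \<inter> {x. idx x = i}" by (auto simp: h_def)
    then show ?thesis using idx_meas[OF that] by simp
  qed
  have R: "R \<in> meas_partitions G"
    unfolding meas_partitions_def R_def using h_meas idx_in by (auto simp: h_def)
  have hidx: "{x. h (idx x) = h i} = {x. idx x = i}" if "i \<in> {1..t}" for i
    using inj_on_eq_iff[OF h_inj] idx_in that by auto
  interpret hc: coded_measure \<kappa> Tm "\<lambda>x. h (idx x)" R
    by unfold_locales (use idx_in idx_meas hidx in \<open>auto simp: R_def\<close>)
  have img: "map h ` words {1..t} n = words R n" for n
  proof -
    have "map h ` words {1..t} n = {rs \<in> lists R. length rs = n}"
      unfolding R_def lists_image words_def by (auto simp: in_lists_conv_set subset_eq)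
    then show ?thesis by (auto simp: words_def in_lists_conv_set subset_eq)
  qed
  have inj: "inj_on (map h) (words {1..t} n)" for n
  proof (rule inj_onI)
    fix us ws assume *: "us \<in> words {1..t} n" "ws \<in> words {1..t} n" "map h us = map h ws"
    have "inj_on h (set us \<union> set ws)" using * by (intro inj_on_subset[OF h_inj]) (auto simp: words_def)
    then show "us = ws" using *(3) by (simp add: inj_on_map_eq_map)
  qed
  have prb: "hc.prb (map h ws) = cd.prb ws" if ws: "ws \<in> words {1..t} n" for ws n
  proof -
    have "word (\<lambda>x. h (idx x)) Tm n x = map h ws \<longleftrightarrow> word idx Tm n x = ws" for x
      unfolding map_word[symmetric] using inj_on_eq_iff[OF inj cd.word_words ws] .
    then show ?thesis using ws by (simp add: hc.prb_def cd.prb_def words_def)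
  qed
  have ent: "hc.ent n = cd.ent n" for n
    unfolding hc.ent_def cd.ent_def img[symmetric] sum.reindex[OF inj] by (simp add: prb)
  have G0: "emeasure \<kappa> (- G) = 0"
    using AE_G by (subst (asm) AE_iff_measurable[of "- G"]) auto
  have "part_entropy \<kappa> (join_part G F R n) = cd.ent n" for n
    unfolding ent[symmetric]
    by (rule part_entropy_join[OF hc.coded_measure_axioms R G_borel G0])
      (auto simp: h_def Tm_def F_G)
  then have "ereal gent \<le> ereal (lim (\<lambda>n. part_entropy \<kappa> (join_part G F R (Suc n)) / real (Suc n)))"
    using entropy_rate_ge by simp
  also have "\<dots> \<le> ks_entropy G F \<kappa>"
    unfolding ks_entropy_def by (rule SUP_upper[OF R])
  finally show ?thesis .
qed

end

section \<open>The entropy of invariant measures on the fractal\<close>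

context ifs_geom
begin

lemma inv_measure_Tm:
  assumes "prob_space m" and sets_m: "sets m = sets borel" and G0: "emeasure m (UNIV - G) = 0"
    and inv: "\<And>B. B \<in> sets borel \<Longrightarrow> emeasure m (F -` B \<inter> G) = emeasure m B"
  shows "inv_measure m Tm"
proof -
  interpret prob_space m by fact
  have AE_G: "AE x in m. x \<in> G"
    using G0 sets_m by (intro AE_I[of _ _ "UNIV - G"]) auto
  show ?thesis
  proof
    fix B :: "'a set" assume B: "B \<in> sets borel"
    have TB: "Tm -` B \<in> sets borel" using measurable_sets[OF Tm_meas B] by simp
    have eq: "F -` B \<inter> G = Tm -` B \<inter> G" by (auto simp: Tm_def)
    have "emeasure m (Tm -` B) = emeasure m (F -` B \<inter> G)"
      unfolding eq using AE_G TB sets_m by (intro emeasure_eq_AE) auto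
    then show "emeasure m (Tm -` B) = emeasure m B" using inv[OF B] by simp
  qed (simp_all add: sets_m)
qed

lemma AE_not_Crit:
  assumes "inv_measure m Tm" "\<And>x. emeasure m {x} = 0"
  shows "AE x in m. x \<notin> Crit"
proof -
  interpret inv_measure m Tm by fact
  have "AE x in m. \<forall>y\<in>Crit. x \<noteq> y"
  proof (rule AE_finite_allI[OF finite_Crit])
    show "AE x in m. x \<noteq> y" for y
      using assms(2)[of y] by (intro AE_I[of _ _ "{y}"]) auto
  qed
  then show ?thesis by eventually_elim auto
qed

text \<open>A partition \<open>R\<close> is coded together with the branch index: the weights
  \<open>g i y * indicator r (\<psi> i y)\<close> again sum to one, and along an orbit they are those of \<open>g\<close> alone.\<close>

lemma ks_entropy_le:
  assumes C: "0 \<le> C" "C < 1" "\<And>i x y. i \<in> {1..t} \<Longrightarrow> dist (\<psi> i x) (\<psi> i y) \<le> C * dist x y"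
    and inv: "inv_measure m Tm" and AE_G: "AE x in m. x \<in> G" and AE_C: "AE x in m. x \<notin> Crit"
    and gm: "\<And>i. i \<in> {1..t} \<Longrightarrow> g i \<in> borel_measurable borel"
    and g_nonneg: "AE y in m. \<forall>i\<in>{1..t}. 0 \<le> g i y" and g_sum: "AE y in m. (\<Sum>i=1..t. g i y) = 1"
    and g_pos: "AE x in m. 0 < g (idx x) (Tm x)" and int: "integrable m (\<lambda>x. ln (g (idx x) (Tm x)))"
  shows "ks_entropy G F m \<le> ereal (- (\<integral>x. ln (g (idx x) (Tm x)) \<partial>m))"
  unfolding ks_entropy_def
proof (rule SUP_least, unfold ereal_less_eq(3))
  interpret inv_measure m Tm by (rule inv)
  fix R assume R: "R \<in> meas_partitions G"
  have R_fin: "finite R" and R_meas: "\<And>r. r \<in> R \<Longrightarrow> r \<in> sets borel" and R_un: "\<Union>R = G"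
    and R_disj: "\<And>r s x. r \<in> R \<Longrightarrow> s \<in> R \<Longrightarrow> x \<in> r \<Longrightarrow> x \<in> s \<Longrightarrow> r = s"
    using R unfolding meas_partitions_def by blast+
  have R_ne: "R \<noteq> {}" using R_un G_ne by blast
  \<comment> \<open>The cell of \<open>x\<close>, with an arbitrary cell off \<open>G\<close> so
    that the label is total.\<close>
  define rc where "rc x = (if x \<in> G then THE r. r \<in> R \<and> x \<in> r else SOME r. r \<in> R)" for x
  have rc: "rc x = r" if "r \<in> R" "x \<in> r" for x r
  proof -
    have "x \<in> G" using that R_un by blast
    moreover have "(THE r. r \<in> R \<and> x \<in> r) = r" by (rule the_equality) (use that R_disj in auto)
    ultimately show ?thesis by (simp add: rc_def)
  qed
  have rc_mem: "x \<in> rc x" if "x \<in> G" for x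
  proof -
    obtain r where "r \<in> R" "x \<in> r" using \<open>x \<in> G\<close> R_un by blast
    then show ?thesis using rc by simp
  qed
  have rc_in: "rc x \<in> R" for x
  proof (cases "x \<in> G")
    case True
    then obtain r where "r \<in> R" "x \<in> r" using R_un by blast
    then show ?thesis using rc by simp
  next
    case False
    then show ?thesis using R_ne by (simp add: rc_def some_in_eq)
  qed
  define r0 where "r0 = (SOME r. r \<in> R)"
  have rc_meas: "{x. rc x = r} \<in> sets borel" if r: "r \<in> R" for r
  proof -
    have "{x. rc x = r} = r \<union> (if r = r0 then - G else {})"
    proof (intro set_eqI)
      fix x
      have "r \<subseteq> G" using r R_un by blast
      then show "x \<in> {x. rc x = r} \<longleftrightarrow> x \<in> r \<union> (if r = r0 then - G else {})"
        using rc[OF r, of x] rc_mem[of x] by (cases "x \<in> G") (auto simp: rc_def r0_def)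
    qed
    then show ?thesis using R_meas[OF r] by auto
  qed
  define X where "X x = (idx x, rc x)" for x
  define I where "I = {1..t} \<times> R"
  interpret ci: coded_ifs m Tm X I "\<lambda>a. \<psi> (fst a)" G C
  proof
    show "finite I" using R_fin by (simp add: I_def)
    show "X x \<in> I" for x using idx_in rc_in by (simp add: X_def I_def)
    show "{x. X x = v} \<in> sets borel" if "v \<in> I" for v
    proof -
      have "{x. X x = v} = {x. idx x = fst v} \<inter> {x. rc x = snd v}" by (auto simp: X_def)
      then show ?thesis using that idx_meas rc_meas by (auto simp: I_def)
    qed
    show "AE x in m. \<psi> (fst (X x)) (Tm x) = x"
      using AE_G AE_C by eventually_elim (simp add: X_def \<psi>_idx_Tm)
  qed (use C \<psi>_G G_compact G_ne AE_G in \<open>auto simp: I_def\<close>)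
  define \<phi> where "\<phi> a y = g (fst a) y * indicator (snd a) (\<psi> (fst a) y)" for a y
  have \<phi>m: "\<phi> a \<in> borel_measurable borel" if "a \<in> I" for a
  proof -
    have a: "fst a \<in> {1..t}" "snd a \<in> R" using that by (auto simp: I_def)
    note [measurable] = gm[OF a(1)] \<psi>_meas[OF a(1)] R_meas[OF a(2)]
    show ?thesis unfolding \<phi>_def by measurable
  qed
  have \<phi>_nonneg: "AE y in m. \<forall>a\<in>I. 0 \<le> \<phi> a y"
    using g_nonneg by eventually_elim (auto simp: \<phi>_def I_def)
  have \<phi>_sum: "AE y in m. (\<Sum>a\<in>I. \<phi> a y) = 1"
    using g_sum AE_G
  proof eventually_elim
    case (elim y)
    have "(\<Sum>a\<in>I. \<phi> a y) = (\<Sum>i=1..t. \<Sum>r\<in>R. g i y * indicator r (\<psi> i y))"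
      by (simp add: I_def \<phi>_def sum.cartesian_product case_prod_unfold)
    also have "\<dots> = (\<Sum>i=1..t. g i y)"
    proof (intro sum.cong refl)
      fix i assume i: "i \<in> {1..t}"
      have y: "\<psi> i y \<in> G" using \<psi>_G[OF i] elim by simp
      have "(\<Sum>r\<in>R. g i y * indicator r (\<psi> i y)) = (\<Sum>r\<in>R. if r = rc (\<psi> i y) then g i y else 0)"
      proof (intro sum.cong refl)
        fix r assume "r \<in> R"
        show "g i y * indicator r (\<psi> i y) = (if r = rc (\<psi> i y) then g i y else 0)"
        proof (cases "\<psi> i y \<in> r")
          case True
          then show ?thesis using rc[OF \<open>r \<in> R\<close> True] by simp
        next
          case False
          then have "r \<noteq> rc (\<psi> i y)" using rc_mem[OF y] by auto
          then show ?thesis using False by simp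
        qed
      qed
      then show "(\<Sum>r\<in>R. g i y * indicator r (\<psi> i y)) = g i y"
        using R_fin rc_in by simp
    qed
    finally show ?case using elim by simp
  qed
  have \<phi>_eq: "AE x in m. \<phi> (X x) (Tm x) = g (idx x) (Tm x)"
    using AE_G AE_C by eventually_elim (simp add: \<phi>_def X_def \<psi>_idx_Tm rc_mem)
  have lhs_m: "(\<lambda>x. ln (\<phi> (X x) (Tm x))) \<in> borel_measurable borel"
  proof (rule borel_measurable_finite_index[OF ci.finite_I ci.X_in ci.X_meas, of "\<lambda>a x. ln (\<phi> a (Tm x))"])
    show "(\<lambda>x. ln (\<phi> a (Tm x))) \<in> borel_measurable borel" if "a \<in> I" for a
      using measurable_compose[OF Tm_meas \<phi>m[OF that]] by simp
  qed
  have AE_ln: "AE x in m. ln (\<phi> (X x) (Tm x)) = ln (g (idx x) (Tm x))"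
    using \<phi>_eq by eventually_elim simp
  have lhs_m': "(\<lambda>x. ln (\<phi> (X x) (Tm x))) \<in> borel_measurable m"
    using lhs_m by (simp add: measurable_cong_sets[OF sets_m refl])
  have \<phi>_int: "integrable m (\<lambda>x. ln (\<phi> (X x) (Tm x)))"
    using int lhs_m' AE_ln by (subst integrable_cong_AE[where g = "\<lambda>x. ln (g (idx x) (Tm x))"]) auto
  have \<phi>_integral: "(\<integral>x. ln (\<phi> (X x) (Tm x)) \<partial>m) = (\<integral>x. ln (g (idx x) (Tm x)) \<partial>m)"
    using int lhs_m' AE_ln by (intro integral_cong_AE) auto
  have \<phi>_pos: "AE x in m. 0 < \<phi> (X x) (Tm x)"
    using g_pos \<phi>_eq by eventually_elim simp
  have sndI: "snd ` I = R" unfolding I_def using t2 by (auto simp: image_iff)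
  \<comment> \<open>\<open>snd\<close> discards the branch label, so the entropy on the left is that
    of \<open>R\<close> alone.\<close>
  have rate: "lim (\<lambda>n. coded_measure.ent m Tm rc R (Suc n) / real (Suc n)) \<le> - (\<integral>x. ln (g (idx x) (Tm x)) \<partial>m)"
    using ci.entropy_rate_le[OF \<phi>m \<phi>_nonneg \<phi>_sum \<phi>_pos \<phi>_int, of snd]
    unfolding sndI \<phi>_integral by (simp add: X_def)
  have coded: "coded_measure m Tm rc R"
    using ci.coded_image[of snd] unfolding sndI by (simp add: X_def)
  have G0: "emeasure m (- G) = 0"
    using AE_G by (subst (asm) AE_iff_measurable[of "- G"]) auto
  have "part_entropy m (join_part G F R n) = coded_measure.ent m Tm rc R n" for n
    by (rule part_entropy_join[OF coded R G_borel G0]) (auto simp: rc_mem Tm_def F_G)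
  then show "lim (\<lambda>n. part_entropy m (join_part G F R (Suc n)) / real (Suc n)) \<le> - (\<integral>x. ln (g (idx x) (Tm x)) \<partial>m)"
    using rate by simp
qed

text \<open>The constant weights \<open>1 / t\<close> are admissible and bound the entropy by
  \<open>ln t\<close>. This keeps the functional from adding opposite infinities.\<close>

lemma ks_entropy_finite:
  assumes C: "0 \<le> C" "C < 1" "\<And>i x y. i \<in> {1..t} \<Longrightarrow> dist (\<psi> i x) (\<psi> i y) \<le> C * dist x y"
    and inv: "inv_measure m Tm" and AE_G: "AE x in m. x \<in> G" and AE_C: "AE x in m. x \<notin> Crit"
  shows "ks_entropy G F m \<noteq> \<infinity>"
proof -
  interpret inv_measure m Tm by (rule inv)
  have "ks_entropy G F m \<le> ereal (- (\<integral>x. ln (1 / real t) \<partial>m))"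
    by (rule ks_entropy_le[OF C inv AE_G AE_C]) (use t2 in auto)
  then show ?thesis by auto
qed

end

section \<open>The pressure functional\<close>

lemma hs_sum_left: "hs q (\<lambda>S T. \<Sum>i\<in>J. c i * X i S T) Y = (\<Sum>i\<in>J. c i * hs q (X i) Y)"
proof -
  have "hs q (\<lambda>S T. \<Sum>i\<in>J. c i * X i S T) Y = (\<Sum>S\<in>Iq q. \<Sum>T\<in>Iq q. \<Sum>i\<in>J. c i * (X i S T * Y T S))"
    unfolding hs_def by (intro sum.cong refl) (simp add: sum_distrib_right mult.assoc)
  also have "\<dots> = (\<Sum>S\<in>Iq q. \<Sum>i\<in>J. \<Sum>T\<in>Iq q. c i * (X i S T * Y T S))"
    by (intro sum.cong refl sum.swap)
  also have "\<dots> = (\<Sum>i\<in>J. \<Sum>S\<in>Iq q. \<Sum>T\<in>Iq q. c i * (X i S T * Y T S))"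
    by (rule sum.swap)
  also have "\<dots> = (\<Sum>i\<in>J. c i * hs q (X i) Y)"
    unfolding hs_def by (simp add: sum_distrib_left)
  finally show ?thesis .
qed

lemma hs_smult_left: "hs q (\<lambda>S T. c * X S T) Y = c * hs q X Y"
  unfolding hs_def by (simp add: sum_distrib_left mult.assoc)

lemma hs_smult_right: "(\<And>S T. S \<in> Iq q \<Longrightarrow> T \<in> Iq q \<Longrightarrow> Y S T = c * Z S T) \<Longrightarrow> hs q X Y = c * hs q X Z"
  unfolding hs_def sum_distrib_left by (intro sum.cong refl) simp

lemma hs_cong_left: "(\<And>S T. S \<in> Iq q \<Longrightarrow> T \<in> Iq q \<Longrightarrow> X S T = X' S T) \<Longrightarrow> hs q X Y = hs q X' Y"
  unfolding hs_def by (intro sum.cong refl) simp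

lemma Psi_smult: "Psi q A (\<lambda>S T. c * X S T) = (\<lambda>S T. c * Psi q A X S T)"
  unfolding Psi_def qmul_def by (simp add: fun_eq_iff sum_distrib_left mult_ac)

lemma integrable_mult_bounded:
  fixes f h :: "'a \<Rightarrow> real"
  assumes "integrable M f" and [measurable]: "h \<in> borel_measurable M" and "AE x in M. \<bar>h x\<bar> \<le> B"
  shows "integrable M (\<lambda>x. h x * f x)"
proof (rule Bochner_Integration.integrable_bound)
  show "integrable M (\<lambda>x. B * f x)" using assms(1) by simp
  show "(\<lambda>x. h x * f x) \<in> borel_measurable M" using assms(1) by measurable
  show "AE x in M. norm (h x * f x) \<le> norm (B * f x)"
    using assms(3) by eventually_elim (auto simp: abs_mult intro!: mult_right_mono)
qed

locale kusuoka = ifs_geom t \<psi> G Ob F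
  for t :: nat and \<psi> :: "nat \<Rightarrow> (real, 'n::{finite,linorder}) vec \<Rightarrow> (real, 'n) vec" and G Ob F +
  fixes q :: nat and A :: "nat \<Rightarrow> ((real, 'n) vec, 'n) vec" and V :: "(real, 'n) vec \<Rightarrow> real"
    and \<beta> C :: real and Q :: "(real, 'n) vec \<Rightarrow> 'n qmat"
  assumes C: "0 \<le> C" "C < 1" "\<And>i x y. i \<in> {1..t} \<Longrightarrow> dist (\<psi> i x) (\<psi> i y) \<le> C * dist x y"
    and V_cont: "continuous_on G V" and \<beta>_pos: "0 < \<beta>"
    and Q_cont: "\<And>S T. continuous_on G (\<lambda>x. Q x S T)"
    and Q_pd: "\<And>x. x \<in> G \<Longrightarrow> qpd q (Q x)"
    and Q_eig: "\<And>x S T. x \<in> G \<Longrightarrow> S \<in> Iq q \<Longrightarrow> T \<in> Iq q \<Longrightarrow> ruelle q t A \<psi> V Q x S T = \<beta> * Q x S T"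
begin

text \<open>The branch weight \<open>g\<close> of the pair; the indicator cuts off the region where
  \<open>V\<close> and \<open>Q\<close> are arbitrary and possibly not measurable.\<close>

definition gw :: "((real, 'n) vec \<Rightarrow> 'n qmat) \<Rightarrow> nat \<Rightarrow> (real, 'n) vec \<Rightarrow> real" where
  "gw M i y = indicator G y * (exp (V (\<psi> i y)) * hs q (Psi q (A i) (Q (\<psi> i y))) (M y) / \<beta>)"

text \<open>The coefficients of \<open>gw\<close> as a linear function of the entries of
  \<open>M\<close>. They are bounded and Borel, so measurability and integrability pass from the
  entries to \<open>gw\<close>.\<close>

definition wentry :: "nat \<Rightarrow> 'n set \<Rightarrow> 'n set \<Rightarrow> (real, 'n) vec \<Rightarrow> real" where
  "wentry i S T y = indicator G y * (exp (V (\<psi> i y)) * Psi q (A i) (Q (\<psi> i y)) S T / \<beta>)"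

lemma gw_eq: "gw M i y = (\<Sum>S\<in>Iq q. \<Sum>T\<in>Iq q. wentry i S T y * M y T S)"
  unfolding gw_def wentry_def hs_def by (simp add: sum_distrib_left sum_divide_distrib mult_ac)

lemma wentry_bounded:
  assumes i: "i \<in> {1..t}"
  shows "wentry i S T \<in> borel_measurable borel" "\<exists>B. \<forall>y. \<bar>wentry i S T y\<bar> \<le> B"
proof -
  let ?f = "\<lambda>y. exp (V (\<psi> i y)) * Psi q (A i) (Q (\<psi> i y)) S T / \<beta>"
  have \<psi>c: "continuous_on G (\<psi> i)" by (rule continuous_on_subset[OF \<psi>_cont[OF i]]) simp
  have sub: "\<psi> i ` G \<subseteq> G" using \<psi>_G[OF i] by blast
  note comp = continuous_on_compose2[OF _ \<psi>c sub]
  have cont: "continuous_on G ?f"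
    unfolding Psi_def qmul_def
    by (intro continuous_intros comp[OF V_cont] comp[OF Q_cont]) (use \<beta>_pos in auto)
  have "(\<lambda>y. indicator G y *\<^sub>R ?f y) \<in> borel_measurable borel"
    using cont by (intro borel_measurable_continuous_on_indicator) auto
  then show "wentry i S T \<in> borel_measurable borel" by (simp add: wentry_def[abs_def])
  have "bounded (?f ` G)" using compact_continuous_image[OF cont G_compact] by (rule compact_imp_bounded)
  then obtain B where B: "\<And>y. y \<in> G \<Longrightarrow> \<bar>?f y\<bar> \<le> B" unfolding bounded_iff by auto
  have "\<bar>wentry i S T y\<bar> \<le> \<bar>B\<bar>" for y
  proof (cases "y \<in> G")
    case True
    then show ?thesis using B[OF True] by (simp add: wentry_def)
  next
    case False
    then show ?thesis by (simp add: wentry_def)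
  qed
  then show "\<exists>B. \<forall>y. \<bar>wentry i S T y\<bar> \<le> B" by blast
qed

lemma gw_meas:
  assumes "i \<in> {1..t}" "\<And>S T. (\<lambda>x. M x S T) \<in> borel_measurable borel"
  shows "gw M i \<in> borel_measurable borel"
  unfolding gw_eq[abs_def] using wentry_bounded(1)[OF assms(1)] assms(2)
  by (intro borel_measurable_sum borel_measurable_times)

lemma gw_nonneg:
  assumes i: "i \<in> {1..t}" and "qpsd q (M y)"
  shows "0 \<le> gw M i y"
proof (cases "y \<in> G")
  case True
  have "0 \<le> hs q (Psi q (A i) (Q (\<psi> i y))) (M y)"
    by (intro hs_nonneg qpsd_Psi qpd_imp_qpsd Q_pd \<psi>_G i True assms(2))
  then show ?thesis using \<beta>_pos by (simp add: gw_def True)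
qed (simp add: gw_def)

lemma gw_sum:
  assumes y: "y \<in> G" and "hs q (Q y) (M y) = 1"
  shows "(\<Sum>i=1..t. gw M i y) = 1"
proof -
  have "\<beta> * hs q (Q y) (M y) = hs q (ruelle q t A \<psi> V Q y) (M y)"
    unfolding hs_smult_left[symmetric] by (intro hs_cong_left) (simp add: Q_eig[OF y])
  also have "\<dots> = (\<Sum>i=1..t. exp (V (\<psi> i y)) * hs q (Psi q (A i) (Q (\<psi> i y))) (M y))"
    unfolding ruelle_def by (rule hs_sum_left)
  also have "\<dots> = \<beta> * (\<Sum>i=1..t. gw M i y)"
    using y \<beta>_pos by (simp add: gw_def sum_distrib_left)
  finally show ?thesis using assms(2) \<beta>_pos by simp
qed

text \<open>With \<open>y = F x\<close> and \<open>i\<close> the label of \<open>x\<close>, the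
  point \<open>\<psi> i y\<close> is \<open>x\<close> itself; the weight and the pairing then differ
  only by the normalising factors in \<open>gw\<close>.\<close>

lemma hs_tPsi_eq:
  assumes "x \<in> G" "x \<notin> Crit"
  shows "hs q (Q x) (tPsi q (A (iota t \<psi> G x)) (M (F x))) = gw M (idx x) (Tm x) * \<beta> * exp (- V x)"
proof -
  have 1: "\<psi> (idx x) (Tm x) = x" by (rule \<psi>_idx_Tm[OF assms])
  have 2: "idx x = iota t \<psi> G x" "Tm x = F x" using assms by (simp_all add: idx_def Tm_def)
  show ?thesis
    unfolding gw_def 1 using Tm_G[of x] \<beta>_pos
    by (simp add: 2 hs_Psi_eq_hs_tPsi exp_minus field_simps)
qed

lemma V_bounded: "\<exists>B\<ge>0. \<forall>x. \<bar>indicator G x * V x\<bar> \<le> B" and V_meas: "(\<lambda>x. indicator G x * V x) \<in> borel_measurable borel"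
proof -
  have "bounded (V ` G)" using compact_continuous_image[OF V_cont G_compact] by (rule compact_imp_bounded)
  then obtain B where B: "\<And>y. y \<in> G \<Longrightarrow> \<bar>V y\<bar> \<le> B" unfolding bounded_iff by auto
  have "\<bar>indicator G x * V x\<bar> \<le> \<bar>B\<bar>" for x
    using B[of x] by (auto simp: indicator_def)
  then show "\<exists>B\<ge>0. \<forall>x. \<bar>indicator G x * V x\<bar> \<le> B" by (intro exI[of _ "\<bar>B\<bar>"]) auto
  have "(\<lambda>y. indicator G y *\<^sub>R V y) \<in> borel_measurable borel"
    using V_cont by (intro borel_measurable_continuous_on_indicator) auto
  then show "(\<lambda>x. indicator G x * V x) \<in> borel_measurable borel" by simp
qed

lemma gw_path_meas:
  assumes "\<And>S T. (\<lambda>x. M x S T) \<in> borel_measurable borel"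
  shows "(\<lambda>x. gw M (idx x) (Tm x)) \<in> borel_measurable borel"
  by (rule borel_measurable_finite_index[of "{1..t}" idx "\<lambda>i x. gw M i (Tm x)"])
    (use idx_in idx_meas measurable_compose[OF Tm_meas gw_meas] assms in auto)

lemma ext_int_integrable:
  assumes inv: "inv_measure m Tm" and AE_G: "AE x in m. x \<in> G" and AE_C: "AE x in m. x \<notin> Crit"
    and pos: "AE x in m. 0 < gw M (idx x) (Tm x)" and int: "integrable m (\<lambda>x. ln (gw M (idx x) (Tm x)))"
  shows "ext_int m G (\<lambda>x. elog (hs q (Q x) (tPsi q (A (iota t \<psi> G x)) (M (F x))))) =
    ereal ((\<integral>x. ln (gw M (idx x) (Tm x)) \<partial>m) + ln \<beta> - (LINT x:G|m. V x))"
proof -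
  interpret inv_measure m Tm by (rule inv)
  \<comment> \<open>The finite logarithm; the term with \<open>V\<close> cancels the potential term
    of the functional.\<close>
  define W where "W x = ln (gw M (idx x) (Tm x)) + ln \<beta> - indicator G x * V x" for x
  define e where "e x = elog (hs q (Q x) (tPsi q (A (iota t \<psi> G x)) (M (F x))))" for x
  obtain B where B: "\<And>x. \<bar>indicator G x * V x\<bar> \<le> B" using V_bounded by blast
  have Vint: "integrable m (\<lambda>x. indicator G x * V x)"
    by (rule integrable_bounded[OF V_meas, of B]) (simp add: B)
  have Wint: "integrable m W" unfolding W_def using int Vint by simp
  have eW: "AE x in m. x \<in> G \<and> e x = ereal (W x)"
    using AE_G AE_C pos
  proof eventually_elim
    case (elim x)
    then show ?case using \<beta>_pos by (simp add: e_def hs_tPsi_eq elog_def W_def ln_mult)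
  qed
  have "(\<integral>\<^sup>+ x\<in>G. e2ennreal (e x) \<partial>m) = (\<integral>\<^sup>+ x. ennreal (W x) \<partial>m)"
    using eW by (intro nn_integral_cong_AE, elim eventually_mono) auto
  moreover have "(\<integral>\<^sup>+ x\<in>G. e2ennreal (- e x) \<partial>m) = (\<integral>\<^sup>+ x. ennreal (- W x) \<partial>m)"
    using eW by (intro nn_integral_cong_AE, elim eventually_mono) auto
  moreover have "enn2ereal (\<integral>\<^sup>+ x. ennreal (W x) \<partial>m) - enn2ereal (\<integral>\<^sup>+ x. ennreal (- W x) \<partial>m) = ereal (\<integral>x. W x \<partial>m)"
  proof -
    have fin: "(\<integral>\<^sup>+ x. ennreal (W x) \<partial>m) \<noteq> \<infinity>" "(\<integral>\<^sup>+ x. ennreal (- W x) \<partial>m) \<noteq> \<infinity>"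
      using Wint unfolding real_integrable_def by auto
    show ?thesis
      unfolding real_lebesgue_integral_def[OF Wint] using fin
      by (cases "\<integral>\<^sup>+ x. ennreal (W x) \<partial>m"; cases "\<integral>\<^sup>+ x. ennreal (- W x) \<partial>m") auto
  qed
  ultimately have "ext_int m G e = ereal (\<integral>x. W x \<partial>m)" unfolding ext_int_def by simp
  also have "(\<integral>x. W x \<partial>m) = (\<integral>x. ln (gw M (idx x) (Tm x)) \<partial>m) + ln \<beta> - (LINT x:G|m. V x)"
    unfolding W_def set_lebesgue_integral_def using int Vint by simp
  finally show ?thesis unfolding e_def .
qed

lemma KV_facts:
  assumes "(m, M) \<in> KV q G F Q"
  shows "inv_measure m Tm" "AE x in m. x \<in> G" "AE x in m. x \<notin> Crit"
    "\<And>S T. (\<lambda>x. M x S T) \<in> borel_measurable borel"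
    "AE y in m. \<forall>i\<in>{1..t}. 0 \<le> gw M i y" "AE y in m. (\<Sum>i=1..t. gw M i y) = 1"
proof -
  have KV: "sets m = sets borel" "prob_space m" "emeasure m (UNIV - G) = 0" "\<And>x. emeasure m {x} = 0"
      "\<And>B. B \<in> sets borel \<Longrightarrow> emeasure m (F -` B \<inter> G) = emeasure m B"
      "\<And>S T. (\<lambda>x. M x S T) \<in> borel_measurable borel" "AE x in m. qpsd q (M x) \<and> hs q (Q x) (M x) = 1"
    using assms unfolding KV_def by auto
  show inv: "inv_measure m Tm" by (rule inv_measure_Tm[OF KV(2,1,3,5)])
  show AE_G: "AE x in m. x \<in> G" using KV(1,3) by (intro AE_I[of _ _ "UNIV - G"]) auto
  show "AE x in m. x \<notin> Crit" by (rule AE_not_Crit[OF inv KV(4)])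
  show "\<And>S T. (\<lambda>x. M x S T) \<in> borel_measurable borel" by (rule KV(6))
  show "AE y in m. \<forall>i\<in>{1..t}. 0 \<le> gw M i y" using KV(7) by eventually_elim (simp add: gw_nonneg)
  show "AE y in m. (\<Sum>i=1..t. gw M i y) = 1" using KV(7) AE_G by eventually_elim (rule gw_sum, auto)
qed

text \<open>Weights are at most 1, so the positive part of the integrand is bounded by a constant.
  If the logarithm is not integrable, or the weight vanishes on a set of positive measure, the
  negative part must have infinite integral.\<close>

lemma ext_int_not_integrable:
  assumes KV: "(m, M) \<in> KV q G F Q"
    and non: "\<not> ((AE x in m. 0 < gw M (idx x) (Tm x)) \<and> integrable m (\<lambda>x. ln (gw M (idx x) (Tm x))))"
  shows "ext_int m G (\<lambda>x. elog (hs q (Q x) (tPsi q (A (iota t \<psi> G x)) (M (F x))))) = - \<infinity>"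
proof -
  note facts = KV_facts[OF KV]
  interpret inv_measure m Tm by (rule facts(1))
  define gg where "gg x = gw M (idx x) (Tm x)" for x
  define W where "W x = ln (gg x) + ln \<beta> - indicator G x * V x" for x
  define e where "e x = elog (hs q (Q x) (tPsi q (A (iota t \<psi> G x)) (M (F x))))" for x
  have ggm [measurable]: "gg \<in> borel_measurable borel" unfolding gg_def by (rule gw_path_meas[OF facts(4)])
  note [measurable] = V_meas
  have Wm [measurable]: "W \<in> borel_measurable borel" unfolding W_def by measurable
  obtain B where B: "0 \<le> B" "\<And>x. \<bar>indicator G x * V x\<bar> \<le> B" using V_bounded by blast
  have gg01: "AE x in m. 0 \<le> gg x \<and> gg x \<le> 1"
    using AE_T[OF AE_conjI[OF facts(5,6)]]
  proof eventually_elim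
    case (elim x)
    have "gw M (idx x) (Tm x) \<le> (\<Sum>i=1..t. gw M i (Tm x))"
      using elim idx_in by (intro member_le_sum) auto
    then show ?case using elim idx_in[of x] by (simp add: gg_def)
  qed
  define K where "K = \<bar>ln \<beta>\<bar> + B"
  have K0: "0 \<le> K" using B by (simp add: K_def)
  have W_le: "AE x in m. W x \<le> K"
    using gg01
  proof eventually_elim
    case (elim x)
    then have "ln (gg x) \<le> 0" by (cases "gg x = 0") auto
    then show ?case using B(2)[of x] by (simp add: W_def K_def)
  qed
  have e_eq: "AE x in m. x \<in> G \<and> e x = (if 0 < gg x then ereal (W x) else - \<infinity>)"
    using facts(2,3) gg01
  proof eventually_elim
    case (elim x)
    then show ?case using \<beta>_pos
      by (auto simp: e_def hs_tPsi_eq elog_def W_def ln_mult zero_less_mult_iff gg_def)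
  qed
  have "(\<integral>\<^sup>+ x\<in>G. e2ennreal (e x) \<partial>m) \<le> (\<integral>\<^sup>+ x. ennreal K \<partial>m)"
    using e_eq W_le
    by (intro nn_integral_mono_AE, eventually_elim) (auto simp: ennreal_leI e2ennreal_neg indicator_def)
  also have "\<dots> = ennreal K" by (simp add: emeasure_eq_measure)
  finally have fin: "(\<integral>\<^sup>+ x\<in>G. e2ennreal (e x) \<partial>m) \<noteq> \<infinity>" by (auto simp: top_unique)
  have neg_eq: "(\<integral>\<^sup>+ x\<in>G. e2ennreal (- e x) \<partial>m) = (\<integral>\<^sup>+ x. (if 0 < gg x then ennreal (- W x) else \<infinity>) \<partial>m)"
    using e_eq by (intro nn_integral_cong_AE, elim eventually_mono) auto
  have inf: "(\<integral>\<^sup>+ x\<in>G. e2ennreal (- e x) \<partial>m) = \<infinity>"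
  proof (rule ccontr)
    assume "\<not> ?thesis"
    then have nfin: "(\<integral>\<^sup>+ x. (if 0 < gg x then ennreal (- W x) else \<infinity>) \<partial>m) \<noteq> \<infinity>" using neg_eq by simp
    have "AE x in m. (if 0 < gg x then ennreal (- W x) else \<infinity>) \<noteq> \<infinity>"
      by (rule nn_integral_PInf_AE[OF _ nfin]) measurable
    then have pos: "AE x in m. 0 < gg x" by eventually_elim (auto split: if_splits)
    have "(\<integral>\<^sup>+ x. ennreal (- W x) \<partial>m) = (\<integral>\<^sup>+ x. (if 0 < gg x then ennreal (- W x) else \<infinity>) \<partial>m)"
      using pos by (intro nn_integral_cong_AE, elim eventually_mono) auto
    then have n1: "(\<integral>\<^sup>+ x. ennreal (- W x) \<partial>m) \<noteq> \<infinity>" using nfin by simp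
    have "(\<integral>\<^sup>+ x. ennreal (W x) \<partial>m) \<le> (\<integral>\<^sup>+ x. ennreal K \<partial>m)"
      using W_le by (intro nn_integral_mono_AE, elim eventually_mono) (auto simp: ennreal_leI)
    also have "\<dots> = ennreal K" by (simp add: emeasure_eq_measure)
    finally have n2: "(\<integral>\<^sup>+ x. ennreal (W x) \<partial>m) \<noteq> \<infinity>" by (auto simp: top_unique)
    have Wint: "integrable m W" unfolding real_integrable_def using n1 n2 by simp
    have Vint: "integrable m (\<lambda>x. indicator G x * V x)"
      by (rule integrable_bounded[OF V_meas, of B]) (simp add: B)
    have "integrable m (\<lambda>x. W x - ln \<beta> + indicator G x * V x)" using Wint Vint by simp
    then have "integrable m (\<lambda>x. ln (gg x))" by (simp add: W_def)
    with pos non show False by (simp add: gg_def)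
  qed
  show ?thesis
    unfolding ext_int_def e_def[symmetric] inf using fin
    by (cases "\<integral>\<^sup>+ x\<in>G. e2ennreal (e x) \<partial>m") auto
qed

lemma press_fun_le:
  assumes KV: "(m, M) \<in> KV q G F Q"
  shows "press_fun q t A \<psi> G F V Q m M \<le> ereal (ln \<beta>)"
proof -
  note facts = KV_facts[OF KV]
  show ?thesis
  proof (cases "(AE x in m. 0 < gw M (idx x) (Tm x)) \<and> integrable m (\<lambda>x. ln (gw M (idx x) (Tm x)))")
    case True
    define L where "L = (\<integral>x. ln (gw M (idx x) (Tm x)) \<partial>m)"
    have "ks_entropy G F m \<le> ereal (- L)"
      unfolding L_def
      by (rule ks_entropy_le[OF C facts(1-3) gw_meas[OF _ facts(4)] facts(5,6)]) (use True in auto)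
    moreover have "ext_int m G (\<lambda>x. elog (hs q (Q x) (tPsi q (A (iota t \<psi> G x)) (M (F x))))) =
        ereal (L + ln \<beta> - (LINT x:G|m. V x))"
      unfolding L_def by (rule ext_int_integrable[OF facts(1-3)]) (use True in auto)
    ultimately have "press_fun q t A \<psi> G F V Q m M \<le>
        ereal (- L) + ereal (LINT x:G|m. V x) + ereal (L + ln \<beta> - (LINT x:G|m. V x))"
      unfolding press_fun_def by (simp only: add_right_mono)
    then show ?thesis by simp
  next
    case False
    \<comment> \<open>Finiteness matters: for \<open>ereal\<close>,
      \<open>\<infinity> + - \<infinity>\<close> is \<infinity>, which would break the
      bound.\<close>
    have "ks_entropy G F m \<noteq> \<infinity>" by (rule ks_entropy_finite[OF C facts(1-3)])
    then have "press_fun q t A \<psi> G F V Q m M = - \<infinity>"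
      unfolding press_fun_def ext_int_not_integrable[OF KV False] by (cases "ks_entropy G F m") auto
    then show ?thesis by simp
  qed
qed

end

section \<open>Kusuoka's measure\<close>

locale kusuoka_measure = kusuoka t \<psi> G Ob F q A V \<beta> C Q + finite_measure \<nu>
  for t :: nat and \<psi> :: "nat \<Rightarrow> (real, 'n::{finite,linorder}) vec \<Rightarrow> (real, 'n) vec" and G Ob F
    and q :: nat and A :: "nat \<Rightarrow> ((real, 'n) vec, 'n) vec" and V \<beta> C Q
    and \<nu> :: "(real, 'n) vec measure" +
  fixes N Mg :: "(real, 'n) vec \<Rightarrow> 'n qmat"
  assumes q_range: "1 \<le> q" "q \<le> CARD('n)"
    and A_inv: "\<And>i. i \<in> {1..t} \<Longrightarrow> invertible (A i)" and ND: "NDq q t A"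
    and sets_\<nu> [measurable_cong, simp]: "sets \<nu> = sets borel"
    and \<nu>_G: "emeasure \<nu> (UNIV - G) = 0"
    and N_int: "\<And>S T. integrable \<nu> (\<lambda>x. N x S T)"
    and mu_psd: "\<And>B. B \<in> sets borel \<Longrightarrow> qpsd q (\<lambda>S T. LINT x:B|\<nu>. N x S T)"
    and mu_eig: "\<And>f. \<forall>S T. continuous_on G (\<lambda>x. f x S T) \<Longrightarrow> \<forall>x\<in>G. qsym q (f x) \<Longrightarrow>
        (LINT x:G|\<nu>. hs q (ruelle q t A \<psi> V f x) (N x)) = \<beta> * (LINT x:G|\<nu>. hs q (f x) (N x))"
    and mu_norm: "(LINT x:G|\<nu>. hs q (Q x) (N x)) = 1"
    and Mg_meas: "\<And>S T. (\<lambda>x. Mg x S T) \<in> borel_measurable borel"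
    and Mg_sym: "\<And>x. x \<in> G \<Longrightarrow> qsym q (Mg x)"
    and Mg_int: "\<And>S T. integrable (density \<nu> (\<lambda>x. ennreal (hs q (Q x) (N x)))) (\<lambda>x. Mg x S T)"
    and Mg_dens: "\<And>B S T. B \<in> sets borel \<Longrightarrow> S \<in> Iq q \<Longrightarrow> T \<in> Iq q \<Longrightarrow>
        (LINT x:B|\<nu>. N x S T) = (LINT x:B|density \<nu> (\<lambda>x. ennreal (hs q (Q x) (N x))). Mg x S T)"
begin

abbreviation "\<kappa> \<equiv> density \<nu> (\<lambda>x. ennreal (hs q (Q x) (N x)))"

lemma space_\<nu> [simp]: "space \<nu> = UNIV"
  using sets_eq_imp_space_eq[OF sets_\<nu>] by simp

lemma AE_\<nu>_G: "AE x in \<nu>. x \<in> G"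
  using \<nu>_G by (intro AE_I[of _ _ "UNIV - G"]) auto

lemma N_meas [measurable]: "(\<lambda>x. N x S T) \<in> borel_measurable \<nu>"
  using N_int by (rule borel_measurable_integrable)

text \<open>Positivity is given for integrals over sets and wanted pointwise. Uniqueness of
  densities gives symmetry, and for each fixed \<open>c\<close> nonnegativity holds almost
  everywhere; a common exceptional set for all \<open>c\<close> comes from the countably many
  rational vectors and continuity of the form.\<close>

lemma N_psd: "AE x in \<nu>. qpsd q (N x)"
proof -
  have int_set: "set_integrable \<nu> B (\<lambda>x. c * N x S T)" if "B \<in> sets borel" for B c S T
    unfolding set_integrable_def using that N_int
    by (intro integrable_mult_indicator integrable_mult_right) auto
  have sym: "AE x in \<nu>. N x S T = N x T S" if "S \<in> Iq q" "T \<in> Iq q" for S T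
    by (rule density_unique_banach[OF N_int N_int]) (use that mu_psd in \<open>auto simp: qpsd_def qsym_def\<close>)
  have sym_all: "AE x in \<nu>. \<forall>S\<in>Iq q. \<forall>T\<in>Iq q. N x S T = N x T S"
    by (intro AE_finite_allI sym) auto
  define f where "f c x = (\<Sum>S\<in>Iq q. \<Sum>T\<in>Iq q. (c S * c T) * N x S T)" for c :: "'n set \<Rightarrow> real" and x
  have f_int: "integrable \<nu> (f c)" for c
    unfolding f_def by (intro Bochner_Integration.integrable_sum integrable_mult_right N_int)
  have f_nonneg: "AE x in \<nu>. 0 \<le> f c x" for c
  proof (rule density_nonneg[OF f_int])
    fix B assume "B \<in> sets \<nu>"
    then have B: "B \<in> sets borel" by simp
    have "(LINT x:B|\<nu>. f c x) = (\<Sum>S\<in>Iq q. \<Sum>T\<in>Iq q. c S * (LINT x:B|\<nu>. N x S T) * c T)"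
    proof -
      have "(LINT x:B|\<nu>. f c x) = (\<integral>x. (\<Sum>S\<in>Iq q. \<Sum>T\<in>Iq q. indicator B x *\<^sub>R ((c S * c T) * N x S T)) \<partial>\<nu>)"
        unfolding set_lebesgue_integral_def f_def by (simp add: sum_distrib_left)
      also have "\<dots> = (\<Sum>S\<in>Iq q. \<integral>x. (\<Sum>T\<in>Iq q. indicator B x *\<^sub>R ((c S * c T) * N x S T)) \<partial>\<nu>)"
        using int_set[OF B] unfolding set_integrable_def
        by (intro Bochner_Integration.integral_sum Bochner_Integration.integrable_sum)
      also have "\<dots> = (\<Sum>S\<in>Iq q. \<Sum>T\<in>Iq q. \<integral>x. indicator B x *\<^sub>R ((c S * c T) * N x S T) \<partial>\<nu>)"
        using int_set[OF B] unfolding set_integrable_def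
        by (intro sum.cong refl Bochner_Integration.integral_sum)
      also have "\<dots> = (\<Sum>S\<in>Iq q. \<Sum>T\<in>Iq q. c S * (LINT x:B|\<nu>. N x S T) * c T)"
      proof (intro sum.cong refl)
        fix S T
        have "(\<integral>x. indicator B x *\<^sub>R ((c S * c T) * N x S T) \<partial>\<nu>) = (\<integral>x. (c S * c T) * (indicator B x *\<^sub>R N x S T) \<partial>\<nu>)"
          by (simp add: mult_ac)
        also have "\<dots> = (c S * c T) * (\<integral>x. indicator B x *\<^sub>R N x S T \<partial>\<nu>)" by (rule integral_mult_right_zero)
        finally show "(\<integral>x. indicator B x *\<^sub>R ((c S * c T) * N x S T) \<partial>\<nu>) = c S * (LINT x:B|\<nu>. N x S T) * c T"
          by (simp add: set_lebesgue_integral_def)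
      qed
      finally show ?thesis .
    qed
    also have "0 \<le> \<dots>" using mu_psd[OF B] by (simp add: qpsd_def)
    finally show "0 \<le> (LINT x:B|\<nu>. f c x)" .
  qed
  have "AE x in \<nu>. \<forall>c :: 'n set \<Rightarrow> rat. 0 \<le> f (\<lambda>S. of_rat (c S)) x"
    unfolding AE_all_countable using f_nonneg by blast
  then show ?thesis using sym_all
  proof eventually_elim
    case (elim x)
    have "0 \<le> f c x" for c
    proof -
      have "\<exists>r :: nat \<Rightarrow> rat. (\<lambda>n. of_rat (r n)) \<longlonglongrightarrow> y" for y :: real
      proof -
        have "\<exists>r :: rat. \<bar>of_rat r - y\<bar> < 1 / real (Suc n)" for n
        proof -
          obtain r :: rat where "y < of_rat r" "of_rat r < y + 1 / real (Suc n)"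
            using of_rat_dense[of y "y + 1 / real (Suc n)"] by auto
          then show ?thesis by (intro exI[of _ r]) auto
        qed
        then obtain r :: "nat \<Rightarrow> rat" where r: "\<And>n. \<bar>of_rat (r n) - y\<bar> < 1 / real (Suc n)" by metis
        have "(\<lambda>n. of_rat (r n) - y) \<longlonglongrightarrow> 0"
          by (rule tendsto_rabs_zero_cancel, rule tendsto_sandwich[OF _ _ tendsto_const LIMSEQ_Suc[OF lim_1_over_n]])
            (use r in \<open>auto intro!: always_eventually less_imp_le\<close>)
        then show ?thesis by (auto simp: LIM_zero_iff)
      qed
      then have "\<forall>S. \<exists>r :: nat \<Rightarrow> rat. (\<lambda>n. of_rat (r n)) \<longlonglongrightarrow> c S" by blast
      from choice[OF this] obtain r :: "'n set \<Rightarrow> nat \<Rightarrow> rat"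
        where r: "\<And>S. (\<lambda>n. of_rat (r S n)) \<longlonglongrightarrow> c S" by blast
      have "(\<lambda>n. f (\<lambda>S. of_rat (r S n)) x) \<longlonglongrightarrow> f c x"
        unfolding f_def by (intro tendsto_intros r)
      moreover have "0 \<le> f (\<lambda>S. of_rat (r S n)) x" for n
        using elim(1)[rule_format, of "\<lambda>S. r S n"] .
      ultimately show ?thesis by (intro LIMSEQ_le_const) auto
    qed
    then show ?case using elim(2) by (simp add: qpsd_def qsym_def f_def mult_ac)
  qed
qed

definition k :: "(real, 'n) vec \<Rightarrow> real" where
  "k x = indicator G x * hs q (Q x) (N x)"

lemma k_eq: "k x = (\<Sum>S\<in>Iq q. \<Sum>T\<in>Iq q. (indicator G x * Q x S T) * N x T S)"
  by (simp add: k_def hs_def sum_distrib_left mult.assoc)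

lemma k_int: "integrable \<nu> k"
proof -
  have "integrable \<nu> (\<lambda>x. (indicator G x * Q x S T) * N x T S)" for S T
  proof -
    have "(\<lambda>x. indicator G x *\<^sub>R Q x S T) \<in> borel_measurable borel"
      using Q_cont by (intro borel_measurable_continuous_on_indicator) auto
    then have m: "(\<lambda>x. indicator G x * Q x S T) \<in> borel_measurable \<nu>"
      by (simp add: measurable_cong_sets[OF sets_\<nu> refl])
    have "bounded ((\<lambda>x. Q x S T) ` G)"
      using compact_continuous_image[OF Q_cont G_compact] by (rule compact_imp_bounded)
    then obtain B where B: "\<And>y. y \<in> G \<Longrightarrow> \<bar>Q y S T\<bar> \<le> B" unfolding bounded_iff by auto
    have "AE x in \<nu>. \<bar>indicator G x * Q x S T\<bar> \<le> B"
      using AE_\<nu>_G by eventually_elim (simp add: B)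
    then show ?thesis by (rule integrable_mult_bounded[OF N_int m])
  qed
  then show ?thesis unfolding k_eq[abs_def] by (intro Bochner_Integration.integrable_sum)
qed

lemma k_meas [measurable]: "k \<in> borel_measurable \<nu>"
  using k_int by (rule borel_measurable_integrable)

lemma k_nonneg: "AE x in \<nu>. 0 \<le> k x"
  using N_psd
proof eventually_elim
  case (elim x)
  show ?case
  proof (cases "x \<in> G")
    case True
    then show ?thesis using hs_nonneg[OF qpd_imp_qpsd[OF Q_pd[OF True]] elim] by (simp add: k_def)
  qed (simp add: k_def)
qed

text \<open>Off \<open>G\<close> the function \<open>Q\<close> is arbitrary, possibly not measurable; \<open>k\<close> is a measurable version
  of the density.\<close>

lemma \<kappa>_eq: "\<kappa> = density \<nu> (\<lambda>x. ennreal (k x))"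
proof -
  have "(\<integral>\<^sup>+x. ennreal (hs q (Q x) (N x)) * indicator B x \<partial>\<nu>) = (\<integral>\<^sup>+x. ennreal (k x) * indicator B x \<partial>\<nu>)" for B
    using AE_\<nu>_G by (intro nn_integral_cong_AE, elim eventually_mono) (simp add: k_def)
  then show ?thesis unfolding density_def by simp
qed

lemma \<kappa>_integral:
  assumes "f \<in> borel_measurable borel"
  shows "(\<integral>x. f x \<partial>\<kappa>) = (\<integral>x. k x * f x \<partial>\<nu>)"
    and "integrable \<kappa> f \<longleftrightarrow> integrable \<nu> (\<lambda>x. k x * f x)"
proof -
  have f: "f \<in> borel_measurable \<nu>" using assms by (simp add: measurable_cong_sets[OF sets_\<nu> refl])
  show "(\<integral>x. f x \<partial>\<kappa>) = (\<integral>x. k x * f x \<partial>\<nu>)"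
    unfolding \<kappa>_eq by (rule integral_real_density[OF k_meas k_nonneg f])
  show "integrable \<kappa> f \<longleftrightarrow> integrable \<nu> (\<lambda>x. k x * f x)"
    unfolding \<kappa>_eq by (rule integrable_real_density[OF k_meas k_nonneg f])
qed

lemma \<kappa>_prob: "prob_space \<kappa>"
proof
  have "emeasure \<kappa> (space \<kappa>) = (\<integral>\<^sup>+x. ennreal (k x) \<partial>\<nu>)"
    unfolding \<kappa>_eq by (subst emeasure_density) (auto intro!: nn_integral_cong simp: indicator_def)
  also have "\<dots> = ennreal (\<integral>x. k x \<partial>\<nu>)" by (rule nn_integral_eq_integral[OF k_int k_nonneg])
  also have "(\<integral>x. k x \<partial>\<nu>) = 1" using mu_norm by (simp add: k_def[abs_def] set_lebesgue_integral_def)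
  finally show "emeasure \<kappa> (space \<kappa>) = 1" by simp
qed

lemma AE_\<kappa>I: "AE x in \<nu>. 0 < k x \<longrightarrow> P x \<Longrightarrow> AE x in \<kappa>. P x"
  unfolding \<kappa>_eq by (subst AE_density) auto

text \<open>Both sides have the same integral over every Borel set. In particular these entries of
  \<open>N\<close> vanish almost everywhere that \<open>k\<close> does, so passing from \<nu> to
  \<kappa> loses nothing.\<close>

lemma N_eq: "AE x in \<nu>. \<forall>S\<in>Iq q. \<forall>T\<in>Iq q. N x S T = k x * Mg x S T"
proof (intro AE_finite_allI)
  fix S T :: "'n set" assume ST: "S \<in> Iq q" "T \<in> Iq q"
  have int: "integrable \<nu> (\<lambda>x. k x * Mg x S T)"
    using Mg_int \<kappa>_integral(2)[OF Mg_meas] by simp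
  show "AE x in \<nu>. N x S T = k x * Mg x S T"
  proof (rule density_unique_banach[OF N_int int])
    fix B assume "B \<in> sets \<nu>"
    then have B [measurable]: "B \<in> sets borel" by simp
    note [measurable] = Mg_meas
    have "(LINT x:B|\<nu>. N x S T) = (LINT x:B|\<kappa>. Mg x S T)" by (rule Mg_dens[OF B ST])
    also have "\<dots> = (\<integral>x. k x * (indicator B x *\<^sub>R Mg x S T) \<partial>\<nu>)"
      unfolding set_lebesgue_integral_def by (rule \<kappa>_integral(1)) measurable
    also have "\<dots> = (LINT x:B|\<nu>. k x * Mg x S T)"
      unfolding set_lebesgue_integral_def by (simp add: mult_ac)
    finally show "(LINT x:B|\<nu>. N x S T) = (LINT x:B|\<nu>. k x * Mg x S T)" .
  qed
qed auto

lemma AE_\<kappa>_G: "AE x in \<kappa>. x \<in> G"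
  by (rule AE_\<kappa>I) (use AE_\<nu>_G in eventually_elim, simp)

text \<open>Where \<open>k\<close> is positive, \<open>Mg\<close> is \<open>N\<close> divided by
  \<open>k\<close>: positivity is inherited, and the normalisation restates the definition of
  \<open>k\<close>.\<close>

lemma Mg_good: "AE x in \<kappa>. qpsd q (Mg x) \<and> hs q (Q x) (Mg x) = 1"
proof (rule AE_\<kappa>I)
  show "AE x in \<nu>. 0 < k x \<longrightarrow> qpsd q (Mg x) \<and> hs q (Q x) (Mg x) = 1"
    using N_psd N_eq AE_\<nu>_G
  proof eventually_elim
    case (elim x)
    show ?case
    proof
      assume k: "0 < k x"
      have sym: "qsym q (Mg x)" using elim by (intro Mg_sym)
      have "0 \<le> (\<Sum>S\<in>Iq q. \<Sum>T\<in>Iq q. c S * Mg x S T * c T)" for c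
      proof -
        have "0 \<le> (\<Sum>S\<in>Iq q. \<Sum>T\<in>Iq q. c S * N x S T * c T)" using elim(1) by (simp add: qpsd_def)
        also have "\<dots> = k x * (\<Sum>S\<in>Iq q. \<Sum>T\<in>Iq q. c S * Mg x S T * c T)"
          unfolding sum_distrib_left by (intro sum.cong refl) (use elim(2) in \<open>simp add: mult_ac\<close>)
        finally show ?thesis using k by (simp add: zero_le_mult_iff)
      qed
      then have "qpsd q (Mg x)" using sym by (simp add: qpsd_def)
      moreover have "k x = k x * hs q (Q x) (Mg x)"
        using hs_smult_right[of q "N x" "k x" "Mg x" "Q x"] elim(2,3) by (simp add: k_def)
      ultimately show "qpsd q (Mg x) \<and> hs q (Q x) (Mg x) = 1" using k by simp
    qed
  qed
qed

lemma gw_N_int: "i \<in> {1..t} \<Longrightarrow> integrable \<nu> (gw N i)"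
proof -
  assume i: "i \<in> {1..t}"
  have "integrable \<nu> (\<lambda>y. wentry i S T y * N y T S)" for S T
  proof -
    obtain B where "\<And>y. \<bar>wentry i S T y\<bar> \<le> B" using wentry_bounded(2)[OF i] by blast
    then show ?thesis using wentry_bounded(1)[OF i]
      by (intro integrable_mult_bounded[OF N_int, of _ B]) (auto simp: measurable_cong_sets[OF sets_\<nu> refl])
  qed
  then show ?thesis unfolding gw_eq[abs_def] by (intro Bochner_Integration.integrable_sum)
qed

lemma gw_N_eq: "AE x in \<nu>. \<forall>i\<in>{1..t}. gw N i x = k x * gw Mg i x"
  using N_eq
proof eventually_elim
  case (elim x)
  have "hs q X (N x) = k x * hs q X (Mg x)" for X
    by (rule hs_smult_right) (use elim in simp)
  then show ?case by (simp add: gw_def)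
qed

text \<open>A scalar factor passes through \<open>Psi\<close> and the pairing, so the test field
  \<open>f\<close> with values \<open>\<phi> x\<close> times \<open>Q x\<close> produces the weights
  \<open>gw N\<close>, which the density relation rewrites over \<kappa>.\<close>

lemma transfer_gw:
  assumes \<phi>: "continuous_on UNIV \<phi>" "\<forall>x. 0 \<le> \<phi> x \<and> \<phi> x \<le> 1"
  shows "(\<Sum>i=1..t. \<integral>x. gw Mg i x * \<phi> (\<psi> i x) \<partial>\<kappa>) = (\<integral>x. \<phi> x \<partial>\<kappa>)"
proof -
  have \<phi>m [measurable]: "\<phi> \<in> borel_measurable borel" by (rule borel_measurable_continuous_onI[OF \<phi>(1)])
  define f where "f x S T = \<phi> x * Q x S T" for x S T
  have eig: "(LINT x:G|\<nu>. hs q (ruelle q t A \<psi> V f x) (N x)) = \<beta> * (LINT x:G|\<nu>. hs q (f x) (N x))"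
  proof (rule mu_eig)
    show "\<forall>S T. continuous_on G (\<lambda>x. f x S T)"
      unfolding f_def using Q_cont continuous_on_subset[OF \<phi>(1)] by (intro allI continuous_on_mult) auto
    show "\<forall>x\<in>G. qsym q (f x)"
      using Q_pd by (auto simp: f_def qpd_def qsym_def)
  qed
  have "indicator G x *\<^sub>R hs q (ruelle q t A \<psi> V f x) (N x) = \<beta> * (\<Sum>i=1..t. \<phi> (\<psi> i x) * gw N i x)" for x
  proof (cases "x \<in> G")
    case True
    have "hs q (ruelle q t A \<psi> V f x) (N x) = (\<Sum>i=1..t. exp (V (\<psi> i x)) * hs q (Psi q (A i) (f (\<psi> i x))) (N x))"
      unfolding ruelle_def by (rule hs_sum_left)
    also have "\<dots> = (\<Sum>i=1..t. exp (V (\<psi> i x)) * (\<phi> (\<psi> i x) * hs q (Psi q (A i) (Q (\<psi> i x))) (N x)))"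
      by (simp add: f_def[abs_def] Psi_smult hs_smult_left)
    also have "\<dots> = \<beta> * (\<Sum>i=1..t. \<phi> (\<psi> i x) * gw N i x)"
      using True \<beta>_pos by (simp add: gw_def sum_distrib_left mult_ac)
    finally show ?thesis using True by simp
  qed (simp add: gw_def)
  then have "(LINT x:G|\<nu>. hs q (ruelle q t A \<psi> V f x) (N x)) = (\<integral>x. \<beta> * (\<Sum>i=1..t. \<phi> (\<psi> i x) * gw N i x) \<partial>\<nu>)"
    by (simp add: set_lebesgue_integral_def)
  also have "\<dots> = \<beta> * (\<Sum>i=1..t. \<integral>x. \<phi> (\<psi> i x) * gw N i x \<partial>\<nu>)"
  proof -
    have "integrable \<nu> (\<lambda>x. \<phi> (\<psi> i x) * gw N i x)" if i: "i \<in> {1..t}" for i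
    proof (rule integrable_mult_bounded[OF gw_N_int[OF i], of _ 1])
      show "(\<lambda>x. \<phi> (\<psi> i x)) \<in> borel_measurable \<nu>"
        using measurable_compose[OF \<psi>_meas[OF i] \<phi>m] by (simp add: measurable_cong_sets[OF sets_\<nu> refl])
    qed (use \<phi>(2) in \<open>auto simp: abs_le_iff intro: order_trans[of _ 0]\<close>)
    then show ?thesis by (subst integral_mult_right_zero, subst Bochner_Integration.integral_sum) auto
  qed
  also have "\<dots> = \<beta> * (\<Sum>i=1..t. \<integral>x. gw Mg i x * \<phi> (\<psi> i x) \<partial>\<kappa>)"
  proof (intro arg_cong[of _ _ "\<lambda>x. \<beta> * x"] sum.cong refl)
    fix i assume i: "i \<in> {1..t}"
    have m: "(\<lambda>x. gw Mg i x * \<phi> (\<psi> i x)) \<in> borel_measurable borel"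
      using gw_meas[OF i Mg_meas] measurable_compose[OF \<psi>_meas[OF i] \<phi>m] by simp
    have m1: "(\<lambda>x. \<phi> (\<psi> i x)) \<in> borel_measurable \<nu>"
      using measurable_compose[OF \<psi>_meas[OF i] \<phi>m] by (simp add: measurable_cong_sets[OF sets_\<nu> refl])
    show "(\<integral>x. \<phi> (\<psi> i x) * gw N i x \<partial>\<nu>) = (\<integral>x. gw Mg i x * \<phi> (\<psi> i x) \<partial>\<kappa>)"
      unfolding \<kappa>_integral(1)[OF m]
    proof (rule integral_cong_AE)
      show "(\<lambda>x. \<phi> (\<psi> i x) * gw N i x) \<in> borel_measurable \<nu>"
        using m1 borel_measurable_integrable[OF gw_N_int[OF i]] by (rule borel_measurable_times)
      show "(\<lambda>x. k x * (gw Mg i x * \<phi> (\<psi> i x))) \<in> borel_measurable \<nu>"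
        using m unfolding measurable_cong_sets[OF sets_\<nu> refl, symmetric] by (rule borel_measurable_times[OF k_meas])
      show "AE x in \<nu>. \<phi> (\<psi> i x) * gw N i x = k x * (gw Mg i x * \<phi> (\<psi> i x))"
        using gw_N_eq by eventually_elim (use i in simp)
    qed
  qed
  finally have lhs: "(LINT x:G|\<nu>. hs q (ruelle q t A \<psi> V f x) (N x)) =
      \<beta> * (\<Sum>i=1..t. \<integral>x. gw Mg i x * \<phi> (\<psi> i x) \<partial>\<kappa>)" .
  have "(LINT x:G|\<nu>. hs q (f x) (N x)) = (\<integral>x. k x * \<phi> x \<partial>\<nu>)"
    unfolding set_lebesgue_integral_def
    by (rule Bochner_Integration.integral_cong[OF refl]) (simp add: f_def[abs_def] hs_smult_left k_def)
  also have "\<dots> = (\<integral>x. \<phi> x \<partial>\<kappa>)" by (rule \<kappa>_integral(1)[symmetric]) simp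
  finally show ?thesis using eig lhs \<beta>_pos by simp
qed

lemma conformal_\<kappa>: "conformal t \<psi> G Ob F \<kappa> (gw Mg)"
proof -
  interpret prob_space \<kappa> by (rule \<kappa>_prob)
  show ?thesis
  proof
    show "AE x in \<kappa>. (\<forall>i\<in>{1..t}. 0 \<le> gw Mg i x) \<and> (\<Sum>i=1..t. gw Mg i x) = 1 \<and>
        (\<forall>i. \<exists>j\<in>{1..t}. j \<noteq> i \<and> 0 < gw Mg j x)"
      using Mg_good AE_\<kappa>_G
    proof eventually_elim
      case (elim x)
      have "\<exists>j\<in>{1..t}. j \<noteq> i \<and> 0 < gw Mg j x" for i
      proof -
        \<comment> \<open>The normalisation \<open>hs q (Q x) (Mg x) = 1\<close> certifies that
          \<open>Mg x\<close> is not zero.\<close>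
        have "\<exists>j\<in>{1..t}. j \<noteq> i \<and> 0 < hs q (Psi q (A j) (Q (\<psi> j x))) (Mg x)"
          by (rule hs_Psi_two_branches[OF ND t2 q_range A_inv, of "\<lambda>j. Q (\<psi> j x)" "Mg x" "Q x"])
            (use elim in \<open>auto intro!: Q_pd \<psi>_G\<close>)
        then show ?thesis using elim \<beta>_pos by (auto simp: gw_def)
      qed
      moreover have "(\<Sum>i=1..t. gw Mg i x) = 1" using elim by (intro gw_sum) auto
      ultimately show ?case using elim by (blast intro: gw_nonneg)
    qed
  qed (use AE_\<kappa>_G gw_meas Mg_meas transfer_gw in auto)
qed

lemma \<kappa>_KV: "(\<kappa>, Mg) \<in> KV q G F Q"
proof -
  interpret cf: conformal t \<psi> G Ob F \<kappa> "gw Mg" by (rule conformal_\<kappa>)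
  have G0: "emeasure \<kappa> (UNIV - G) = 0"
    using AE_\<kappa>_G by (subst (asm) AE_iff_measurable[of "UNIV - G"]) auto
  have "emeasure \<kappa> (F -` B \<inter> G) = emeasure \<kappa> B" if B: "B \<in> sets borel" for B
  proof -
    have TB: "Tm -` B \<in> sets borel" using measurable_sets[OF Tm_meas B] by simp
    have eq: "F -` B \<inter> G = Tm -` B \<inter> G" by (auto simp: Tm_def)
    have "emeasure \<kappa> (Tm -` B \<inter> G) = emeasure \<kappa> (Tm -` B)"
      using AE_\<kappa>_G TB by (intro emeasure_eq_AE) auto
    then show ?thesis using cf.invariant[OF B] eq by simp
  qed
  moreover have "emeasure \<kappa> {x} = 0" for x
    using cf.nonatomic[of x] by (simp add: cf.emeasure_eq_measure)
  ultimately show ?thesis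
    using G0 \<kappa>_prob Mg_meas Mg_sym Mg_good unfolding KV_def by auto
qed

text \<open>The general upper bound, applied to \<open>Mg\<close>, and the lower bound for conformal
  measures meet at \<open>gent\<close>, which then cancels against the integral of the
  logarithm.\<close>

lemma press_fun_\<kappa>: "press_fun q t A \<psi> G F V Q \<kappa> Mg = ereal (ln \<beta>)"
proof -
  interpret cf: conformal t \<psi> G Ob F \<kappa> "gw Mg" by (rule conformal_\<kappa>)
  note facts = KV_facts[OF \<kappa>_KV]
  have "ks_entropy G F \<kappa> \<le> ereal (- (\<integral>x. ln (gw Mg (idx x) (Tm x)) \<partial>\<kappa>))"
    by (rule ks_entropy_le[OF C facts(1-3) gw_meas[OF _ facts(4)] facts(5,6) cf.AE_g_pos cf.ln_g_integral(1)])
  then have ks: "ks_entropy G F \<kappa> = ereal cf.gent"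
    using cf.ks_entropy_ge unfolding cf.ln_g_integral(2) by simp
  have "ext_int \<kappa> G (\<lambda>x. elog (hs q (Q x) (tPsi q (A (iota t \<psi> G x)) (Mg (F x))))) =
      ereal (- cf.gent + ln \<beta> - (LINT x:G|\<kappa>. V x))"
    unfolding cf.ln_g_integral(2)[symmetric]
    by (rule ext_int_integrable[OF facts(1-3) cf.AE_g_pos cf.ln_g_integral(1)])
  then show ?thesis unfolding press_fun_def ks by simp
qed

end

section \<open>The variational principle for affine contractions\<close>

theorem theorem1:
  fixes t q :: nat
    and A :: "nat \<Rightarrow> ((real, 'n::{finite,linorder}) vec, 'n) vec"
    and b :: "nat \<Rightarrow> (real, 'n) vec"
    and \<psi> :: "nat \<Rightarrow> (real, 'n) vec \<Rightarrow> (real, 'n) vec"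
    and G :: "((real, 'n) vec) set"
    and Ob :: "nat \<Rightarrow> ((real, 'n) vec) set"
    and F :: "(real, 'n) vec \<Rightarrow> (real, 'n) vec"
    and V :: "(real, 'n) vec \<Rightarrow> real"
    and \<alpha> \<beta> :: real
    and Q :: "(real, 'n) vec \<Rightarrow> 'n qmat"
    and \<nu> :: "((real, 'n) vec) measure"
    and N :: "(real, 'n) vec \<Rightarrow> 'n qmat"
    and Mg :: "(real, 'n) vec \<Rightarrow> 'n qmat"
  assumes t2: "t \<ge> 2"
    and q_range: "1 \<le> q" "q \<le> CARD('n)"
    and affine: "\<And>i. i \<in> {1..t} \<Longrightarrow> invertible (A i) \<and> \<psi> i = (\<lambda>x. A i *v x + b i)"
    and contr: "\<forall>i\<in>{1..t}. \<exists>C<1. C-lipschitz_on UNIV (\<psi> i)"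
    and G_compact: "compact G" and G_ne: "G \<noteq> {}"
    and G_attr: "G = (\<Union>i\<in>{1..t}. \<psi> i ` G)"
    and F2: "F2 t \<psi> G" and F3: "F3 t \<psi> G" and F4: "F4 t \<psi> G Ob"
    and ND: "NDq q t A"
    and F_G: "\<forall>x\<in>G. F x \<in> G"
    and F_inv: "\<forall>i\<in>{1..t}. \<forall>x\<in>G \<inter> Ob i. \<psi> i (F x) = x"
    and F_fix: "\<forall>x\<in>Fset t \<psi> G. \<exists>i\<in>{1..t}. \<psi> i (F x) = F x"
    and alpha: "0 < \<alpha>" "\<alpha> \<le> 1" and V_hol: "holder_on \<alpha> G V"
    \<comment> \<open>beta_{G,V} and Q_{G,V}\<close>
    and beta_pos: "\<beta> > 0"
    and Q_cont: "\<forall>S T. continuous_on G (\<lambda>x. Q x S T)"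
    and Q_pd: "\<forall>x\<in>G. qpd q (Q x)"
    and Q_eig: "\<forall>x\<in>G. \<forall>S\<in>Iq q. \<forall>T\<in>Iq q. ruelle q t A \<psi> V Q x S T = \<beta> * Q x S T"
    \<comment> \<open>mu_{G,V} = N nu (M^q-valued Borel measure on G, density N w.r.t. finite measure nu)\<close>
    and nu_sets: "sets \<nu> = sets borel" and nu_fin: "finite_measure \<nu>"
    and nu_G: "emeasure \<nu> (UNIV - G) = 0"
    and N_int: "\<forall>S T. integrable \<nu> (\<lambda>x. N x S T)"
    and mu_psd: "\<forall>B\<in>sets borel. qpsd q (\<lambda>S T. LINT x:B|\<nu>. N x S T)"
    and mu_eig: "\<And>f. \<forall>S T. continuous_on G (\<lambda>x. f x S T) \<Longrightarrow> \<forall>x\<in>G. qsym q (f x) \<Longrightarrow>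
        (LINT x:G|\<nu>. hs q (ruelle q t A \<psi> V f x) (N x)) = \<beta> * (LINT x:G|\<nu>. hs q (f x) (N x))"
    and mu_norm: "(LINT x:G|\<nu>. hs q (Q x) (N x)) = 1"
    \<comment> \<open>M_{G,V}: mu = M_{G,V} kappa, kappa = (Q, mu)_HS\<close>
    and Mg_meas: "\<forall>S T. (\<lambda>x. Mg x S T) \<in> borel_measurable borel"
    and Mg_sym: "\<forall>x\<in>G. qsym q (Mg x)"
    and Mg_int: "\<forall>S T. integrable (density \<nu> (\<lambda>x. ennreal (hs q (Q x) (N x)))) (\<lambda>x. Mg x S T)"
    and Mg_dens: "\<forall>B\<in>sets borel. \<forall>S\<in>Iq q. \<forall>T\<in>Iq q.
        (LINT x:B|\<nu>. N x S T) = (LINT x:B|density \<nu> (\<lambda>x. ennreal (hs q (Q x) (N x))). Mg x S T)"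
  shows "ereal (ln \<beta>) = press_fun q t A \<psi> G F V Q (density \<nu> (\<lambda>x. ennreal (hs q (Q x) (N x)))) Mg
       \<and> ereal (ln \<beta>) = (SUP mM\<in>KV q G F Q. press_fun q t A \<psi> G F V Q (fst mM) (snd mM))"
proof -
  have "\<exists>C. \<forall>i\<in>{1..t}. 0 \<le> C i \<and> C i < 1 \<and> (\<forall>x y. dist (\<psi> i x) (\<psi> i y) \<le> C i * dist x y)"
    using contr unfolding lipschitz_on_def by (intro bchoice) blast
  then obtain c where c: "\<And>i. i \<in> {1..t} \<Longrightarrow> 0 \<le> c i" "\<And>i. i \<in> {1..t} \<Longrightarrow> c i < 1"
      "\<And>i x y. i \<in> {1..t} \<Longrightarrow> dist (\<psi> i x) (\<psi> i y) \<le> c i * dist x y" by blast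
  \<comment> \<open>A common contraction ratio below 1, as the largest of finitely many.\<close>
  define C where "C = Max (c ` {1..t})"
  have ne: "{1..t} \<noteq> {}" using t2 by simp
  have C_ge: "c i \<le> C" if "i \<in> {1..t}" for i unfolding C_def using that by simp
  have C1: "C < 1" unfolding C_def using ne c(2) by (subst Max_less_iff) auto
  have C0: "0 \<le> C" using c(1)[of 1] C_ge[of 1] t2 by simp
  have C_contr: "dist (\<psi> i x) (\<psi> i y) \<le> C * dist x y" if "i \<in> {1..t}" for i x y
    using c(3)[OF that, of x y] mult_right_mono[OF C_ge[OF that] zero_le_dist[of x y]] by linarith
  have \<psi>_cont: "continuous_on UNIV (\<psi> i)" if "i \<in> {1..t}" for i
    using affine[OF that] by (auto intro!: continuous_intros matrix_vector_mult_linear_continuous_on)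
  have \<psi>_inj: "inj (\<psi> i)" if "i \<in> {1..t}" for i
  proof -
    have "inj ((*v) (A i))" using affine[OF that] by (simp add: inj_matrix_vector_mult)
    then show ?thesis using affine[OF that] by (auto simp: inj_def)
  qed
  have V_cont: "continuous_on G V"
  proof -
    obtain K where K: "\<And>x y. x \<in> G \<Longrightarrow> y \<in> G \<Longrightarrow> \<bar>V x - V y\<bar> \<le> K * dist x y powr \<alpha>"
      using V_hol unfolding holder_on_def by blast
    show ?thesis unfolding continuous_on_def
    proof
      fix x assume x: "x \<in> G"
      have "((\<lambda>y. K * dist y x powr \<alpha>) \<longlongrightarrow> K * dist x x powr \<alpha>) (at x within G)"
        using alpha by (intro tendsto_intros tendsto_powr') auto
      then have lim0: "((\<lambda>y. K * dist y x powr \<alpha>) \<longlongrightarrow> 0) (at x within G)" using alpha by simp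
      have "((\<lambda>y. V y - V x) \<longlongrightarrow> 0) (at x within G)"
        by (rule Lim_null_comparison[OF _ lim0]) (auto simp: eventually_at_filter intro!: always_eventually K x)
      then show "(V \<longlongrightarrow> V x) (at x within G)" by (rule LIM_zero_cancel)
    qed
  qed
  interpret finite_measure \<nu> by (rule nu_fin)
  interpret kusuoka_measure t \<psi> G Ob F q A V \<beta> C Q \<nu> N Mg
    by unfold_locales
      (fact t2 \<psi>_cont \<psi>_inj G_compact G_ne G_attr F2 F3 F4 F_G[rule_format] F_inv[rule_format]
        C0 C1 C_contr V_cont beta_pos Q_cont[rule_format] Q_pd[rule_format] Q_eig[rule_format]
        q_range affine[THEN conjunct1] ND nu_sets nu_G N_int[rule_format] mu_psd[rule_format]
        mu_eig mu_norm Mg_meas[rule_format] Mg_sym[rule_format] Mg_int[rule_format] Mg_dens[rule_format])+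
  have "(SUP mM\<in>KV q G F Q. press_fun q t A \<psi> G F V Q (fst mM) (snd mM)) = ereal (ln \<beta>)"
  proof (rule antisym)
    show "(SUP mM\<in>KV q G F Q. press_fun q t A \<psi> G F V Q (fst mM) (snd mM)) \<le> ereal (ln \<beta>)"
      by (rule SUP_least) (simp add: press_fun_le)
    \<comment> \<open>Kusuoka's pair is admissible and attains the bound, so the supremum is a
      maximum.\<close>
    show "ereal (ln \<beta>) \<le> (SUP mM\<in>KV q G F Q. press_fun q t A \<psi> G F V Q (fst mM) (snd mM))"
      by (rule SUP_upper2[OF \<kappa>_KV]) (simp add: press_fun_\<kappa>)
  qed
  then show ?thesis using press_fun_\<kappa> by simp
qed

end
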